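(* Let $k$ be an arbitrary field, let $n\geq 4$, and let $H_l\subseteq \mathbb{P}^n_k$ be a hypersurface of degree $l$ with $l-1\geq n$. Then $\dim(\mathbb{P}^1_k\times H_l)=n$ and $$p_a(\mathbb{P}^1_k\times H_l)=-\binom{l-1}{n}<0.$$ Moreover, there is a hypersurface $H_e\subseteq \mathbb{P}^{n+1}_k$ of some degree $e$ such that $\mathbb{P}^1_k\times H_l$ is birational to $H_e$, and $$p_a(\mathbb{P}^1_k\times H_l)\neq p_a(H_e)=\binom{e-1}{n+1}.$$ Hence in every dimension $n\geq 4$ there are pairs of birational projective varieties $(\mathbb{P}^1_k\times H_l, H_e)$ over $k$ with different arithmetic genus.
   Context: A projective variety $Y\subseteq \mathbb{P}^N_k$ over a field $k$ is defined by a homogeneous prime ideal $I(Y)\subseteq k[x_0,\ldots,x_N]$, i.e. $Y\cong \operatorname{Proj}(S)$ with $S=k[x_0,\ldots,x_N]/I(Y)$; it may be singular. A hypersurface of degree $d$ in $\mathbb{P}^N_k$ is the projective variety defined by an irreducible homogeneous polynomial of degree $d$. The Hilbert polynomial $P_Y(t)$ is the polynomial with $P_Y(t)=\dim_k S_t$ for all $t\gg 0$. If $r=\dim Y$, the arithmetic genus is $p_a(Y):=(-1)^r(P_Y(0)-1)$; it is independent of the choice of projective embedding. The product $\mathbb{P}^1_k\times H_l$ is the product over $k$, viewed as a projective variety via the Segre embedding. Two varieties $Y,Y'$ of the same dimension are birational if there are nonempty open subvarieties $U\subseteq Y$ and $U'\subseteq Y'$ and an isomorphism of varieties $U\cong U'$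 over $k$. By convention, $\binom{a}{b}:=0$ for integers $0\leq a<b$. *)

theory Defs
  imports
    "HOL-Analysis.Function_Topology"
    "HOL-Library.Poly_Mapping"
    "HOL-Library.Extended_Nat"
    "HOL-Computational_Algebra.Polynomial"
    "HOL-Algebra.QuotRing"
    "HOL-Algebra.Embedded_Algebras"
    "HOL-Algebra.Ring_Divisibility"
begin

section \<open>Graded algebras\<close>

text \<open>A commutative algebra over the field \<open>'k\<close>, graded by the natural numbers:
  \<open>scalar\<close> is the structure map from \<open>'k\<close>, and \<open>grade A d\<close> is the set of homogeneous
  elements of degree \<open>d\<close> (which contains zero).\<close>

record ('a, 'k) graded_algebra = "'a ring" +
  scalar :: "'k \<Rightarrow> 'a"
  grade :: "nat \<Rightarrow> 'a set"

definition homogeneous_ideal :: "'a set \<Rightarrow> ('a, 'k) graded_algebra \<Rightarrow> bool" where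
  "homogeneous_ideal I A \<longleftrightarrow> ideal I A \<and> I = Idl\<^bsub>A\<^esub> (I \<inter> (\<Union>d. grade A d))"

definition contains_irrelevant :: "'a set \<Rightarrow> ('a, 'k) graded_algebra \<Rightarrow> bool" where
  "contains_irrelevant I A \<longleftrightarrow> (\<forall>d>0. grade A d \<subseteq> I)"

definition quotient_algebra ::
    "('a, 'k) graded_algebra \<Rightarrow> 'a set \<Rightarrow> ('a set, 'k) graded_algebra" where
  "quotient_algebra A I =
     \<lparr> carrier = carrier (A Quot I), mult = mult (A Quot I), one = one (A Quot I),
       zero = zero (A Quot I), add = add (A Quot I),
       scalar = (\<lambda>c. I +>\<^bsub>A\<^esub> scalar A c),
       grade = (\<lambda>d. (\<lambda>a. I +>\<^bsub>A\<^esub> a) ` grade A d) \<rparr>"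

definition hilbert_function :: "('a, 'k) graded_algebra \<Rightarrow> nat \<Rightarrow> nat" where
  "hilbert_function A t = (THE m. ring.dimension A m (range (scalar A)) (grade A t))"

definition hilbert_polynomial :: "('a, 'k) graded_algebra \<Rightarrow> rat poly" where
  "hilbert_polynomial A =
     (THE P. \<forall>\<^sub>F t in sequentially. poly P (of_nat t) = of_nat (hilbert_function A t))"


section \<open>Proj of a graded domain\<close>

definition Proj_points :: "('a, 'k) graded_algebra \<Rightarrow> 'a set set" where
  "Proj_points A = {p. primeideal p A \<and> homogeneous_ideal p A \<and> \<not> contains_irrelevant p A}"

text \<open>The Zariski topology, generated by the sets of points at which a given homogeneous
  element does not vanish.\<close>

definition Proj :: "('a, 'k) graded_algebra \<Rightarrow> 'a set topology" where
  "Proj A = topology_generated_by {{p \<in> Proj_points A. f \<notin> p} | f. f \<in> (\<Union>d. grade A d)}"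

text \<open>For a graded domain \<open>A\<close>, the function field of \<open>Proj A\<close> consists of the fractions
  \<open>a/f\<close> of homogeneous elements of equal degree with \<open>f \<noteq> 0\<close>. The fraction \<open>a/f\<close> is
  represented by its equivalence class, the set of all such pairs \<open>(b, g)\<close> with
  \<open>a g = b f\<close>.\<close>

definition fraction :: "('a, 'k) graded_algebra \<Rightarrow> 'a \<Rightarrow> 'a \<Rightarrow> ('a \<times> 'a) set" where
  "fraction A a f =
     {(b, g). \<exists>d. b \<in> grade A d \<and> g \<in> grade A d \<and> g \<noteq> \<zero>\<^bsub>A\<^esub> \<and> a \<otimes>\<^bsub>A\<^esub> g = b \<otimes>\<^bsub>A\<^esub> f}"

definition function_field :: "('a, 'k) graded_algebra \<Rightarrow> ('a \<times> 'a) set ring" where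
  "function_field A =
     \<lparr> carrier = {fraction A a f | a f d. a \<in> grade A d \<and> f \<in> grade A d \<and> f \<noteq> \<zero>\<^bsub>A\<^esub>},
       mult = (\<lambda>x y. \<Union>(a, f)\<in>x. \<Union>(b, g)\<in>y. fraction A (a \<otimes>\<^bsub>A\<^esub> b) (f \<otimes>\<^bsub>A\<^esub> g)),
       one = fraction A \<one>\<^bsub>A\<^esub> \<one>\<^bsub>A\<^esub>,
       zero = fraction A \<zero>\<^bsub>A\<^esub> \<one>\<^bsub>A\<^esub>,
       add = (\<lambda>x y. \<Union>(a, f)\<in>x. \<Union>(b, g)\<in>y.
                fraction A (a \<otimes>\<^bsub>A\<^esub> g \<oplus>\<^bsub>A\<^esub> b \<otimes>\<^bsub>A\<^esub> f) (f \<otimes>\<^bsub>A\<^esub> g)) \<rparr>"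

text \<open>The local ring at \<open>p\<close>, i.e. the degree zero part of the localisation of \<open>A\<close> at the
  homogeneous elements outside \<open>p\<close>, as a subring of the function field.\<close>

definition local_ring :: "('a, 'k) graded_algebra \<Rightarrow> 'a set \<Rightarrow> ('a \<times> 'a) set set" where
  "local_ring A p = {fraction A a f | a f d. a \<in> grade A d \<and> f \<in> grade A d \<and> f \<notin> p}"

text \<open>Sections of the structure sheaf over a nonempty open set \<open>V\<close>: since \<open>Proj A\<close> is
  integral, these are the rational functions that are regular at every point of \<open>V\<close>, and
  the restriction maps are inclusions. (The definition is not meant to be used for the empty
  set, over which the sections form the zero ring.)\<close>

definition sections :: "('a, 'k) graded_algebra \<Rightarrow> 'a set set \<Rightarrow> ('a \<times> 'a) set ring" where
  "sections A V = function_field A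
     \<lparr> carrier := {s \<in> carrier (function_field A). \<forall>p\<in>V. s \<in> local_ring A p} \<rparr>"

text \<open>Isomorphism over \<open>'k\<close> between an open subvariety \<open>U\<close> of \<open>Proj A\<close> and an open subvariety
  \<open>U'\<close> of \<open>Proj B\<close>: a homeomorphism together with an isomorphism of the sheaves of algebras
  over \<open>'k\<close>. The induced maps on stalks are ring isomorphisms between local rings, hence
  automatically local.\<close>

definition open_subvarieties_isomorphic ::
    "('a, 'k) graded_algebra \<Rightarrow> 'a set set \<Rightarrow> ('b, 'k) graded_algebra \<Rightarrow> 'b set set \<Rightarrow> bool" where
  "open_subvarieties_isomorphic A U B U' \<longleftrightarrow>
     (\<exists>\<phi> \<psi>.
        homeomorphic_map (subtopology (Proj A) U) (subtopology (Proj B) U') \<phi> \<and>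
        (\<forall>V. openin (Proj B) V \<and> V \<subseteq> U' \<and> V \<noteq> {} \<longrightarrow>
           \<psi> V \<in> ring_iso (sections B V) (sections A {p \<in> U. \<phi> p \<in> V}) \<and>
           (\<forall>c. \<psi> V (fraction B (scalar B c) \<one>\<^bsub>B\<^esub>) = fraction A (scalar A c) \<one>\<^bsub>A\<^esub>)) \<and>
        (\<forall>V W. openin (Proj B) V \<and> openin (Proj B) W \<and> W \<subseteq> V \<and> V \<subseteq> U' \<and> W \<noteq> {} \<longrightarrow>
           (\<forall>s\<in>carrier (sections B V). \<psi> W s = \<psi> V s)))"


section \<open>Krull dimension of a topological space\<close>

definition irreducible_closed :: "'a topology \<Rightarrow> 'a set \<Rightarrow> bool" where
  "irreducible_closed X Z \<longleftrightarrow> closedin X Z \<and> Z \<noteq> {} \<and>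
     (\<forall>C D. closedin X C \<and> closedin X D \<and> Z \<subseteq> C \<union> D \<longrightarrow> Z \<subseteq> C \<or> Z \<subseteq> D)"

definition krull_dim :: "'a topology \<Rightarrow> enat" where
  "krull_dim X = (SUP m \<in> {m. \<exists>Z. (\<forall>i\<le>m. irreducible_closed X (Z i)) \<and>
                                  (\<forall>i<m. Z i \<subset> Z (Suc i))}. enat m)"


section \<open>Polynomial rings\<close>

text \<open>Polynomials in variables indexed by \<open>nat\<close>: a monomial is a finitely supported exponent
  vector.\<close>

type_synonym 'k mpoly = "(nat \<Rightarrow>\<^sub>0 nat) \<Rightarrow>\<^sub>0 'k"

definition Const :: "'k::zero \<Rightarrow> 'k mpoly" where
  "Const c = Poly_Mapping.single 0 c"

definition Var :: "nat \<Rightarrow> 'k::zero_neq_one mpoly" where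
  "Var i = Poly_Mapping.single (Poly_Mapping.single i 1) 1"

definition monomial_degree :: "(nat \<Rightarrow>\<^sub>0 nat) \<Rightarrow> nat" where
  "monomial_degree m = (\<Sum>i\<in>Poly_Mapping.keys m. Poly_Mapping.lookup m i)"

definition substitute :: "(nat \<Rightarrow> 'k mpoly) \<Rightarrow> 'k mpoly \<Rightarrow> 'k::field mpoly" where
  "substitute \<sigma> F = (\<Sum>m\<in>Poly_Mapping.keys F. Const (Poly_Mapping.lookup F m) *
                      (\<Prod>i\<in>Poly_Mapping.keys m. \<sigma> i ^ Poly_Mapping.lookup m i))"

text \<open>\<open>polynomial_algebra N\<close> is the graded ring \<open>k[x_0, ..., x_N]\<close> in \<open>N + 1\<close> variables.\<close>

definition polynomials_in :: "nat \<Rightarrow> 'k::field mpoly set" where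
  "polynomials_in N = {F. \<forall>m\<in>Poly_Mapping.keys F. Poly_Mapping.keys m \<subseteq> {..N}}"

definition polynomial_algebra :: "nat \<Rightarrow> ('k::field mpoly, 'k) graded_algebra" where
  "polynomial_algebra N =
     \<lparr> carrier = polynomials_in N, mult = (*), one = 1, zero = 0, add = (+),
       scalar = Const,
       grade = (\<lambda>d. {F \<in> polynomials_in N.
                       \<forall>m\<in>Poly_Mapping.keys F. monomial_degree m = d}) \<rparr>"


section \<open>Projective varieties\<close>

text \<open>A subscheme of projective \<open>N\<close>-space, given by \<open>N\<close> and an ideal of \<open>k[x_0, ..., x_N]\<close>.\<close>

record (overloaded) 'k projective_scheme =
  ambient :: nat
  vanishing_ideal :: "'k mpoly set"

definition projective_variety :: "'k::field projective_scheme \<Rightarrow> bool" where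
  "projective_variety Y \<longleftrightarrow>
     (let R = polynomial_algebra (ambient Y); I = vanishing_ideal Y
      in primeideal I R \<and> homogeneous_ideal I R \<and> \<not> contains_irrelevant I R)"

definition coordinate_ring ::
    "'k::field projective_scheme \<Rightarrow> ('k mpoly set, 'k) graded_algebra" where
  "coordinate_ring Y = quotient_algebra (polynomial_algebra (ambient Y)) (vanishing_ideal Y)"

definition dimension_of :: "'k::field projective_scheme \<Rightarrow> enat" where
  "dimension_of Y = krull_dim (Proj (coordinate_ring Y))"

definition arithmetic_genus :: "'k::field projective_scheme \<Rightarrow> rat" where
  "arithmetic_genus Y = (-1) ^ the_enat (dimension_of Y) *
     (poly (hilbert_polynomial (coordinate_ring Y)) 0 - 1)"

definition hypersurface :: "nat \<Rightarrow> nat \<Rightarrow> 'k::field projective_scheme \<Rightarrow> bool" where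
  "hypersurface N d Y \<longleftrightarrow> projective_variety Y \<and> ambient Y = N \<and>
     (\<exists>f. f \<in> grade (polynomial_algebra N) d \<and>
          ring_irreducible\<^bsub>polynomial_algebra N\<^esub> f \<and>
          vanishing_ideal Y = PIdl\<^bsub>polynomial_algebra N\<^esub> f)"

definition projective_space :: "nat \<Rightarrow> 'k::field projective_scheme" where
  "projective_space N = \<lparr> ambient = N, vanishing_ideal = {0} \<rparr>"

text \<open>The product over \<open>k\<close> in its Segre embedding. For \<open>Y\<close> in projective \<open>M\<close>-space with ideal
  \<open>I\<close> and \<open>Z\<close> in projective \<open>N\<close>-space with ideal \<open>J\<close>, it is the subscheme of projective
  space of dimension \<open>(M + 1)(N + 1) - 1\<close> with coordinates \<open>z_ij\<close> (for \<open>i \<le> M\<close>, \<open>j \<le> N\<close>)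
  defined by the kernel of the map \<open>z_ij \<mapsto> x_i \<otimes> y_j\<close> from \<open>k[z_ij]\<close> to the tensor product
  over \<open>k\<close> of \<open>k[x_0, ..., x_M]/I\<close> and \<open>k[y_0, ..., y_N]/J\<close>. That tensor product is
  \<open>k[x_0, ..., x_M, y_0, ..., y_N]/(I + J)\<close>. The variable \<open>x_i\<close> is numbered \<open>i\<close>,
  \<open>y_j\<close> is numbered \<open>M + 1 + j\<close>, and \<open>z_ij\<close> is numbered \<open>i (N + 1) + j\<close>.\<close>

definition segre_product ::
    "'k::field projective_scheme \<Rightarrow> 'k projective_scheme \<Rightarrow> 'k projective_scheme" where
  "segre_product Y Z =
     (let M = ambient Y; N = ambient Z;
          K = Idl\<^bsub>polynomial_algebra (M + N + 1)\<^esub>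
                (vanishing_ideal Y \<union> substitute (\<lambda>j. Var (M + 1 + j)) ` vanishing_ideal Z);
          D = (M + 1) * (N + 1) - 1
      in \<lparr> ambient = D,
           vanishing_ideal =
             {F \<in> polynomials_in D.
                substitute (\<lambda>q. Var (q div (N + 1)) * Var (M + 1 + q mod (N + 1))) F \<in> K} \<rparr>)"

definition birational :: "'k::field projective_scheme \<Rightarrow> 'k projective_scheme \<Rightarrow> bool" where
  "birational Y Z \<longleftrightarrow> dimension_of Y = dimension_of Z \<and>
     (\<exists>U U'. openin (Proj (coordinate_ring Y)) U \<and> U \<noteq> {} \<and>
             openin (Proj (coordinate_ring Z)) U' \<and> U' \<noteq> {} \<and>
             open_subvarieties_isomorphic (coordinate_ring Y) U (coordinate_ring Z) U')"

end

theory Submission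
  imports Defs
begin

text \<open>
  Let \<open>H = V(f)\<close> be a hypersurface of degree \<open>l\<close> in projective \<open>n\<close>-space. The hypersurface
  birational to \<open>P^1 \<times> H\<close> is the cone over \<open>H\<close>: the zero locus of the same \<open>f\<close> in one
  more variable \<open>w\<close>. The open part of the cone where \<open>y_0\<close> does not vanish is the product of the
  affine line with an affine chart of \<open>H\<close>, and so is the open part of \<open>P^1 \<times> H\<close> where
  \<open>x_0 y_0\<close> does not vanish. This comparison takes no primitive element of the function field,
  so it makes no demand on the ground field. As \<open>f\<close> is still prime after the variable \<open>w\<close> has
  been adjoined (\<open>cone_prime\<close>), the cone is again a hypersurface of degree \<open>l\<close>.

  The two charts are compared without leaving polynomial rings. In the Segre coordinates
  \<open>z_ij = x_i y_j\<close>, the substitution \<open>\<alpha>\<close> sends \<open>y_j\<close> to \<open>z_0j\<close> and \<open>w\<close> to \<open>z_10\<close>, while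
  \<open>\<beta>\<close> sends \<open>z_0j\<close> to \<open>y_0 y_j\<close> and \<open>z_1j\<close> to \<open>w y_j\<close>. Modulo the defining ideals, both
  composites multiply a form of degree \<open>d\<close> by the \<open>d\<close>-th power of \<open>y_0\<close> or of \<open>z_00\<close>, hence they
  are invertible as soon as this linear form is invertible. Taking preimages of primes and
  substituting in fractions then gives the homeomorphism and the isomorphism of sheaves
  (\<open>charts_isomorphic\<close>). The same \<open>\<beta>\<close> shows that the ideal of the Segre product is the
  preimage of the ideal of the cone, and therefore prime (\<open>IX_pullback\<close>).

  Hilbert functions are computed from one exact sequence: for a homogeneous ideal \<open>I\<close> and a form
  \<open>a\<close> of degree \<open>e\<close>, the Hilbert function of \<open>I\<close> in degree \<open>t + e\<close> is that of \<open>(I : a)\<close> in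
  degree \<open>t\<close> plus that of \<open>I + (a)\<close> in degree \<open>t + e\<close> (\<open>hilb_exact\<close>). For a hypersurface of
  degree \<open>l\<close> in projective \<open>N\<close>-space it gives the Hilbert polynomial
  \<open>binom(t + N, N) - binom(t + N - l, N)\<close>, with value \<open>1 - (-1)^N binom(l - 1, N)\<close> at \<open>0\<close>. The
  degree \<open>t\<close> part of the Segre ring consists of \<open>t + 1\<close> copies of the degree \<open>t\<close> part of the
  coordinate ring of \<open>H\<close>, so the Hilbert polynomial of the product is \<open>t + 1\<close> times that of \<open>H\<close>,
  and takes the same value at \<open>0\<close>. But the product has dimension \<open>n\<close> where \<open>H\<close> has dimension
  \<open>n - 1\<close>: the sign changes, and the genus of the product is \<open>- binom(l - 1, n) < 0\<close>. The cone
  has genus \<open>binom(l - 1, n + 1) \<ge> 0\<close>, so the two differ.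

  Dimensions are also read off from Hilbert functions: the Krull dimension of \<open>Proj\<close> is the
  degree of growth (\<open>krull_dim_by_growth\<close>). Along a chain of \<open>m + 1\<close> homogeneous primes, the
  exact sequence forces growth of degree at least \<open>m\<close> (\<open>chain_hilb_lower_bound\<close>). Conversely, an
  ideal that is maximal among the homogeneous ideals of large growth is prime, again by the
  exact sequence, and such primes can be stacked into a chain (\<open>prime_step\<close>). Maximal ideals of
  this kind exist by the ascending chain condition, which follows from Dickson's lemma applied
  to leading monomials (\<open>hideal_wf\<close>).

  That hypersurfaces of every degree exist is seen from \<open>y_2^l - y_1 y_0^(l-1)\<close>, which generates
  the kernel of a monomial parametrisation (\<open>toric_dvd_iff\<close>).
\<close>

section \<open>Relative dimension of nested vector spaces\<close>

text \<open>A separate name for the locale of vector spaces, so that the notions below are not inherited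
  by the real vector spaces. The relation \<open>reldim W E n\<close> says that \<open>E / W\<close> has dimension \<open>n\<close>,
  without forming the quotient: \<open>E\<close> is reached from \<open>W\<close> in \<open>n\<close> steps, each adjoining a line. The
  definition of dimension over a subfield of a ring has this shape as well, so that results are
  transported to graded algebras by a simple induction.\<close>

locale nested_vector_spaces = vector_space
begin

inductive reldim :: "'b set \<Rightarrow> 'b set \<Rightarrow> nat \<Rightarrow> bool" for W where
  reldim_refl: "reldim W W 0"
| reldim_step: "reldim W E n \<Longrightarrow> v \<notin> E \<Longrightarrow> reldim W {scale c v + e |c e. e \<in> E} (Suc n)"

lemma subspace_line_extension:
  assumes "subspace E"
  shows "subspace {scale c v + e |c e. e \<in> E}"
  unfolding subspace_def
proof (intro conjI ballI allI)
  show "0 \<in> {scale c v + e |c e. e \<in> E}"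
    using subspace_0[OF assms] by (auto intro!: exI[of _ 0])
next
  fix x y assume "x \<in> {scale c v + e |c e. e \<in> E}" "y \<in> {scale c v + e |c e. e \<in> E}"
  then obtain c e d e' where *: "x = scale c v + e" "y = scale d v + e'" "e \<in> E" "e' \<in> E" by auto
  have "x + y = scale (c + d) v + (e + e')" by (simp add: * scale_left_distrib algebra_simps)
  with * subspace_add[OF assms] show "x + y \<in> {scale c v + e |c e. e \<in> E}" by blast
next
  fix a x assume "x \<in> {scale c v + e |c e. e \<in> E}"
  then obtain c e where *: "x = scale c v + e" "e \<in> E" by auto
  have "scale a x = scale (a * c) v + scale a e" by (simp add: * scale_right_distrib)
  with * subspace_scale[OF assms] show "scale a x \<in> {scale c v + e |c e. e \<in> E}" by blast
qed

lemma reldim_subspace: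
  assumes "reldim W E n" "subspace W"
  shows "subspace E" "W \<subseteq> E"
proof -
  from assms have "subspace E \<and> W \<subseteq> E"
  proof (induction rule: reldim.induct)
    case (reldim_step E n v)
    then have "E \<subseteq> {scale c v + e |c e. e \<in> E}" 
      by (intro subsetI CollectI) (metis scale_zero_left add_0_left)
    with reldim_step subspace_line_extension[of E v] show ?case by blast
  qed auto
  then show "subspace E" "W \<subseteq> E" by auto
qed

lemma reldim_trans: "reldim W E m \<Longrightarrow> reldim U W n \<Longrightarrow> reldim U E (n + m)"
  by (induction rule: reldim.induct) (auto intro: reldim.intros)

lemma span_insert_line: "span (insert v S) = {scale k v + e |k e. e \<in> span S}"
proof (rule subset_antisym; rule subsetI)
  fix x assume "x \<in> span (insert v S)"
  then obtain k where "x - scale k v \<in> span S" by (auto simp: span_insert)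
  then show "x \<in> {scale k v + e |k e. e \<in> span S}"
    by (auto intro!: exI[of _ k] exI[of _ "x - scale k v"])
next
  fix x assume "x \<in> {scale k v + e |k e. e \<in> span S}"
  then obtain k e where "x = scale k v + e" "e \<in> span S" by auto
  then have "x - scale k v \<in> span S" by simp
  then show "x \<in> span (insert v S)" by (auto simp: span_insert)
qed

lemma reldim_span:
  assumes "finite C" "independent (B \<union> C)" "B \<inter> C = {}"
  shows "reldim (span B) (span (B \<union> C)) (card C)"
  using assms
proof (induction rule: finite_induct)
  case empty
  then show ?case by (simp add: reldim_refl)
next
  case (insert c C)
  have ind: "independent (insert c (B \<union> C))" and "c \<notin> B \<union> C" using insert by auto
  then have "c \<notin> span (B \<union> C)" by (simp add: independent_insert)
  moreover have "reldim (span B) (span (B \<union> C)) (card C)"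
    using insert independent_mono[OF ind, of "B \<union> C"] by auto
  ultimately have "reldim (span B) {scale k c + e |k e. e \<in> span (B \<union> C)} (Suc (card C))"
    by (rule reldim_step[rotated])
  moreover have "{scale k c + e |k e. e \<in> span (B \<union> C)} = span (insert c (B \<union> C))"
    by (simp add: span_insert_line)
  ultimately show ?case using insert by simp
qed

lemma reldim_exists:
  assumes "subspace W" "subspace E" "W \<subseteq> E" "E \<subseteq> span S" "finite S"
  shows "\<exists>n. reldim W E n"
proof -
  obtain B where B: "B \<subseteq> W" "independent B" "W \<subseteq> span B"
    using maximal_independent_subset[of W] .
  have "B \<subseteq> E" using B assms by auto
  then obtain D where D: "B \<subseteq> D" "D \<subseteq> E" "independent D" "E \<subseteq> span D"
    using maximal_independent_subset_extend[OF _ B(2)] by metis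
  have "finite D" using independent_span_bound[OF \<open>finite S\<close> D(3)] D assms by auto
  then have "reldim (span B) (span (B \<union> (D - B))) (card (D - B))"
    using D by (intro reldim_span) (auto simp: Un_absorb1)
  moreover have "span B = W" using B assms(1) span_minimal by blast
  moreover have "span D = E" using D assms(2) span_minimal by blast
  ultimately show ?thesis using D(1) by (auto simp: Un_absorb1)
qed

lemma reldim_zero_basis:
  assumes "reldim {0} E n"
  shows "\<exists>B. finite B \<and> independent B \<and> span B = E \<and> card B = n"
  using assms
proof (induction rule: reldim.induct)
  case reldim_refl
  then show ?case by (intro exI[of _ "{}"]) (auto simp: span_empty independent_empty)
next
  case (reldim_step E n v)
  then obtain B where B: "finite B" "independent B" "span B = E" "card B = n" by auto
  have "span (insert v B) = {scale k v + e |k e. e \<in> E}"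
    by (simp add: span_insert_line B(3))
  moreover have "v \<notin> B" using reldim_step(2) span_superset[of B] unfolding B(3) by auto
  moreover have "independent (insert v B)" using B reldim_step(2) by (simp add: independent_insertI)
  ultimately show ?case using B by (intro exI[of _ "insert v B"]) auto
qed

lemma reldim_zero_unique:
  assumes "reldim {0} E n" "reldim {0} E m"
  shows "n = m"
  using reldim_zero_basis[OF assms(1)] reldim_zero_basis[OF assms(2)] dim_span_eq_card_independent
  by metis

lemma reldim_unique:
  assumes W: "subspace W" and n: "reldim W E n" and m: "reldim W E m"
    and S: "E \<subseteq> span S" "finite S"
  shows "n = m"
proof -
  have "W \<subseteq> span S" using reldim_subspace(2)[OF n W] S by auto
  then obtain a where a: "reldim {0} W a"
    using reldim_exists[of "{0}" W S] W S subspace_0 by (auto simp: subspace_def)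
  from reldim_zero_unique[OF reldim_trans[OF n a] reldim_trans[OF m a]] show ?thesis by simp
qed

text \<open>If the preimage of \<open>W'\<close> in \<open>E\<close> is \<open>W\<close>, then \<open>T\<close> induces an isomorphism from \<open>E / W\<close> onto
  \<open>(T E + W') / W'\<close>. Every dimension count below is an instance.\<close>

lemma reldim_image:
  assumes "reldim W E n" "subspace W" "subspace W'"
    and add: "\<And>x y. T (x + y) = T x + T y" and scl: "\<And>c x. T (scale c x) = scale c (T x)"
    and ker: "\<And>x. x \<in> E \<Longrightarrow> T x \<in> W' \<longleftrightarrow> x \<in> W"
  shows "reldim W' {T x + w |x w. x \<in> E \<and> w \<in> W'} n"
  using assms(1,2) ker
proof (induction rule: reldim.induct)
  case reldim_refl
  have "T 0 = 0" using scl[of 0 0] by simp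
  have "{T x + w |x w. x \<in> W \<and> w \<in> W'} = W'"
    using reldim_refl subspace_0[OF assms(2)] \<open>T 0 = 0\<close> subspace_add[OF assms(3)]
    by (auto) (metis add_0_left)
  then show ?case by (simp add: reldim.reldim_refl)
next
  case (reldim_step E n v)
  let ?E = "{scale c v + e |c e. e \<in> E}"
  let ?F = "{T x + w |x w. x \<in> E \<and> w \<in> W'}"
  note E = reldim_subspace[OF reldim_step(1) assms(2)]
  have sub: "E \<subseteq> ?E" 
      by (intro subsetI CollectI) (metis scale_zero_left add_0_left)
  have "v \<in> ?E" using subspace_0[OF E(1)] by (auto intro!: exI[of _ 1])
  have Tv: "T v \<notin> ?F"
  proof
    assume "T v \<in> ?F"
    then obtain e w where e: "T v = T e + w" "e \<in> E" "w \<in> W'" by auto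
    from e have Tve: "T (v - e) = w" using add[of "v - e" e] by simp
  have "v - e \<in> ?E"
      using subspace_diff[OF subspace_line_extension[OF E(1)] \<open>v \<in> ?E\<close>] e sub by blast
    then have "v - e \<in> W" using reldim_step(5)[of "v - e"] e Tve by simp
    then have "(v - e) + e \<in> E" using E e subspace_add by blast
    with reldim_step(2) show False by simp
  qed
  have "reldim W' ?F n" using reldim_step sub by blast
  from reldim.reldim_step[OF this Tv] 
  have "reldim W' {scale c (T v) + e |c e. e \<in> ?F} (Suc n)" .
  moreover have "{scale c (T v) + e |c e. e \<in> ?F} = {T x + w |x w. x \<in> ?E \<and> w \<in> W'}"
    apply (auto simp: add scl)
    apply (metis (no_types, lifting) add.assoc add scl)
    by (metis (no_types, lifting) add.assoc)
  ultimately show ?case by simp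
qed

end

section \<open>Terms of polynomials\<close>

abbreviation lookup where "lookup \<equiv> Poly_Mapping.lookup"
abbreviation keys where "keys \<equiv> Poly_Mapping.keys"

lemma Const_simps: "Const (a + b) = Const a + Const b" "Const (a * b) = Const a * Const b"
   "Const (0::'k::field) = 0" "Const (1::'k::field) = 1" "Const (- a) = - Const (a::'k::field)"
  for a b :: "'k::field"
  by (simp_all add: Const_def single_add mult_single single_uminus)

lemma lookup_Const_mult: "lookup (Const c * F) m = c * lookup F m" for F :: "'k::field mpoly"
  by (simp add: Const_def Poly_Mapping.map.rep_eq when_def flip: mult_map_scale_conv_mult)

global_interpretation mp: nested_vector_spaces "\<lambda>c (F :: 'k::field mpoly). Const c * F"
  by unfold_locales (auto simp: Const_simps algebra_simps)

lemma keys_add_subset: "keys (F + G) \<subseteq> keys F \<union> keys G" for F :: "'a \<Rightarrow>\<^sub>0 'b::comm_monoid_add"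
  by (auto simp: in_keys_iff lookup_add)

lemma keys_mult_subset: "keys (F * G) \<subseteq> {a + b |a b. a \<in> keys F \<and> b \<in> keys G}"
  for F G :: "'k::field mpoly"
  by (rule keys_mult)

lemma keys_Const: "keys (Const c) \<subseteq> {0}" by (simp add: Const_def)

lemma keys_add_nat: "keys (a + b) = keys a \<union> keys b" for a b :: "nat \<Rightarrow>\<^sub>0 nat"
  by (auto simp: in_keys_iff lookup_add)

lemma poly_expand_superset:
  "finite S \<Longrightarrow> keys F \<subseteq> S \<Longrightarrow> F = (\<Sum>m\<in>S. Poly_Mapping.single m (lookup F m))"
  by (rule poly_mapping_eqI) (auto simp: lookup_sum lookup_single when_def in_keys_iff)

lemma poly_expand: "F = (\<Sum>m\<in>keys F. Poly_Mapping.single m (lookup F m))"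
  by (rule poly_expand_superset) auto

definition part :: "(nat \<Rightarrow>\<^sub>0 nat) set \<Rightarrow> 'k::field mpoly \<Rightarrow> 'k mpoly" where
  "part M F = Poly_Mapping.mapp (\<lambda>m c. if m \<in> M then c else 0) F"

definition supported :: "(nat \<Rightarrow>\<^sub>0 nat) set \<Rightarrow> 'k::field mpoly set" where
  "supported M = {F. keys F \<subseteq> M}"

lemma lookup_part: "lookup (part M F) m = (if m \<in> M then lookup F m else 0)"
  by (auto simp: part_def lookup_mapp when_def in_keys_iff)

lemma keys_part: "keys (part M F) = keys F \<inter> M"
  by (auto simp: in_keys_iff lookup_part split: if_splits)

lemma part_add: "part M (F + G) = part M F + part M G"
  by (rule poly_mapping_eqI) (auto simp: lookup_part lookup_add)

lemma part_zero [simp]: "part M 0 = 0"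
  by (rule poly_mapping_eqI) (auto simp: lookup_part)

lemma part_sum: "part M (sum f A) = (\<Sum>a\<in>A. part M (f a))"
  by (induction A rule: infinite_finite_induct) (auto simp: part_add)

lemma part_id: "keys F \<subseteq> M \<Longrightarrow> part M F = F"
  by (rule poly_mapping_eqI) (auto simp: lookup_part in_keys_iff)

lemma part_disjoint: "keys F \<inter> M = {} \<Longrightarrow> part M F = 0"
  by (rule poly_mapping_eqI) (auto simp: lookup_part in_keys_iff)

lemma supported_subspace: "mp.subspace (supported M :: 'k::field mpoly set)"
  unfolding mp.subspace_def supported_def
  by (auto dest: subsetD[OF keys_add_subset]) (auto simp: in_keys_iff lookup_Const_mult)

lemma supported_basis:
  fixes M :: "(nat \<Rightarrow>\<^sub>0 nat) set"
  defines "B \<equiv> (\<lambda>m. Poly_Mapping.single m (1::'k::field)) ` M"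
  assumes "finite M"
  shows "mp.independent B" "mp.span B = supported M" "card B = card M"
proof -
  have inj: "inj_on (\<lambda>m. Poly_Mapping.single m (1::'k)) M"
    by (rule inj_onI) (metis lookup_single_eq lookup_single_not_eq zero_neq_one)
  then show "card B = card M" unfolding B_def by (rule card_image)
  show "mp.independent B"
  proof (rule mp.independent_if_scalars_zero)
    show "finite B" using assms by simp
    fix f :: "'k mpoly \<Rightarrow> 'k" and x
    assume sum: "(\<Sum>x\<in>B. Const (f x) * x) = 0" and "x \<in> B"
    then obtain m where m: "m \<in> M" "x = Poly_Mapping.single m 1" unfolding B_def by auto
    have "(\<Sum>x\<in>B. Const (f x) * x) = (\<Sum>m\<in>M. Const (f (Poly_Mapping.single m 1)) * Poly_Mapping.single m 1)"
      unfolding B_def by (rule sum.reindex_cong[OF inj]) auto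
    with sum have "lookup (\<Sum>m\<in>M. Const (f (Poly_Mapping.single m 1)) * Poly_Mapping.single m 1) m = 0" by simp
    then show "f x = 0" using m \<open>finite M\<close> by (simp add: lookup_sum lookup_Const_mult lookup_single when_def if_distrib[where f="(*) _"] cong: if_cong)
  qed
  show "mp.span B = supported M"
  proof
    show "mp.span B \<subseteq> supported M"
      by (rule mp.span_minimal[OF _ supported_subspace]) (auto simp: B_def supported_def)
    show "supported M \<subseteq> mp.span B"
    proof
      fix F :: "'k mpoly" assume "F \<in> supported M"
      then have F: "keys F \<subseteq> M" by (simp add: supported_def)
      have "F = (\<Sum>m\<in>keys F. Const (lookup F m) * Poly_Mapping.single m 1)"
        by (subst poly_expand) (simp add: Const_def mult_single)
      also have "\<dots> \<in> mp.span B"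
        using F unfolding B_def by (intro mp.span_sum mp.span_scale mp.span_base) auto
      finally show "F \<in> mp.span B" .
    qed
  qed
qed

lemma reldim_supported:
  "finite M \<Longrightarrow> mp.reldim {0} (supported M :: 'k::field mpoly set) (card M)"
  using mp.reldim_span[of "(\<lambda>m. Poly_Mapping.single m (1::'k)) ` M" "{}"] supported_basis[of M, where 'k='k]
  by (simp add: mp.span_empty)

section \<open>Additive weights\<close>

definition weight :: "((nat \<Rightarrow>\<^sub>0 nat) \<Rightarrow> nat) \<Rightarrow> bool" where
  "weight w \<longleftrightarrow> (\<forall>a b. w (a + b) = w a + w b)"

abbreviation wpart :: "((nat \<Rightarrow>\<^sub>0 nat) \<Rightarrow> nat) \<Rightarrow> nat \<Rightarrow> 'k::field mpoly \<Rightarrow> 'k mpoly" where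
  "wpart w d F \<equiv> part {m. w m = d} F"

lemma weightD: "weight w \<Longrightarrow> w (a + b) = w a + w b" by (simp add: weight_def)
lemma weight_zero: "weight w \<Longrightarrow> w 0 = 0" using weightD[of w 0 0] by simp

lemma weight_homogeneous_mult:
  fixes F G :: "'k::field mpoly"
  assumes "weight w" "\<forall>m\<in>keys F. w m = a" "\<forall>m\<in>keys G. w m = b"
  shows "\<forall>m\<in>keys (F * G). w m = a + b"
  using keys_mult_subset[of F G] assms by (fastforce simp: weightD)

lemma part_expand: 
  assumes "finite D" "w ` keys F \<subseteq> D" 
  shows "F = (\<Sum>d\<in>D. wpart w d F)"
proof (rule poly_mapping_eqI)
  fix m
  show "lookup F m = lookup (\<Sum>d\<in>D. wpart w d F) m"
  proof (cases "w m \<in> D")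
    case True
    then show ?thesis using assms by (simp add: lookup_sum lookup_part)
  next
    case False
    with assms have "lookup F m = 0" by (force simp: in_keys_iff)
    then show ?thesis using False by (auto simp: lookup_sum lookup_part intro: sum.neutral)
  qed
qed

lemma wpart_mult_homogeneous:
  assumes w: "weight w" and F: "\<forall>m\<in>keys F. w m = a"
  shows "wpart w (a + b) (F * G) = F * wpart w b G"
proof -
  have exp: "G = (\<Sum>d\<in>insert b (w ` keys G). wpart w d G)" by (rule part_expand) auto
  have "wpart w (a + b) (F * G) = (\<Sum>d\<in>insert b (w ` keys G). wpart w (a + b) (F * wpart w d G))"
    by (subst exp) (simp only: sum_distrib_left part_sum)
  also have "\<dots> = (\<Sum>d\<in>insert b (w ` keys G). if d = b then F * wpart w d G else 0)"
  proof (rule sum.cong[OF refl])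
    fix d
    have "\<forall>m\<in>keys (F * wpart w d G). w m = a + d"
      by (rule weight_homogeneous_mult[OF w F]) (auto simp: keys_part)
    then show "wpart w (a + b) (F * wpart w d G) = (if d = b then F * wpart w d G else 0)"
      by (auto intro!: part_id part_disjoint)
  qed
  also have "\<dots> = F * wpart w b G" by (simp add: sum.delta)
  finally show ?thesis .
qed

lemma wpart_mult:
  assumes w: "weight w"
  shows "wpart w d (F * G) = (\<Sum>i\<le>d. wpart w i F * wpart w (d - i) G)"
proof -
  define D where "D = {..d} \<union> w ` keys F"
  have D: "finite D" by (simp add: D_def)
  have exp: "F = (\<Sum>i\<in>D. wpart w i F)" by (rule part_expand) (auto simp: D_def)
  have "wpart w d (F * G) = (\<Sum>i\<in>D. wpart w d (wpart w i F * G))"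
    by (subst exp) (simp only: sum_distrib_right part_sum)
  also have "\<dots> = (\<Sum>i\<in>D. if i \<le> d then wpart w i F * wpart w (d - i) G else 0)"
  proof (rule sum.cong[OF refl])
    fix i
    have h: "\<forall>m\<in>keys (wpart w i F). w m = i" by (auto simp: keys_part)
    show "wpart w d (wpart w i F * G) = (if i \<le> d then wpart w i F * wpart w (d - i) G else 0)"
    proof (cases "i \<le> d")
      case True
      then show ?thesis using wpart_mult_homogeneous[OF w h, of "d - i" G] by simp
    next
      case False
      have "keys (wpart w i F * G) \<inter> {m. w m = d} = {}"
        using keys_mult_subset[of "wpart w i F" G] h False by (fastforce simp: weightD[OF w])
      then show ?thesis using False by (simp add: part_disjoint)
    qed
  qed
  also have "\<dots> = (\<Sum>i\<le>d. wpart w i F * wpart w (d - i) G)"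
    by (rule sum.mono_neutral_cong_right) (auto simp: D_def)
  finally show ?thesis .
qed

section \<open>Substitution\<close>

abbreviation monomial_value :: "(nat \<Rightarrow> 'k::field mpoly) \<Rightarrow> (nat \<Rightarrow>\<^sub>0 nat) \<Rightarrow> 'k mpoly" where
  "monomial_value \<sigma> m \<equiv> (\<Prod>i\<in>keys m. \<sigma> i ^ lookup m i)"

lemma monomial_value_superset:
  "finite S \<Longrightarrow> keys m \<subseteq> S \<Longrightarrow> monomial_value \<sigma> m = (\<Prod>i\<in>S. \<sigma> i ^ lookup m i)"
  by (rule prod.mono_neutral_left) (auto simp: in_keys_iff)

lemma monomial_value_add: "monomial_value \<sigma> (a + b) = monomial_value \<sigma> a * monomial_value \<sigma> b"
  by (simp add: monomial_value_superset[of "keys a \<union> keys b"] keys_add_nat lookup_add power_add prod.distrib)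

lemma substitute_superset:
  assumes "finite S" "keys F \<subseteq> S"
  shows "substitute \<sigma> F = (\<Sum>m\<in>S. Const (lookup F m) * monomial_value \<sigma> m)"
  unfolding substitute_def
  using assms by (intro sum.mono_neutral_left) (auto simp: in_keys_iff Const_simps)

lemma substitute_zero [simp]: "substitute \<sigma> 0 = 0"
  by (simp add: substitute_def)

lemma substitute_single: "substitute \<sigma> (Poly_Mapping.single m c) = Const c * monomial_value \<sigma> m"
  by (subst substitute_superset[of "{m}"]) auto

lemma substitute_Const [simp]: "substitute \<sigma> (Const c) = Const c"
  using substitute_single[of \<sigma> 0 c] by (simp add: Const_def)

lemma substitute_one [simp]: "substitute \<sigma> 1 = 1"
  using substitute_Const[of \<sigma> 1] by (simp add: Const_simps)

lemma substitute_Var [simp]: "substitute \<sigma> (Var i) = \<sigma> i"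
  unfolding Var_def substitute_single by (simp add: Const_simps)

lemma substitute_add: "substitute \<sigma> (F + G) = substitute \<sigma> F + substitute \<sigma> G"
  using keys_add_subset[of F G]
  by (simp add: substitute_superset[of "keys F \<union> keys G"] lookup_add Const_simps
      distrib_right sum.distrib)

lemma substitute_sum: "substitute \<sigma> (sum f A) = (\<Sum>a\<in>A. substitute \<sigma> (f a))"
  by (induction A rule: infinite_finite_induct) (auto simp: substitute_add)

lemma substitute_minus: "substitute \<sigma> (F - G) = substitute \<sigma> F - substitute \<sigma> G"
  using substitute_add[of \<sigma> "F - G" G] by (simp add: algebra_simps)

lemma substitute_mult: "substitute \<sigma> (F * G) = substitute \<sigma> F * substitute \<sigma> G"
proof -
  let ?s = Poly_Mapping.single
  have "substitute \<sigma> (F * G) =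
      substitute \<sigma> ((\<Sum>a\<in>keys F. ?s a (lookup F a)) * (\<Sum>b\<in>keys G. ?s b (lookup G b)))"
    by (simp only: poly_expand[symmetric])
  also have "\<dots> = (\<Sum>a\<in>keys F. \<Sum>b\<in>keys G. substitute \<sigma> (?s a (lookup F a) * ?s b (lookup G b)))"
    by (simp only: sum_product substitute_sum)
  also have "\<dots> = (\<Sum>a\<in>keys F. \<Sum>b\<in>keys G. substitute \<sigma> (?s a (lookup F a)) * substitute \<sigma> (?s b (lookup G b)))"
    by (intro sum.cong refl)
      (simp only: mult_single substitute_single monomial_value_add Const_simps mult_ac)
  also have "\<dots> = substitute \<sigma> (\<Sum>a\<in>keys F. ?s a (lookup F a)) * substitute \<sigma> (\<Sum>b\<in>keys G. ?s b (lookup G b))"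
    by (simp only: sum_product substitute_sum)
  also have "\<dots> = substitute \<sigma> F * substitute \<sigma> G"
    by (simp only: poly_expand[symmetric])
  finally show ?thesis .
qed

lemma substitute_power: "substitute \<sigma> (F ^ n) = substitute \<sigma> F ^ n"
  by (induction n) (auto simp: substitute_mult)

lemma substitute_prod: "substitute \<sigma> (prod f A) = (\<Prod>a\<in>A. substitute \<sigma> (f a))"
  by (induction A rule: infinite_finite_induct) (auto simp: substitute_mult)

lemma substitute_substitute:
  "substitute \<tau> (substitute \<sigma> F) = substitute (\<lambda>i. substitute \<tau> (\<sigma> i)) F"
  unfolding substitute_def[of \<sigma>] substitute_def[of "\<lambda>i. substitute \<tau> (\<sigma> i)"]
  by (simp add: substitute_sum substitute_mult substitute_prod substitute_power)

lemma monomial_value_Var: "monomial_value Var m = Poly_Mapping.single m (1::'k::field)"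
proof -
  have pow: "Poly_Mapping.single a (1::'k) ^ n = Poly_Mapping.single (of_nat n * a) 1"
    for a :: "nat \<Rightarrow>\<^sub>0 nat" and n
    by (induction n) (auto simp: mult_single algebra_simps)
  have prod: "(\<Prod>i\<in>A. Poly_Mapping.single (g i) (1::'k)) = Poly_Mapping.single (\<Sum>i\<in>A. g i) 1"
    for A :: "nat set" and g :: "nat \<Rightarrow> nat \<Rightarrow>\<^sub>0 nat"
    by (induction A rule: infinite_finite_induct) (auto simp: mult_single)
  have sn: "of_nat n * Poly_Mapping.single i (1::nat) = Poly_Mapping.single i n" for i n :: nat
    by (induction n) (auto simp: single_add[symmetric] distrib_right)
  have "monomial_value Var m = Poly_Mapping.single (\<Sum>i\<in>keys m. Poly_Mapping.single i (lookup m i)) (1::'k)"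
    unfolding Var_def by (simp add: pow prod sn[unfolded One_nat_def])
  also have "(\<Sum>i\<in>keys m. Poly_Mapping.single i (lookup m i)) = m"
    using poly_mapping_eqI[of "\<Sum>i\<in>keys m. Poly_Mapping.single i (lookup m i)" m]
    by (auto simp: lookup_sum lookup_single when_def in_keys_iff)
  finally show ?thesis .
qed

lemma substitute_Var_id: "substitute Var F = F"
  unfolding substitute_def monomial_value_Var
  by (simp add: Const_def mult_single poly_expand[symmetric])

lemma substitute_cong:
  "(\<And>m i. m \<in> keys F \<Longrightarrow> i \<in> keys m \<Longrightarrow> \<sigma> i = \<tau> i) \<Longrightarrow> substitute \<sigma> F = substitute \<tau> F"
  unfolding substitute_def by (auto intro!: sum.cong prod.cong)

section \<open>Polynomials in finitely many variables\<close>

lemma polynomials_in_supported: "polynomials_in N = supported {m. keys m \<subseteq> {..N}}"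
  by (auto simp: polynomials_in_def supported_def)

lemma polynomials_in_closed [simp, intro]:
  "0 \<in> polynomials_in N" "1 \<in> polynomials_in N" "Const c \<in> polynomials_in N"
  "F \<in> polynomials_in N \<Longrightarrow> G \<in> polynomials_in N \<Longrightarrow> F + G \<in> polynomials_in N"
  "F \<in> polynomials_in N \<Longrightarrow> G \<in> polynomials_in N \<Longrightarrow> F - G \<in> polynomials_in N"
  "F \<in> polynomials_in N \<Longrightarrow> - F \<in> polynomials_in N"
  "F \<in> polynomials_in N \<Longrightarrow> G \<in> polynomials_in N \<Longrightarrow> F * G \<in> polynomials_in N"
  for F G :: "'k::field mpoly"
proof -
  note sub = supported_subspace[of "{m. keys m \<subseteq> {..N}}", folded polynomials_in_supported, where 'k = 'k]
  show "0 \<in> polynomials_in N" "1 \<in> polynomials_in N" "Const c \<in> polynomials_in N"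
    using keys_Const[of c] by (auto simp: polynomials_in_def)
  show "F \<in> polynomials_in N \<Longrightarrow> G \<in> polynomials_in N \<Longrightarrow> F + G \<in> polynomials_in N"
    "F \<in> polynomials_in N \<Longrightarrow> G \<in> polynomials_in N \<Longrightarrow> F - G \<in> polynomials_in N"
    "F \<in> polynomials_in N \<Longrightarrow> - F \<in> polynomials_in N"
    by (rule mp.subspace_add[OF sub] mp.subspace_diff[OF sub] mp.subspace_neg[OF sub]; assumption)+
  show "F * G \<in> polynomials_in N" if "F \<in> polynomials_in N" "G \<in> polynomials_in N"
    using that keys_mult_subset[of F G] unfolding polynomials_in_def
    by (fastforce simp: keys_add_nat)
qed

lemma polynomials_in_sum [intro]:
  "(\<And>a. a \<in> A \<Longrightarrow> f a \<in> polynomials_in N) \<Longrightarrow> sum f A \<in> (polynomials_in N :: 'k::field mpoly set)"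
  by (induction A rule: infinite_finite_induct) auto

lemma polynomials_in_prod [intro]:
  "(\<And>a. a \<in> A \<Longrightarrow> f a \<in> polynomials_in N) \<Longrightarrow> prod f A \<in> (polynomials_in N :: 'k::field mpoly set)"
  by (induction A rule: infinite_finite_induct) auto

lemma polynomials_in_power [simp, intro]:
  "F \<in> polynomials_in N \<Longrightarrow> F ^ n \<in> (polynomials_in N :: 'k::field mpoly set)"
  by (induction n) auto

lemma keys_Var: "keys (Var i :: 'k::field mpoly) = {Poly_Mapping.single i 1}"
  by (simp add: Var_def)

lemma Var_neq_0 [simp]: "Var i \<noteq> (0 :: 'k::field mpoly)"
  using keys_Var[of i] keys_zero by (metis insert_not_empty)

lemma Var_in_polynomials [simp]: "Var i \<in> (polynomials_in N :: 'k::field mpoly set) \<longleftrightarrow> i \<le> N"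
  by (simp add: polynomials_in_def keys_Var)

lemma polynomials_in_mono: "N \<le> M \<Longrightarrow> polynomials_in N \<subseteq> (polynomials_in M :: 'k::field mpoly set)"
  by (fastforce simp: polynomials_in_def)

lemma part_in_polynomials [simp, intro]:
  "F \<in> polynomials_in N \<Longrightarrow> part M F \<in> polynomials_in N"
  by (auto simp: polynomials_in_def keys_part)

lemma substitute_in_polynomials:
  assumes "F \<in> polynomials_in N" "\<And>i. i \<le> N \<Longrightarrow> \<sigma> i \<in> polynomials_in M"
  shows "substitute \<sigma> F \<in> polynomials_in M"
proof -
  have "\<And>m i. m \<in> keys F \<Longrightarrow> i \<in> keys m \<Longrightarrow> \<sigma> i \<in> polynomials_in M"
    using assms(1) by (intro assms(2)) (auto simp: polynomials_in_def)
  then show ?thesis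
    unfolding substitute_def by (intro polynomials_in_sum polynomials_in_closed polynomials_in_prod polynomials_in_power)
qed

lemma substitute_cong_polynomials:
  assumes "F \<in> polynomials_in N" "\<And>i. i \<le> N \<Longrightarrow> \<sigma> i = \<tau> i"
  shows "substitute \<sigma> F = substitute \<tau> F"
  by (rule substitute_cong) (use assms in \<open>auto simp: polynomials_in_def subset_iff\<close>)

lemma monomial_degree_superset:
  "finite S \<Longrightarrow> keys m \<subseteq> S \<Longrightarrow> monomial_degree m = (\<Sum>i\<in>S. lookup m i)"
  unfolding monomial_degree_def by (rule sum.mono_neutral_left) (auto simp: in_keys_iff)

lemma weight_monomial_degree [simp]: "weight monomial_degree"
  unfolding weight_def
proof (intro allI)
  fix a b
  show "monomial_degree (a + b) = monomial_degree a + monomial_degree b"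
    using monomial_degree_superset[of "keys a \<union> keys b"]
    by (simp add: keys_add_nat lookup_add sum.distrib)
qed

abbreviation component :: "nat \<Rightarrow> 'k::field mpoly \<Rightarrow> 'k mpoly" where
  "component \<equiv> wpart monomial_degree"

definition monomials :: "nat \<Rightarrow> nat \<Rightarrow> (nat \<Rightarrow>\<^sub>0 nat) set" where
  "monomials N d = {m. keys m \<subseteq> {..N} \<and> monomial_degree m = d}"

definition forms :: "nat \<Rightarrow> nat \<Rightarrow> 'k::field mpoly set" where
  "forms N d = supported (monomials N d)"

lemma forms_iff:
  "F \<in> forms N d \<longleftrightarrow> F \<in> polynomials_in N \<and> (\<forall>m\<in>keys F. monomial_degree m = d)"
  by (auto simp: forms_def supported_def monomials_def polynomials_in_def)

lemma grade_polynomial_algebra: "grade (polynomial_algebra N) d = forms N d"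
  by (auto simp: polynomial_algebra_def forms_iff)

lemma forms_subspace: "mp.subspace (forms N d :: 'k::field mpoly set)"
  unfolding forms_def by (rule supported_subspace)

lemma forms_polynomial: "F \<in> forms N d \<Longrightarrow> F \<in> polynomials_in N"
  by (simp add: forms_iff)

lemma forms_closed:
  "0 \<in> forms N d" 
  "F \<in> forms N d \<Longrightarrow> G \<in> forms N d \<Longrightarrow> F + G \<in> forms N d"
  "F \<in> forms N d \<Longrightarrow> G \<in> forms N d \<Longrightarrow> F - G \<in> forms N d"
  "F \<in> forms N d \<Longrightarrow> Const c * F \<in> forms N d"
  by (rule mp.subspace_0[OF forms_subspace] mp.subspace_add[OF forms_subspace]
      mp.subspace_diff[OF forms_subspace] mp.subspace_scale[OF forms_subspace]; assumption)+

lemma forms_mult: "F \<in> forms N a \<Longrightarrow> G \<in> forms N b \<Longrightarrow> F * G \<in> forms N (a + b)"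
  using weight_homogeneous_mult[OF weight_monomial_degree, of F a G b] by (auto simp: forms_iff)

lemma forms_one: "1 \<in> forms N 0"
  by (auto simp: forms_iff monomial_degree_def)

lemma forms_Const: "Const c \<in> forms N 0"
  using forms_closed(4)[OF forms_one] by simp

lemma forms_Var: "i \<le> N \<Longrightarrow> Var i \<in> forms N 1"
  by (auto simp: forms_iff keys_Var monomial_degree_def)

lemma forms_power: "F \<in> forms N a \<Longrightarrow> F ^ n \<in> forms N (n * a)"
  by (induction n) (auto simp: forms_one forms_mult)

lemma comp_forms [simp]: "F \<in> polynomials_in N \<Longrightarrow> component d F \<in> forms N d"
  by (auto simp: forms_iff keys_part)

lemma comp_of_form: "F \<in> forms N d \<Longrightarrow> component e F = (if e = d then F else 0)"
  by (auto simp: forms_iff intro!: part_id part_disjoint)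

lemma comp_expand: "\<exists>n. F = (\<Sum>d\<le>n. component d F)"
proof
  let ?n = "Max (insert 0 (monomial_degree ` keys F))"
  show "F = (\<Sum>d\<le>?n. component d F)"
    by (rule part_expand) auto
qed

lemma substitute_weight:
  assumes w: "weight w" and F: "F \<in> forms N d"
    and \<sigma>: "\<And>i m. i \<le> N \<Longrightarrow> m \<in> keys (\<sigma> i) \<Longrightarrow> w m = r"
  shows "\<forall>m\<in>keys (substitute \<sigma> F). w m = r * d"
proof -
  let ?S = "\<lambda>d. supported {m. w m = d} :: 'a mpoly set"
  have mult: "F * G \<in> ?S (a + b)" if "F \<in> ?S a" "G \<in> ?S b" for F G a b
    using weight_homogeneous_mult[OF w, of F a G b] that by (auto simp: supported_def)
  have one: "1 \<in> ?S 0" using weight_zero[OF w] by (auto simp: supported_def)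
  have pow: "F ^ k \<in> ?S (k * a)" if "F \<in> ?S a" for F a k
    by (induction k) (use one mult that in auto)
  have "Const (lookup F m) * monomial_value \<sigma> m \<in> ?S (r * d)" if m: "m \<in> keys F" for m
  proof -
    have m': "keys m \<subseteq> {..N}" "monomial_degree m = d"
      using F m by (auto simp: forms_iff polynomials_in_def)
    have "(\<Prod>i\<in>A. \<sigma> i ^ lookup m i) \<in> ?S (r * (\<Sum>i\<in>A. lookup m i))"
      if "finite A" "A \<subseteq> {..N}" for A
      using that
    proof (induction A rule: finite_induct)
      case empty then show ?case using one by simp
    next
      case (insert i A)
      have "\<sigma> i \<in> ?S r" using \<sigma>[of i] insert.prems by (auto simp: supported_def)
      from mult[OF pow[OF this, of "lookup m i"] insert.IH] insert show ?case by (simp add: algebra_simps)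
    qed
    from this[OF finite_keys m'(1)] have "monomial_value \<sigma> m \<in> ?S (r * d)"
      using m'(2) by (simp add: monomial_degree_def)
    then show ?thesis by (rule mp.subspace_scale[OF supported_subspace])
  qed
  then have "substitute \<sigma> F \<in> ?S (r * d)"
    unfolding substitute_def by (intro mp.subspace_sum supported_subspace) auto
  then show ?thesis by (auto simp: supported_def)
qed

lemma substitute_forms:
  assumes F: "F \<in> forms N d" and \<sigma>: "\<And>i. i \<le> N \<Longrightarrow> \<sigma> i \<in> forms M r"
  shows "substitute \<sigma> F \<in> forms M (r * d)"
proof -
  have "\<forall>m\<in>keys (substitute \<sigma> F). monomial_degree m = r * d"
    by (rule substitute_weight[OF weight_monomial_degree F]) (use \<sigma> forms_iff in blast)
  moreover have "substitute \<sigma> F \<in> polynomials_in M"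
    using F \<sigma> by (intro substitute_in_polynomials[of F N]) (auto simp: forms_iff)
  ultimately show ?thesis by (simp add: forms_iff)
qed

text \<open>Homogeneity with respect to a scaling by a polynomial \<open>c\<close> rather than by a constant: this is
  what makes the composites of the two chart maps powers of a linear form.\<close>

lemma substitute_scaled:
  assumes F: "F \<in> forms N d" and \<sigma>: "\<And>i. i \<le> N \<Longrightarrow> \<sigma> i = c * \<tau> i"
  shows "substitute \<sigma> F = c ^ d * substitute \<tau> F"
proof -
  have "monomial_value \<sigma> m = c ^ d * monomial_value \<tau> m" if m: "m \<in> keys F" for m
  proof -
    have m': "keys m \<subseteq> {..N}" "monomial_degree m = d"
      using F m by (auto simp: forms_iff polynomials_in_def)
    have "monomial_value \<sigma> m = (\<Prod>i\<in>keys m. c ^ lookup m i * \<tau> i ^ lookup m i)"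
      using m'(1) \<sigma> by (intro prod.cong refl) (auto simp: power_mult_distrib)
    then show ?thesis using m'(2) by (simp add: prod.distrib power_sum[symmetric] monomial_degree_def)
  qed
  then have "substitute \<sigma> F = (\<Sum>m\<in>keys F. c ^ d * (Const (lookup F m) * monomial_value \<tau> m))"
    unfolding substitute_def by (intro sum.cong refl) (simp add: mult.left_commute)
  then show ?thesis by (simp add: substitute_def sum_distrib_left)
qed

lemma comp_substitute:
  assumes F: "F \<in> polynomials_in N" and \<sigma>: "\<And>i. i \<le> N \<Longrightarrow> \<sigma> i \<in> forms M r" and "r > 0"
  shows "component (r * d) (substitute \<sigma> F) = substitute \<sigma> (component d F)"
proof -
  obtain n where n: "F = (\<Sum>e\<le>n. component e F)" using comp_expand by blast
  have F': "F = (\<Sum>e\<in>insert d {..n}. component e F)"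
  proof (cases "d \<le> n")
    case True
    then have "insert d {..n} = {..n}" by auto
    then show ?thesis using n by simp
  next
    case False
    have "component d F = (\<Sum>e\<le>n. component d (component e F))" by (subst n) (simp add: part_sum)
    also have "\<dots> = 0" using False F by (intro sum.neutral) (auto simp: comp_of_form[OF comp_forms])
    finally show ?thesis using n False by simp
  qed
  have "component (r * d) (substitute \<sigma> F) = (\<Sum>e\<in>insert d {..n}. component (r * d) (substitute \<sigma> (component e F)))"
    by (subst F') (simp only: substitute_sum part_sum)
  also have "\<dots> = (\<Sum>e\<in>insert d {..n}. if e = d then substitute \<sigma> (component d F) else 0)"
    using \<open>r > 0\<close> comp_of_form[OF substitute_forms[OF comp_forms[OF F] \<sigma>]]
    by (intro sum.cong refl) auto
  finally show ?thesis by simp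
qed

lemma single_0_monomial: "monomials 0 d = {Poly_Mapping.single 0 d}"
proof -
  have "m = Poly_Mapping.single 0 d" if "keys m \<subseteq> {..0}" "monomial_degree m = d" for m
    using that monomial_degree_superset[of "{0}" m]
    by (intro poly_mapping_eqI) (auto simp: lookup_single when_def in_keys_iff)
  then show ?thesis by (auto simp: monomials_def monomial_degree_def split: if_splits)
qed

lemma monomials_deg_0: "monomials N 0 = {0}"
proof -
  have "m = 0" if "monomial_degree m = 0" for m
    using that unfolding monomial_degree_def
    by (intro poly_mapping_eqI) (auto simp: in_keys_iff)
  then show ?thesis by (auto simp: monomials_def monomial_degree_def)
qed

text \<open>A monomial of degree \<open>d + 1\<close> either avoids the last variable or is divisible by it, which
  gives Pascal's rule.\<close>

lemma monomials_Suc: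
  "monomials (Suc N) (Suc d) =
     monomials N (Suc d) \<union> (\<lambda>m. m + Poly_Mapping.single (Suc N) 1) ` monomials (Suc N) d" (is "?L = ?R")
proof (rule subset_antisym; rule subsetI)
  fix m assume m: "m \<in> ?L"
  show "m \<in> ?R"
  proof (cases "Suc N \<in> keys m")
    case False
    with m have "m \<in> monomials N (Suc d)" by (auto simp: monomials_def subset_iff le_Suc_eq)
    then show ?thesis by simp
  next
    case True
    define m' where "m' = m - Poly_Mapping.single (Suc N) 1"
    have mm': "m = m' + Poly_Mapping.single (Suc N) 1"
      using True unfolding m'_def
      by (intro poly_mapping_eqI) (auto simp: lookup_add lookup_minus lookup_single when_def in_keys_iff)
    have "m' \<in> monomials (Suc N) d"
      using m by (auto simp: monomials_def mm' keys_add_nat weightD[OF weight_monomial_degree] monomial_degree_def[of "Poly_Mapping.single _ _"])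
    then show ?thesis using mm' by blast
  qed
next
  fix m assume "m \<in> ?R"
  then show "m \<in> ?L"
    by (auto simp: monomials_def keys_add_nat weightD[OF weight_monomial_degree]
        monomial_degree_def[of "Poly_Mapping.single _ _"] subset_iff)
qed

lemma card_monomials: "finite (monomials N d) \<and> card (monomials N d) = (d + N) choose N"
proof (induction "N + d" arbitrary: N d rule: less_induct)
  case less
  consider "N = 0" | "d = 0" | N' d' where "N = Suc N'" "d = Suc d'"
    by (cases N; cases d) auto
  then show ?case
  proof cases
    case 3
    have IH: "finite (monomials N' d)" "card (monomials N' d) = (d + N') choose N'"
       "finite (monomials N d')" "card (monomials N d') = (d' + N) choose N"
      using less[of N' d] less[of N d'] 3 by auto
    have inj: "inj_on (\<lambda>m. m + Poly_Mapping.single N 1) (monomials N d')" by (rule inj_onI) simp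
    have disj: "monomials N' d \<inter> (\<lambda>m. m + Poly_Mapping.single N 1) ` monomials N d' = {}"
      using 3 by (auto simp: monomials_def keys_add_nat)
    show ?thesis using IH card_image[OF inj] card_Un_disjoint[OF _ _ disj] monomials_Suc[of N' d'] 3
      by (simp add: add.commute)
  qed (auto simp: single_0_monomial monomials_deg_0)
qed

lemma forms_finite_basis: "\<exists>S. finite S \<and> forms N d \<subseteq> mp.span (S :: 'k::field mpoly set)"
  using supported_basis(2)[of "monomials N d", where 'k = 'k] card_monomials[of N d]
  by (intro exI[of _ "(\<lambda>m. Poly_Mapping.single m 1) ` monomials N d"]) (auto simp: forms_def)

section \<open>Homogeneous ideals and their Hilbert functions\<close>

text \<open>Homogeneous ideals as sets closed under taking homogeneous components. This agrees with being
  generated by homogeneous elements, see \<open>homogeneous_ideal_image\<close> and \<open>hideal_preimage\<close>.\<close>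

definition hideal :: "nat \<Rightarrow> 'k::field mpoly set \<Rightarrow> bool" where
  "hideal N I \<longleftrightarrow> I \<subseteq> polynomials_in N \<and> 0 \<in> I \<and> (\<forall>F\<in>I. \<forall>G\<in>I. F + G \<in> I) \<and>
     (\<forall>F\<in>I. \<forall>G\<in>polynomials_in N. F * G \<in> I) \<and> (\<forall>F\<in>I. \<forall>d. component d F \<in> I)"

lemma hidealD:
  assumes "hideal N I"
  shows "F \<in> I \<Longrightarrow> F \<in> polynomials_in N" "0 \<in> I" "F \<in> I \<Longrightarrow> G \<in> I \<Longrightarrow> F + G \<in> I"
    "F \<in> I \<Longrightarrow> G \<in> polynomials_in N \<Longrightarrow> F * G \<in> I" "F \<in> I \<Longrightarrow> G \<in> polynomials_in N \<Longrightarrow> G * F \<in> I"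
    "F \<in> I \<Longrightarrow> component d F \<in> I"
  using assms by (auto simp: hideal_def mult.commute)

lemma hideal_minus: "hideal N I \<Longrightarrow> F \<in> I \<Longrightarrow> G \<in> I \<Longrightarrow> F - G \<in> I"
  using hidealD(3)[of N I F "G * (-1)"] hidealD(4)[of N I G "-1"] by auto

lemma hideal_sum: "hideal N I \<Longrightarrow> (\<And>a. a \<in> A \<Longrightarrow> f a \<in> I) \<Longrightarrow> sum f A \<in> I"
  by (induction A rule: infinite_finite_induct) (auto intro: hidealD)

lemma hideal_subspace: "hideal N I \<Longrightarrow> mp.subspace I"
  unfolding mp.subspace_def by (auto intro: hidealD)

lemma hideal_forms_subspace: "hideal N I \<Longrightarrow> mp.subspace (I \<inter> forms N t)"
  by (simp add: mp.subspace_inter hideal_subspace forms_subspace)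

lemma hideal_comps: "hideal N I \<Longrightarrow> F \<in> I \<longleftrightarrow> (\<forall>d. component d F \<in> I)"
  using comp_expand[of F] by (metis hideal_sum hidealD(6))

definition hilb :: "nat \<Rightarrow> 'k::field mpoly set \<Rightarrow> nat \<Rightarrow> nat" where
  "hilb N I t = (THE n. mp.reldim (I \<inter> forms N t) (forms N t) n)"

lemma hilb_eqI: "hideal N I \<Longrightarrow> mp.reldim (I \<inter> forms N t) (forms N t) n \<Longrightarrow> hilb N I t = n"
  unfolding hilb_def using forms_finite_basis[of N t]
  by (intro the_equality) (auto intro: mp.reldim_unique[OF hideal_forms_subspace])

lemma hilb_reldim:
  assumes "hideal N I"
  shows "mp.reldim (I \<inter> forms N t) (forms N t) (hilb N I t)"
proof -
  obtain S where "finite S" "forms N t \<subseteq> mp.span (S :: 'a mpoly set)" using forms_finite_basis by blast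
  then obtain n where "mp.reldim (I \<inter> forms N t) (forms N t) n"
    using mp.reldim_exists[OF hideal_forms_subspace[OF assms] forms_subspace[of N t], of t S] by blast
  then show ?thesis using hilb_eqI[OF assms, of t n] by simp
qed

lemma hilb_antimono:
  assumes I: "hideal N I" and J: "hideal N J" and "I \<subseteq> J"
  shows "hilb N J t \<le> hilb N I t"
proof -
  obtain S where "finite S" "forms N t \<subseteq> mp.span (S :: 'a mpoly set)" using forms_finite_basis by blast
  then obtain n where "mp.reldim (I \<inter> forms N t) (J \<inter> forms N t) n"
    using mp.reldim_exists[OF hideal_forms_subspace[OF I, of t] hideal_forms_subspace[OF J, of t], of S]
      \<open>I \<subseteq> J\<close> by blast
  from hilb_eqI[OF I mp.reldim_trans[OF hilb_reldim[OF J] this]] show ?thesis by simp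
qed

lemma hilb_0_iff: "hideal N I \<Longrightarrow> hilb N I t = 0 \<longleftrightarrow> forms N t \<subseteq> I"
proof
  assume I: "hideal N I" and "hilb N I t = 0"
  with hilb_reldim[OF I, of t] have "mp.reldim (I \<inter> forms N t) (forms N t) 0" by simp
  then show "forms N t \<subseteq> I" by cases auto
next
  assume I: "hideal N I" and "forms N t \<subseteq> I"
  then have "I \<inter> forms N t = forms N t" by auto
  then show "hilb N I t = 0" using hilb_eqI[OF I, of t 0] mp.reldim_refl by metis
qed

definition colon :: "nat \<Rightarrow> 'k::field mpoly set \<Rightarrow> 'k mpoly \<Rightarrow> 'k mpoly set" where
  "colon N I a = {F \<in> polynomials_in N. a * F \<in> I}"

text \<open>The ideal generated by \<open>I\<close> and \<open>a\<close>.\<close>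

definition adjoin :: "nat \<Rightarrow> 'k::field mpoly set \<Rightarrow> 'k mpoly \<Rightarrow> 'k mpoly set" where
  "adjoin N I a = {F + a * G |F G. F \<in> I \<and> G \<in> polynomials_in N}"

lemma comp_mult_form:
  assumes "a \<in> forms N e"
  shows "component d (a * G) = (if e \<le> d then a * component (d - e) G else 0)"
proof -
  have "component d (a * G) = (\<Sum>i\<le>d. if i = e then a * component (d - e) G else 0)"
    unfolding wpart_mult[OF weight_monomial_degree]
    by (intro sum.cong refl) (auto simp: comp_of_form[OF assms])
  then show ?thesis by simp
qed

lemma hideal_colon:
  assumes I: "hideal N I" and a: "a \<in> forms N e"
  shows "hideal N (colon N I a)"
  unfolding hideal_def colon_def
proof (safe)
  fix F d assume F: "F \<in> polynomials_in N" "a * F \<in> I"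
  have "a * component d F = component (e + d) (a * F)" using comp_mult_form[OF a, of "e + d" F] by simp
  then show "a * component d F \<in> I" using hidealD(6)[OF I F(2)] by simp
qed (use I in \<open>auto simp: distrib_left mult.assoc[symmetric] intro: hidealD\<close>)

lemma hideal_adjoin:
  fixes I :: "'k::field mpoly set"
  assumes I: "hideal N I" and a: "a \<in> forms N e"
  shows "hideal N (adjoin N I a)"
  unfolding hideal_def
proof (intro conjI ballI allI subsetI)
  fix x assume "x \<in> adjoin N I a"
  then show "x \<in> polynomials_in N" 
    using I forms_polynomial[OF a] by (auto simp: adjoin_def intro: hidealD)
next
  show "0 \<in> adjoin N I a" using hidealD(2)[OF I] by (force simp: adjoin_def intro: exI[of _ 0])
next
  fix x y assume "x \<in> adjoin N I a" "y \<in> adjoin N I a"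
  then obtain F G F' G' where *: "x = F + a * G" "y = F' + a * G'" "F \<in> I" "F' \<in> I"
      "G \<in> polynomials_in N" "G' \<in> polynomials_in N" by (auto simp: adjoin_def)
  have "x + y = (F + F') + a * (G + G')" by (simp add: * algebra_simps)
  moreover have "F + F' \<in> I" "G + G' \<in> polynomials_in N" using * hidealD(3)[OF I] by auto
  ultimately show "x + y \<in> adjoin N I a" unfolding adjoin_def by blast
next
  fix x H :: "'k mpoly" assume "x \<in> adjoin N I a" and H: "H \<in> polynomials_in N"
  then obtain F G where *: "x = F + a * G" "F \<in> I" "G \<in> polynomials_in N" by (auto simp: adjoin_def)
  have "x * H = (F * H) + a * (G * H)" by (simp add: * algebra_simps)
  moreover have "F * H \<in> I" "G * H \<in> polynomials_in N" using * H hidealD(4)[OF I] by auto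
  ultimately show "x * H \<in> adjoin N I a" unfolding adjoin_def by blast
next
  fix x d assume "x \<in> adjoin N I a"
  then obtain F G where *: "x = F + a * G" "F \<in> I" "G \<in> polynomials_in N" by (auto simp: adjoin_def)
  have "component d x = component d F + a * (if e \<le> d then component (d - e) G else 0)"
    using comp_mult_form[OF a, of d G] by (simp add: * part_add)
  moreover have "component d F \<in> I" "(if e \<le> d then component (d - e) G else 0) \<in> polynomials_in N"
    using * hidealD(6)[OF I] by auto
  ultimately show "component d x \<in> adjoin N I a" unfolding adjoin_def by blast
qed

lemma adjoin_superset: "hideal N I \<Longrightarrow> I \<subseteq> adjoin N I a"
proof
  fix F assume "F \<in> I"
  then have "F = F + a * 0" by simp
  then show "F \<in> adjoin N I a" using \<open>F \<in> I\<close> unfolding adjoin_def by blast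
qed

lemma adjoin_self: "hideal N I \<Longrightarrow> a \<in> adjoin N I a"
  using hidealD(2)[of N I] by (force simp: adjoin_def intro: exI[of _ 0] exI[of _ 1])

lemma colon_superset: "hideal N I \<Longrightarrow> a \<in> polynomials_in N \<Longrightarrow> I \<subseteq> colon N I a"
  by (auto simp: colon_def intro: hidealD)

text \<open>Multiplication by \<open>a\<close> gives the exact sequence
  \<open>0 \<rightarrow> S/(I : a) \<rightarrow> S/I \<rightarrow> S/(I + (a)) \<rightarrow> 0\<close> with a
  shift of degree by \<open>e\<close>.\<close>

lemma hilb_exact:
  assumes I: "hideal N I" and a: "a \<in> forms N e"
  shows "hilb N I (t + e) = hilb N (colon N I a) t + hilb N (adjoin N I a) (t + e)"
proof -
  have ker: "a * x \<in> I \<inter> forms N (t + e) \<longleftrightarrow> x \<in> colon N I a \<inter> forms N t" if "x \<in> forms N t" for x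
    using that forms_mult[OF a that] forms_polynomial[OF that] by (auto simp: colon_def add.commute)
  have "mp.reldim (I \<inter> forms N (t + e)) {a * x + w |x w. x \<in> forms N t \<and> w \<in> I \<inter> forms N (t + e)}
      (hilb N (colon N I a) t)"
    by (rule mp.reldim_image[where T = "(*) a", OF hilb_reldim[OF hideal_colon[OF I a]]
          hideal_forms_subspace[OF hideal_colon[OF I a]] hideal_forms_subspace[OF I]])
      (use ker in \<open>auto simp: algebra_simps\<close>)
  also have "{a * x + w |x w. x \<in> forms N t \<and> w \<in> I \<inter> forms N (t + e)} = adjoin N I a \<inter> forms N (t + e)"
  proof (rule subset_antisym; rule subsetI)
    fix y assume "y \<in> {a * x + w |x w. x \<in> forms N t \<and> w \<in> I \<inter> forms N (t + e)}"
    then obtain x w where *: "y = a * x + w" "x \<in> forms N t" "w \<in> I" "w \<in> forms N (t + e)" by blast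
    have "y \<in> forms N (t + e)"
      using forms_closed(2)[OF forms_mult[OF a *(2)], of w] * by (simp add: add.commute)
    moreover have "y = w + a * x" using * by simp
    ultimately show "y \<in> adjoin N I a \<inter> forms N (t + e)"
      using * forms_polynomial[OF *(2)] unfolding adjoin_def by blast
  next
    fix y assume "y \<in> adjoin N I a \<inter> forms N (t + e)"
    then obtain F G where *: "y = F + a * G" "F \<in> I" "G \<in> polynomials_in N" "y \<in> forms N (t + e)"
      unfolding adjoin_def by blast
    have "y = component (t + e) y" using comp_of_form[OF *(4)] by simp
    also have "\<dots> = a * component t G + component (t + e) F"
      using comp_mult_form[OF a, of "t + e" G] by (simp add: *(1) part_add)
    finally show "y \<in> {a * x + w |x w. x \<in> forms N t \<and> w \<in> I \<inter> forms N (t + e)}"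
      using * hidealD(1,6)[OF I *(2)] comp_forms by blast
  qed
  finally show ?thesis
    using hilb_eqI[OF I mp.reldim_trans[OF hilb_reldim[OF hideal_adjoin[OF I a]]]] by blast
qed

section \<open>Homogeneous prime ideals\<close>

definition hprime :: "nat \<Rightarrow> 'k::field mpoly set \<Rightarrow> bool" where
  "hprime N P \<longleftrightarrow> hideal N P \<and> 1 \<notin> P \<and>
     (\<forall>F\<in>polynomials_in N. \<forall>G\<in>polynomials_in N. F * G \<in> P \<longrightarrow> F \<in> P \<or> G \<in> P)"

lemma hprimeD:
  assumes "hprime N P"
  shows "hideal N P" "1 \<notin> P"
    "F \<in> polynomials_in N \<Longrightarrow> G \<in> polynomials_in N \<Longrightarrow> F * G \<in> P \<Longrightarrow> F \<in> P \<or> G \<in> P"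
  using assms by (auto simp: hprime_def)

lemma hprime_mult_iff: "hprime N P \<Longrightarrow> F \<in> polynomials_in N \<Longrightarrow> G \<in> polynomials_in N \<Longrightarrow>
    F * G \<in> P \<longleftrightarrow> F \<in> P \<or> G \<in> P"
  using hprimeD(3)[of N P F G] hidealD(4,5)[OF hprimeD(1), of N P] by auto

lemma hprime_power: "hprime N P \<Longrightarrow> F \<in> polynomials_in N \<Longrightarrow> F ^ n \<in> P \<Longrightarrow> F \<in> P"
  by (induction n) (auto simp: hprime_mult_iff hprimeD(2))

lemma colon_hprime: "hprime N P \<Longrightarrow> a \<in> polynomials_in N \<Longrightarrow> a \<notin> P \<Longrightarrow> colon N P a = P"
  using hprime_mult_iff[of N P a] hidealD(1)[OF hprimeD(1), of N P] by (auto simp: colon_def)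

text \<open>Primality of a homogeneous ideal can be tested on forms: if two polynomials lie outside,
  multiply their components of lowest degree that lie outside.\<close>

lemma hprimeI:
  assumes Q: "hideal N Q" and one: "1 \<notin> Q"
    and pr: "\<And>a b F G. F \<in> forms N a \<Longrightarrow> G \<in> forms N b \<Longrightarrow> F * G \<in> Q \<Longrightarrow> F \<in> Q \<or> G \<in> Q"
  shows "hprime N Q"
  unfolding hprime_def
proof (intro conjI ballI impI Q one)
  fix F G assume F: "F \<in> polynomials_in N" and G: "G \<in> polynomials_in N" and FG: "F * G \<in> Q"
  show "F \<in> Q \<or> G \<in> Q"
  proof (rule ccontr)
    assume "\<not> ?thesis"
    then obtain a' b' where "component a' F \<notin> Q" "component b' G \<notin> Q" using hideal_comps[OF Q] by blast
    define a where "a = (LEAST a. component a F \<notin> Q)"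
    define b where "b = (LEAST b. component b G \<notin> Q)"
    have a: "component a F \<notin> Q" "\<And>i. i < a \<Longrightarrow> component i F \<in> Q"
      unfolding a_def using LeastI[of "\<lambda>i. component i F \<notin> Q", OF \<open>component a' F \<notin> Q\<close>]
      by (auto dest: not_less_Least)
    have b: "component b G \<notin> Q" "\<And>i. i < b \<Longrightarrow> component i G \<in> Q"
      unfolding b_def using LeastI[of "\<lambda>i. component i G \<notin> Q", OF \<open>component b' G \<notin> Q\<close>]
      by (auto dest: not_less_Least)
    have "component (a + b) (F * G) = component a F * component b G + (\<Sum>i\<in>{..a+b} - {a}. component i F * component (a + b - i) G)"
      unfolding wpart_mult[OF weight_monomial_degree] by (subst sum.remove[of _ a]) auto
    moreover have "(\<Sum>i\<in>{..a+b} - {a}. component i F * component (a + b - i) G) \<in> Q"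
    proof (rule hideal_sum[OF Q])
      fix i assume i: "i \<in> {..a+b} - {a}"
      consider "i < a" | "a + b - i < b" using i by fastforce
      then show "component i F * component (a + b - i) G \<in> Q"
        using a(2) b(2) F G by cases (auto intro: hidealD[OF Q])
    qed
    ultimately have "component a F * component b G \<in> Q"
      using hideal_minus[OF Q hidealD(6)[OF Q FG, of "a + b"],
          of "\<Sum>i\<in>{..a+b} - {a}. component i F * component (a + b - i) G"] by simp
    with pr[OF comp_forms[OF F] comp_forms[OF G]] a b show False by blast
  qed
qed

lemma hprime_zero: "hprime N {0}"
  by (auto simp: hprime_def hideal_def)

lemma hilb_zero: "hilb N ({0} :: 'k::field mpoly set) t = (t + N) choose N"
proof -
  have "hideal N ({0} :: 'k mpoly set)" by (rule hprimeD(1)[OF hprime_zero])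
  moreover have "{0} \<inter> forms N t = ({0} :: 'k mpoly set)" using forms_closed(1) by auto
  moreover have "mp.reldim {0} (forms N t :: 'k mpoly set) ((t + N) choose N)"
    using reldim_supported[of "monomials N t", where 'k = 'k] card_monomials[of N t]
    by (simp add: forms_def)
  ultimately show ?thesis using hilb_eqI[of N "{0} :: 'k mpoly set" t] by simp
qed

text \<open>For a homogeneous prime, this says that it defines a point of \<open>Proj\<close>.\<close>

definition relevant :: "nat \<Rightarrow> 'k::field mpoly set \<Rightarrow> bool" where
  "relevant N P \<longleftrightarrow> (\<exists>i\<le>N. Var i \<notin> P)"

lemma irrelevant_forms:
  assumes I: "hideal N I" and "\<not> relevant N I" and F: "F \<in> forms N t" and "t > 0"
  shows "F \<in> I"
proof -
  have "Const (lookup F m) * monomial_value Var m \<in> I" if m: "m \<in> keys F" for m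
  proof -
    have m': "keys m \<subseteq> {..N}" "monomial_degree m > 0"
      using F m \<open>t > 0\<close> by (auto simp: forms_iff polynomials_in_def)
    then obtain i where i: "i \<in> keys m" unfolding monomial_degree_def by force
    have "monomial_value Var m = Var i ^ lookup m i * (\<Prod>j\<in>keys m - {i}. (Var j :: 'a mpoly) ^ lookup m j)"
      by (rule prod.remove) (use i in auto)
    also have "Var i ^ lookup m i = (Var i :: 'a mpoly) * Var i ^ (lookup m i - 1)"
      using i by (cases "lookup m i") (auto simp: in_keys_iff)
    finally have "Const (lookup F m) * monomial_value Var m =
       Var i * (Const (lookup F m) * Var i ^ (lookup m i - 1) * (\<Prod>j\<in>keys m - {i}. Var j ^ lookup m j))"
      by (simp only: mult_ac)
    also have "\<dots> \<in> I"
    proof (rule hidealD(4)[OF I])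
      show "Var i \<in> I" using assms(2) i m' by (auto simp: relevant_def)
      show "Const (lookup F m) * Var i ^ (lookup m i - 1) * (\<Prod>j\<in>keys m - {i}. Var j ^ lookup m j) \<in> polynomials_in N"
        using i m'(1) by (intro polynomials_in_closed polynomials_in_prod polynomials_in_power) auto
    qed
    finally show ?thesis .
  qed
  then have "substitute Var F \<in> I" unfolding substitute_def by (intro hideal_sum[OF I])
  then show ?thesis by (simp add: substitute_Var_id)
qed

lemma relevant_hilb_pos:
  assumes "hprime N P" "relevant N P"
  shows "hilb N P t > 0"
proof -
  obtain i where i: "i \<le> N" "Var i \<notin> P" using assms by (auto simp: relevant_def)
  then have "Var i ^ t \<notin> P" using hprime_power[OF assms(1)] by auto
  moreover have "Var i ^ t \<in> forms N t" using forms_power[OF forms_Var[OF i(1)], of t] by simp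
  ultimately show ?thesis using hilb_0_iff[OF hprimeD(1)[OF assms(1)], of t] by auto
qed

text \<open>Forms that witness the strictness of the inclusions can be brought to a common positive degree
  by multiplying with powers of a variable outside all the primes.\<close>

lemma chain_common_degree:
  fixes P :: "nat \<Rightarrow> 'k::field mpoly set"
  assumes pr: "\<And>i. i \<le> m \<Longrightarrow> hprime N (P i)" and sub: "\<And>i. i < m \<Longrightarrow> P i \<subset> P (Suc i)"
    and rel: "relevant N (P m)"
  shows "\<exists>e>0. \<exists>g. \<forall>i<m. g i \<in> forms N e \<and> g i \<in> P (Suc i) \<and> g i \<notin> P i"
proof -
  have mono: "P i \<subseteq> P m" if "i \<le> m" for i
    using that by (induction rule: inc_induct) (use sub in blast)+
  obtain v where v: "v \<le> N" "Var v \<notin> P m" using rel by (auto simp: relevant_def)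
  have "\<exists>d h. h \<in> forms N d \<and> h \<in> P (Suc i) \<and> h \<notin> P i" if i: "i < m" for i
  proof -
    have H: "hideal N (P i)" "hideal N (P (Suc i))"
        using hprimeD(1)[OF pr[of i]] hprimeD(1)[OF pr[of "Suc i"]] i by auto
    obtain F where F: "F \<in> P (Suc i)" "F \<notin> P i" using sub[OF i] by auto
    then obtain d where "component d F \<notin> P i" using hideal_comps[OF H(1)] by blast
    then show ?thesis using hidealD(1,6)[OF H(2) F(1)] comp_forms by blast
  qed
  then obtain d h where h: "\<And>i. i < m \<Longrightarrow> h i \<in> forms N (d i) \<and> h i \<in> P (Suc i) \<and> h i \<notin> P i" by metis
  \<comment> \<open>any positive bound of all the degrees will do\<close>
  define e where "e = 1 + (\<Sum>i<m. d i)"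
  define g where "g i = Var v ^ (e - d i) * h i" for i
  have "g i \<in> forms N e \<and> g i \<in> P (Suc i) \<and> g i \<notin> P i" if i: "i < m" for i
  proof -
    have "d i \<le> (\<Sum>i<m. d i)" by (rule member_le_sum) (use i in auto)
    then have "d i \<le> e" by (simp add: e_def)
    have vf: "Var v ^ (e - d i) \<in> forms N (e - d i)"
      using forms_power[OF forms_Var[OF v(1)], of "e - d i"] by simp
    have "g i \<in> forms N e"
      using forms_mult[OF vf, of "h i" "d i"] h[OF i] \<open>d i \<le> e\<close> by (simp add: g_def)
    moreover have "g i \<in> P (Suc i)"
      using pr[of "Suc i"] h[OF i] i forms_polynomial[OF vf] unfolding g_def
      by (intro hidealD(5)[OF hprimeD(1)]) auto
    moreover have "g i \<notin> P i"
    proof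
      assume "g i \<in> P i"
      then have "Var v ^ (e - d i) \<in> P i"
        using hprimeD(3)[OF pr[of i], of "Var v ^ (e - d i)" "h i"] h[OF i] i forms_polynomial[OF vf]
          forms_polynomial unfolding g_def by force
      then have "Var v \<in> P i" using hprime_power[OF pr[of i]] i v by auto
      then show False using mono[of i] i v by auto
    qed
    ultimately show ?thesis by blast
  qed
  then show ?thesis by (intro exI[of _ e] conjI exI[of _ g]) (auto simp: e_def)
qed

text \<open>Suppose that \<open>g\<close> lies in \<open>P (i + 1)\<close> but not in \<open>P i\<close>. Since \<open>P i\<close> is prime, the exact
  sequence for \<open>g\<close> bounds the Hilbert function of \<open>P i\<close> in degree \<open>(j + 1) e\<close> from below by its
  own value in degree \<open>j e\<close> plus the value for \<open>P (i + 1)\<close> in degree \<open>(j + 1) e\<close>. This is the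
  recursion of Pascal's triangle. In other words, the monomials in \<open>m + 1\<close> suitable forms of
  degree \<open>e\<close> are linearly independent.\<close>

lemma chain_hilb_lower_bound:
  fixes P :: "nat \<Rightarrow> 'k::field mpoly set"
  assumes pr: "\<And>i. i \<le> m \<Longrightarrow> hprime N (P i)" and sub: "\<And>i. i < m \<Longrightarrow> P i \<subset> P (Suc i)"
    and rel: "relevant N (P m)"
  shows "\<exists>e>0. \<forall>j. (j + m) choose m \<le> hilb N (P 0) (j * e)"
proof -
  obtain e g where e: "e > 0" and g: "\<And>i. i < m \<Longrightarrow> g i \<in> forms N e \<and> g i \<in> P (Suc i) \<and> g i \<notin> P i"
    using chain_common_degree[OF pr sub rel] by blast
  have rel': "relevant N (P i)" if "i \<le> m" for i
    using that by (induction rule: inc_induct) (use sub rel in \<open>auto simp: relevant_def\<close>)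
  have "(j + k) choose k \<le> hilb N (P (m - k)) (j * e)" if "k \<le> m" for j k
    using that
  proof (induction "j + k" arbitrary: j k rule: less_induct)
    case less
    have pos: "hilb N (P (m - k)) (j * e) > 0"
      using relevant_hilb_pos pr rel' by (metis diff_le_self)
    consider "j = 0" | "k = 0" | j' k' where "j = Suc j'" "k = Suc k'" by (cases j; cases k) auto
    then show ?case
    proof cases
      case 3
      define i where "i = m - k"
      have i: "i < m" "Suc i = m - k'" using less(2) 3 by (auto simp: i_def)
      have H: "hideal N (P i)" "hideal N (P (Suc i))"
        using hprimeD(1)[OF pr[of i]] hprimeD(1)[OF pr[of "Suc i"]] i by auto
      have G: "g i \<in> forms N e" "g i \<in> P (Suc i)" "g i \<notin> P i" using g[OF i(1)] by simp_all
      have ext: "adjoin N (P i) (g i) \<subseteq> P (Suc i)"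
        using sub[OF i(1)] G unfolding adjoin_def
        by (auto intro!: hidealD(3)[OF H(2)] hidealD(4)[OF H(2)])
      have "hilb N (P i) (j * e) = hilb N (P i) (j' * e) + hilb N (adjoin N (P i) (g i)) (j * e)"
        using hilb_exact[OF H(1) G(1), of "j' * e"] colon_hprime[OF pr _ G(3)] i forms_polynomial[OF G(1)] 3
        by (simp add: add.commute)
      moreover have "hilb N (P (Suc i)) (j * e) \<le> hilb N (adjoin N (P i) (g i)) (j * e)"
        by (rule hilb_antimono[OF hideal_adjoin[OF H(1) G(1)] H(2) ext])
      moreover have "(j' + k) choose k \<le> hilb N (P i) (j' * e)"
        using less(1)[of j' k] less(2) 3 by (simp add: i_def)
      moreover have "(j + k') choose k' \<le> hilb N (P (Suc i)) (j * e)"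
        using less(1)[of j k'] less(2) 3 i by simp
      ultimately show ?thesis using 3 by (simp add: i_def)
    qed (use pos in auto)
  qed
  from this[of m] e show ?thesis by auto
qed

section \<open>The ascending chain condition\<close>

lemma nat_seq_mono_subseq:
  fixes s :: "nat \<Rightarrow> nat"
  shows "\<exists>f :: nat \<Rightarrow> nat. strict_mono f \<and> mono (s \<circ> f)"
proof -
  obtain f where f: "strict_mono f" "monoseq (\<lambda>n. s (f n))"
    using seq_monosub[of s] by (auto simp: o_def)
  show ?thesis
  proof (cases "incseq (\<lambda>n. s (f n))")
    case True
    then show ?thesis using f(1) by (intro exI[of _ f]) (simp add: o_def)
  next
    case False
    then have dec: "decseq (\<lambda>n. s (f n))" using f(2) by (auto simp: monoseq_iff)
    obtain n0 where n0: "\<And>n. s (f n0) \<le> s (f n)"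
      using ex_has_least_nat[of "\<lambda>_. True" _ "\<lambda>n. s (f n)"] by auto
    have "s (f (n0 + n)) = s (f n0)" for n
      using n0[of "n0 + n"] decseqD[OF dec, of n0 "n0 + n"] by simp
    moreover have "strict_mono (\<lambda>n. f (n0 + n))" using f(1) by (auto simp: strict_mono_def)
    ultimately show ?thesis by (intro exI[of _ "\<lambda>n. f (n0 + n)"]) (auto simp: mono_def)
  qed
qed

text \<open>Pass to a subsequence on which the exponents of one variable after the other are
  nondecreasing.\<close>

lemma dickson:
  fixes m :: "nat \<Rightarrow> nat \<Rightarrow>\<^sub>0 nat"
  assumes "\<And>i. keys (m i) \<subseteq> {..N}"
  shows "\<exists>i j u. i < j \<and> m j = m i + u"
proof -
  have "\<exists>f :: nat \<Rightarrow> nat. strict_mono f \<and> (\<forall>v<K. mono (\<lambda>n. lookup (m (f n)) v))" for K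
  proof (induction K)
    case 0
    then show ?case by (intro exI[of _ id]) (auto simp: strict_mono_def)
  next
    case (Suc K)
    then obtain f :: "nat \<Rightarrow> nat" where f: "strict_mono f" "\<And>v. v < K \<Longrightarrow> mono (\<lambda>n. lookup (m (f n)) v)" by blast
    obtain g :: "nat \<Rightarrow> nat" where g: "strict_mono g" "mono ((\<lambda>n. lookup (m (f n)) K) \<circ> g)"
      using nat_seq_mono_subseq by blast
    have "mono (\<lambda>n. lookup (m (f (g n))) v)" if "v < Suc K" for v
    proof (cases "v = K")
      case True
      then show ?thesis using g(2) by (simp add: o_def)
    next
      case False
      then have "mono (\<lambda>n. lookup (m (f n)) v)" using f(2) that by simp
      then show ?thesis using strict_mono_mono[OF g(1)] by (auto simp: mono_def)
    qed
    moreover have "strict_mono (\<lambda>n. f (g n))" using f(1) g(1) by (auto simp: strict_mono_def)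
    ultimately show ?case by (intro exI[of _ "\<lambda>n. f (g n)"]) auto
  qed
  then obtain f :: "nat \<Rightarrow> nat" where f: "strict_mono f" "\<And>v. v < Suc N \<Longrightarrow> mono (\<lambda>n. lookup (m (f n)) v)" by blast
  have le: "lookup (m (f 0)) v \<le> lookup (m (f 1)) v" for v
  proof (cases "v \<le> N")
    case True
    then show ?thesis using f(2)[of v] by (auto simp: mono_def)
  next
    case False
    then have "v \<notin> keys (m (f 0))" using assms[of "f 0"] by auto
    then show ?thesis by (simp add: in_keys_iff)
  qed
  have "m (f 1) = m (f 0) + (m (f 1) - m (f 0))"
    by (rule poly_mapping_eqI) (use le in \<open>auto simp: lookup_add lookup_minus\<close>)
  moreover have "f 0 < f 1" using f(1) by (simp add: strict_mono_def)
  ultimately show ?thesis by blast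
qed

abbreviation leading :: "'k::field mpoly \<Rightarrow> (nat \<Rightarrow>\<^sub>0 nat)" where
  "leading F \<equiv> Max (keys F)"

lemma leading_cancel:
  fixes F G :: "'k::field mpoly"
  assumes "F \<noteq> 0" "G \<noteq> 0" "leading F = leading G"
  shows "\<exists>c. F - Const c * G = 0 \<or> leading (F - Const c * G) < leading F"
proof -
  \<comment> \<open>the quotient of the leading coefficients cancels the leading terms\<close>
  define c where "c = lookup F (leading F) / lookup G (leading G)"
  have lead: "leading F \<in> keys F" "leading G \<in> keys G" 
    using Max_in[of "keys F"] Max_in[of "keys G"] assms by auto
  let ?D = "F - Const c * G"
  have "m < leading F" if "m \<in> keys ?D" for m
  proof -
    have "lookup ?D (leading F) = 0"
      using lead assms(3) by (simp add: c_def lookup_minus lookup_Const_mult in_keys_iff)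
    then have "m \<noteq> leading F" using that by (auto simp: in_keys_iff)
    moreover have "m \<in> keys F \<union> keys G"
      using that by (auto simp: in_keys_iff lookup_minus lookup_Const_mult)
    then have "m \<le> leading F" using assms(3) by (auto intro: Max_ge) (metis Max_ge finite_keys)
    ultimately show ?thesis by simp
  qed
  then have "leading ?D < leading F" if "?D \<noteq> 0"
    using that Max_in[of "keys ?D"] by simp
  then show ?thesis by blast
qed

lemma keys_mult_monomial:
  fixes F :: "'k::field mpoly"
  shows "keys (F * Poly_Mapping.single u 1) = (\<lambda>m. m + u) ` keys F"
proof -
  let ?g = "\<Sum>m\<in>keys F. Poly_Mapping.single (m + u) (lookup F m)"
  have "F * Poly_Mapping.single u 1 = (\<Sum>m\<in>keys F. Poly_Mapping.single m (lookup F m)) * Poly_Mapping.single u 1"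
    by (simp only: poly_expand[symmetric])
  also have "\<dots> = ?g" by (simp add: sum_distrib_right mult_single)
  finally have eq: "F * Poly_Mapping.single u 1 = ?g" .
  have "lookup ?g k = (\<Sum>m\<in>keys F. if m + u = k then lookup F m else 0)" for k
    by (simp add: lookup_sum lookup_single when_def)
  moreover have "(\<Sum>m\<in>keys F. if m + u = k then lookup F m else 0) \<noteq> 0 \<longleftrightarrow> k \<in> (\<lambda>m. m + u) ` keys F" for k
  proof (cases "k \<in> (\<lambda>m. m + u) ` keys F")
    case True
    then obtain n where n: "n \<in> keys F" "k = n + u" by auto
    then have "(\<Sum>m\<in>keys F. if m + u = k then lookup F m else 0) = lookup F n" by simp
    then show ?thesis using n True by (simp add: in_keys_iff)
  next
    case False
    then have "(\<Sum>m\<in>keys F. if m + u = k then lookup F m else 0) = 0" by (intro sum.neutral) auto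
    then show ?thesis using False by simp
  qed
  ultimately show ?thesis unfolding eq by (auto simp: in_keys_iff)
qed

lemma leading_mult_monomial:
  fixes F :: "'k::field mpoly"
  assumes "F \<noteq> 0"
  shows "leading (F * Poly_Mapping.single u 1) = leading F + u"
proof -
  have "Max ((\<lambda>m. m + u) ` keys F) = Max (keys F) + u"
    by (rule mono_Max_commute[symmetric]) (use assms in \<open>auto simp: mono_def add_right_mono\<close>)
  then show ?thesis by (simp add: keys_mult_monomial)
qed

text \<open>Leading monomials with respect to the lexicographic order separate nested ideals: in a
  suitable degree, a form of \<open>J\<close> outside \<open>I\<close> whose leading monomial is as small as possible
  cannot share this monomial with a form of \<open>I\<close>, as the leading terms would cancel.\<close>

lemma new_leading_monomial:
  fixes I J :: "'k::field mpoly set"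
  assumes I: "hideal N I" and J: "hideal N J" and "I \<subset> J"
  shows "\<exists>d g. g \<in> J \<inter> forms N d \<and> g \<noteq> 0 \<and> (\<forall>h \<in> I \<inter> forms N d. h \<noteq> 0 \<longrightarrow> leading h \<noteq> leading g)"
proof -
  obtain F where F: "F \<in> J" "F \<notin> I" using \<open>I \<subset> J\<close> by auto
  then obtain d where d: "component d F \<notin> I" using hideal_comps[OF I] by blast
  define S where "S = {g \<in> J \<inter> forms N d. g \<notin> I}"
  have "component d F \<in> S" using d F hidealD(1,6)[OF J F(1)] by (auto simp: S_def)
  have S0: "g \<noteq> 0" if "g \<in> S" for g using that hidealD(2)[OF I] by (auto simp: S_def)
  have lead: "leading g \<in> monomials N d" if "g \<in> forms N d" "g \<noteq> 0" for g :: "'k mpoly"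
  proof -
    have "leading g \<in> keys g" using that by (intro Max_in) auto
    then show ?thesis using that by (auto simp: forms_def supported_def)
  qed
  have "finite (leading ` S)"
    by (rule finite_subset[of _ "monomials N d"]) (use lead S0 card_monomials in \<open>auto simp: S_def\<close>)
  moreover have "leading ` S \<noteq> {}" using \<open>component d F \<in> S\<close> by auto
  ultimately have "Min (leading ` S) \<in> leading ` S" by (rule Min_in)
  then obtain g where g: "g \<in> S" "leading g = Min (leading ` S)" by auto
  have min: "leading g \<le> leading g'" if "g' \<in> S" for g'
    using g(2) Min_le[OF \<open>finite (leading ` S)\<close>] that by auto
  have "leading h \<noteq> leading g" if h: "h \<in> I \<inter> forms N d" "h \<noteq> 0" for h
  proof
    assume "leading h = leading g"
    then obtain c where c: "g - Const c * h = 0 \<or> leading (g - Const c * h) < leading g"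
      using leading_cancel[of g h] S0 g(1) h(2) by auto
    have ch: "Const c * h \<in> I \<inter> forms N d" using h(1) hidealD(5)[OF I] forms_closed(4) by auto
    have "g - Const c * h \<in> S"
    proof -
      have "g - Const c * h \<in> J" using g(1) ch \<open>I \<subset> J\<close> hideal_minus[OF J] by (auto simp: S_def)
      moreover have "g - Const c * h \<in> forms N d" using g(1) ch forms_closed(3) by (auto simp: S_def)
      moreover have "g - Const c * h \<notin> I"
        using hidealD(3)[OF I, of "g - Const c * h" "Const c * h"] ch g(1) by (auto simp: S_def)
      ultimately show ?thesis by (simp add: S_def)
    qed
    with c S0 min show False by (metis not_less)
  qed
  with g S0 show ?thesis by (intro exI[of _ d] exI[of _ g]) (auto simp: S_def)
qed

text \<open>In an infinite ascending chain, choose new leading monomials at every step. By Dickson's lemma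
  one of them divides a later one, which is then the leading monomial of an element that the
  chain already contained.\<close>

lemma hideal_wf: "wf {(J, I :: 'k::field mpoly set). hideal N I \<and> hideal N J \<and> I \<subset> J}"
  unfolding wf_iff_no_infinite_down_chain
proof
  assume "\<exists>f. \<forall>i. (f (Suc i), f i) \<in> {(J, I :: 'k mpoly set). hideal N I \<and> hideal N J \<and> I \<subset> J}"
  then obtain f where "\<forall>i. (f (Suc i), f i) \<in> {(J, I :: 'k mpoly set). hideal N I \<and> hideal N J \<and> I \<subset> J}"
    by (elim exE)
  then have f: "\<And>i. hideal N (f i)" "\<And>i. f i \<subset> f (Suc i)" by simp_all
  have mono: "f i \<subseteq> f j" if "i \<le> j" for i j
    by (rule lift_Suc_mono_le[OF _ that]) (use f in auto)
  have "\<forall>i. \<exists>d g. g \<in> f (Suc i) \<inter> forms N d \<and> g \<noteq> 0 \<and>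
      (\<forall>h \<in> f i \<inter> forms N d. h \<noteq> 0 \<longrightarrow> leading h \<noteq> leading g)"
    by (intro allI new_leading_monomial f)
  from this[THEN choice] obtain d where "\<forall>i. \<exists>g. g \<in> f (Suc i) \<inter> forms N (d i) \<and> g \<noteq> 0 \<and>
      (\<forall>h \<in> f i \<inter> forms N (d i). h \<noteq> 0 \<longrightarrow> leading h \<noteq> leading g)" ..
  from this[THEN choice] obtain g where "\<forall>i. g i \<in> f (Suc i) \<inter> forms N (d i) \<and> g i \<noteq> 0 \<and>
      (\<forall>h \<in> f i \<inter> forms N (d i). h \<noteq> 0 \<longrightarrow> leading h \<noteq> leading (g i))" ..
  then have g: "\<And>i. g i \<in> f (Suc i)" "\<And>i. g i \<in> forms N (d i)" "\<And>i. g i \<noteq> 0"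
      "\<And>i h. h \<in> f i \<Longrightarrow> h \<in> forms N (d i) \<Longrightarrow> h \<noteq> 0 \<Longrightarrow> leading h \<noteq> leading (g i)"
    by simp_all
  have lead: "leading (g i) \<in> monomials N (d i)" for i
  proof -
    have "leading (g i) \<in> keys (g i)" using g(3) by (intro Max_in) auto
    then show ?thesis using g(2)[of i] by (auto simp: forms_def supported_def)
  qed
  then obtain i j u where ij: "i < j" "leading (g j) = leading (g i) + u"
    using dickson[of "\<lambda>i. leading (g i)" N] by (auto simp: monomials_def)
  define h where "h = g i * Poly_Mapping.single u 1"
  have u: "keys u \<subseteq> {..N}" "monomial_degree u + d i = d j"
    using lead[of j] lead[of i] unfolding ij(2)
    by (auto simp: monomials_def keys_add_nat weightD[OF weight_monomial_degree])
  have "Poly_Mapping.single u 1 \<in> forms N (monomial_degree u)"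
    using u(1) by (auto simp: forms_iff polynomials_in_def)
  then have "h \<in> forms N (d j)"
    using forms_mult[OF g(2)[of i]] u(2) unfolding h_def by (metis add.commute)
  moreover have "h \<in> f j"
    using mono[of "Suc i" j] ij(1) g(1)[of i] u(1) unfolding h_def
    by (intro hidealD(4)[OF f(1)]) (auto simp: polynomials_in_def)
  moreover have "leading h = leading (g j)"
    unfolding h_def using leading_mult_monomial[OF g(3)] ij(2) by metis
  moreover have "h \<noteq> 0" unfolding h_def using g(3)[of i] keys_mult_monomial[of "g i" u] by force
  ultimately show False using g(4)[of h j] by blast
qed

lemma hideal_maximal:
  assumes "hideal N I" "\<Phi> I"
  shows "\<exists>Q. hideal N Q \<and> I \<subseteq> Q \<and> \<Phi> Q \<and> (\<forall>J. hideal N J \<and> Q \<subset> J \<longrightarrow> \<not> \<Phi> J)"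
proof -
  have "I \<in> {J. hideal N J \<and> I \<subseteq> J \<and> \<Phi> J}" using assms by auto
  from wfE_min[OF hideal_wf this] obtain Q where Q: "hideal N Q" "I \<subseteq> Q" "\<Phi> Q"
    and min: "\<And>J. (J, Q) \<in> {(J, I). hideal N I \<and> hideal N J \<and> I \<subset> J} \<Longrightarrow> J \<notin> {J. hideal N J \<and> I \<subseteq> J \<and> \<Phi> J}"
    by blast
  show ?thesis using Q min by (intro exI[of _ Q]) blast
qed

section \<open>Long chains of homogeneous primes\<close>

text \<open>The Hilbert function is summed up to degree \<open>t\<close> so that the condition still makes sense for
  \<open>r = 0\<close>: it then says that infinitely many degrees survive in the quotient. For a quotient of
  Krull dimension \<open>r + 1\<close>, the sum grows with the exponent \<open>r + 1\<close>.\<close>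

definition big :: "nat \<Rightarrow> 'k::field mpoly set \<Rightarrow> nat \<Rightarrow> bool" where
  "big N I r \<longleftrightarrow> (\<forall>C. \<exists>t. C * (t + 1) ^ r < (\<Sum>s\<le>t. hilb N I s))"

lemma big_relevant:
  assumes I: "hideal N I" and "big N I r"
  shows "relevant N I"
proof (rule ccontr)
  assume "\<not> relevant N I"
  then have "forms N s \<subseteq> I" if "s > 0" for s
    using irrelevant_forms[OF I] that by blast
  then have zero: "hilb N I s = 0" if "s > 0" for s using hilb_0_iff[OF I] that by blast
  have "(\<Sum>s\<le>t. hilb N I s) = hilb N I 0" for t
    by (subst sum.remove[of _ 0]) (auto intro!: sum.neutral zero)
  moreover obtain t where "hilb N I 0 * (t + 1) ^ r < (\<Sum>s\<le>t. hilb N I s)"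
    using assms(2) unfolding big_def by blast
  ultimately have "hilb N I 0 * (t + 1) ^ r < hilb N I 0" by simp
  moreover have "hilb N I 0 * 1 \<le> hilb N I 0 * (t + 1) ^ r" by (rule mult_le_mono2) simp
  ultimately show False by linarith
qed

lemma big_split:
  assumes Q: "hideal N Q" and a: "a \<in> forms N e"
    and "\<not> big N (adjoin N Q a) r" "\<not> big N (colon N Q a) r"
  shows "\<not> big N Q r"
proof
  assume big: "big N Q r"
  let ?S = "\<lambda>I t. \<Sum>s\<le>t. hilb N I s"
  obtain C D where C: "\<And>t. ?S (adjoin N Q a) t \<le> C * (t + 1) ^ r"
    and D: "\<And>t. ?S (colon N Q a) t \<le> D * (t + 1) ^ r"
    using assms(3,4) unfolding big_def by (meson not_less)
  \<comment> \<open>the exact sequence starts in degree \<open>e\<close>; the finitely many smaller degrees go into the constant\<close>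
  have shift: "?S Q (t + e) \<le> ?S Q e + ?S (adjoin N Q a) (t + e) + ?S (colon N Q a) t" for t
  proof (induction t)
    case (Suc t)
    have "hilb N Q (Suc t + e) = hilb N (colon N Q a) (Suc t) + hilb N (adjoin N Q a) (Suc t + e)"
      by (rule hilb_exact[OF Q a])
    then show ?case using Suc by simp
  qed simp
  have bound: "?S Q t \<le> ?S Q e + ?S (adjoin N Q a) t + ?S (colon N Q a) t" for t
  proof (cases "t \<le> e")
    case True
    then have "?S Q t \<le> ?S Q e" by (intro sum_mono2) auto
    then show ?thesis by simp
  next
    case False
    have "?S (colon N Q a) (t - e) \<le> ?S (colon N Q a) t" by (intro sum_mono2) auto
    then show ?thesis using shift[of "t - e"] False by simp
  qed
  obtain t where t: "(?S Q e + C + D) * (t + 1) ^ r < ?S Q t"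
    using big unfolding big_def by blast
  have "?S Q e * 1 \<le> ?S Q e * (t + 1) ^ r" by (rule mult_le_mono2) simp
  then show False using t bound[of t] C[of t] D[of t] unfolding distrib_right by linarith
qed

text \<open>A hyperplane section \<open>P + (x)\<close> loses only one degree of growth, because the Hilbert function
  of the section is the difference function of that of \<open>P\<close>. A homogeneous ideal above it that is
  maximal among those of large growth is prime: if \<open>F G\<close> lies in it but \<open>F\<close> and \<open>G\<close> do not, then
  adjoining \<open>F\<close> and dividing by \<open>F\<close> both give larger ideals, hence small growth, and the exact
  sequence makes the growth of the ideal itself small.\<close>

lemma prime_step:
  assumes P: "hprime N P" and big: "big N P (Suc r)"
  shows "\<exists>Q. hprime N Q \<and> P \<subset> Q \<and> big N Q r"
proof -
  have hP: "hideal N P" using P hprimeD(1) by blast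
  obtain i where i: "i \<le> N" "Var i \<notin> P" using big_relevant[OF hP big] by (auto simp: relevant_def)
  define x where "x = (Var i :: 'a mpoly)"
  have x: "x \<in> forms N 1" "x \<notin> P" using i forms_Var by (auto simp: x_def)
  define I where "I = adjoin N P x"
  have I: "hideal N I" unfolding I_def by (rule hideal_adjoin[OF hP x(1)])
  let ?S = "\<lambda>I t. \<Sum>s\<le>t. hilb N I s"
  have le: "hilb N P t \<le> hilb N P 0 + ?S I t" for t
  proof (induction t)
    case (Suc t)
    have "hilb N P (t + 1) = hilb N P t + hilb N I (t + 1)"
      using hilb_exact[OF hP x(1), of t] colon_hprime[OF P forms_polynomial[OF x(1)] x(2)]
      by (simp add: I_def)
    then show ?case using Suc by simp
  qed simp
  have "big N I r"
  proof (rule ccontr)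
    assume "\<not> big N I r"
    then obtain C where C: "\<And>t. ?S I t \<le> C * (t + 1) ^ r" unfolding big_def by (meson not_less)
    have "hilb N P s \<le> (C + hilb N P 0) * (t + 1) ^ r" if "s \<le> t" for s t
    proof -
      have "(s + 1) ^ r \<le> (t + 1) ^ r" using that by (intro power_mono) auto
      then have "C * (s + 1) ^ r \<le> C * (t + 1) ^ r" by (rule mult_le_mono2)
      moreover have "hilb N P 0 * 1 \<le> hilb N P 0 * (t + 1) ^ r" by (rule mult_le_mono2) simp
      ultimately show ?thesis using le[of s] C[of s] unfolding distrib_right by linarith
    qed
    then have b: "?S P t \<le> of_nat (card {..t}) * ((C + hilb N P 0) * (t + 1) ^ r)" for t
      by (intro sum_bounded_above) auto
    have "?S P t \<le> (C + hilb N P 0) * (t + 1) ^ Suc r" for t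
      using b[of t] by (simp add: algebra_simps)
    then show False using big unfolding big_def by (metis not_less)
  qed
  then obtain Q where Q: "hideal N Q" "I \<subseteq> Q" "big N Q r"
    and max: "\<And>J. hideal N J \<Longrightarrow> Q \<subset> J \<Longrightarrow> \<not> big N J r"
    using hideal_maximal[OF I, of "\<lambda>J. big N J r"] by blast
  have "hprime N Q"
  proof (rule hprimeI[OF Q(1)])
    show "1 \<notin> Q"
    proof
      assume "1 \<in> Q"
      then have "Var i \<in> Q" if "i \<le> N" for i using hidealD(4)[OF Q(1), of 1 "Var i"] that by auto
      then show False using big_relevant[OF Q(1,3)] by (auto simp: relevant_def)
    qed
  next
    fix a b F G assume F: "F \<in> forms N a" and G: "G \<in> forms N b" and FG: "F * G \<in> Q"
    show "F \<in> Q \<or> G \<in> Q"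
    proof (rule ccontr)
      assume n: "\<not> ?thesis"
      have "Q \<subset> adjoin N Q F"
        using adjoin_superset[OF Q(1), of F] adjoin_self[OF Q(1), of F] n by blast
      moreover have "Q \<subset> colon N Q F"
        using colon_superset[OF Q(1) forms_polynomial[OF F]] n FG forms_polynomial[OF G]
        by (auto simp: colon_def)
      ultimately have "\<not> big N (adjoin N Q F) r" "\<not> big N (colon N Q F) r"
        by (simp_all add: max hideal_adjoin[OF Q(1) F] hideal_colon[OF Q(1) F])
      with big_split[OF Q(1) F] Q(3) show False by simp
    qed
  qed
  moreover have "P \<subset> Q" using adjoin_superset[OF hP, of x] adjoin_self[OF hP, of x] x(2) Q(2) I_def by blast
  ultimately show ?thesis using Q(3) by blast
qed

lemma prime_chain_exists:
  assumes "hprime N P" "big N P r"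
  shows "\<exists>Z. Z 0 = P \<and> (\<forall>i\<le>r. hprime N (Z i)) \<and> (\<forall>i<r. Z i \<subset> Z (Suc i)) \<and> relevant N (Z r)"
  using assms
proof (induction r arbitrary: P)
  case 0
  then show ?case using big_relevant[OF hprimeD(1)[OF 0(1)]] by (intro exI[of _ "\<lambda>_. P"]) auto
next
  case (Suc r)
  obtain Q where Q: "hprime N Q" "P \<subset> Q" "big N Q r" using prime_step[OF Suc.prems] by blast
  obtain Z where Z: "Z 0 = Q" "\<And>i. i \<le> r \<Longrightarrow> hprime N (Z i)" "\<And>i. i < r \<Longrightarrow> Z i \<subset> Z (Suc i)" "relevant N (Z r)"
    using Suc.IH[OF Q(1,3)] by blast
  define Y where "Y i = (case i of 0 \<Rightarrow> P | Suc j \<Rightarrow> Z j)" for i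
  have "hprime N (Y i)" if "i \<le> Suc r" for i
    using that Suc.prems(1) Z(2) by (auto simp: Y_def split: nat.splits)
  moreover have "Y i \<subset> Y (Suc i)" if "i < Suc r" for i
    using that Q(2) Z(1,3) by (cases i) (auto simp: Y_def)
  moreover have "Y 0 = P" "relevant N (Y (Suc r))" using Z(4) by (auto simp: Y_def)
  ultimately show ?case by blast
qed

section \<open>Graded algebras presented by polynomials\<close>

text \<open>A graded algebra together with a presentation \<open>\<pi>\<close> as a quotient of a polynomial ring by a
  homogeneous ideal. It is used for the coordinate rings of varieties, and with \<open>\<pi>\<close> the
  identity for the polynomial rings themselves. All questions about the algebra are translated
  into questions about polynomials modulo \<open>I\<close>.\<close>

locale presented_algebra =
  fixes A :: "('a, 'k::field) graded_algebra" (structure)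
    and \<pi> :: "'k mpoly \<Rightarrow> 'a" and N :: nat and I :: "'k mpoly set"
  assumes I: "hideal N I"
    and carrier: "carrier A = \<pi> ` polynomials_in N"
    and pi_add: "F \<in> polynomials_in N \<Longrightarrow> G \<in> polynomials_in N \<Longrightarrow> \<pi> F \<oplus> \<pi> G = \<pi> (F + G)"
    and pi_mult: "F \<in> polynomials_in N \<Longrightarrow> G \<in> polynomials_in N \<Longrightarrow> \<pi> F \<otimes> \<pi> G = \<pi> (F * G)"
    and pi_one: "\<one> = \<pi> 1"
    and pi_zero: "\<zero> = \<pi> 0"
    and pi_eq: "F \<in> polynomials_in N \<Longrightarrow> G \<in> polynomials_in N \<Longrightarrow> \<pi> F = \<pi> G \<longleftrightarrow> F - G \<in> I"
    and scalar: "scalar A c = \<pi> (Const c)"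
    and grade: "grade A d = \<pi> ` forms N d"
begin

abbreviation R where "R \<equiv> polynomials_in N :: 'k mpoly set"

lemma cring: "cring A"
proof (rule cringI)
  show "abelian_group A"
  proof (rule abelian_groupI)
    fix x assume "x \<in> carrier A"
    then obtain F where "x = \<pi> F" "F \<in> R" by (auto simp: carrier)
    then show "\<exists>y\<in>carrier A. y \<oplus> x = \<zero>"
      by (intro bexI[of _ "\<pi> (- F)"]) (auto simp: carrier pi_add pi_zero)
  qed (auto simp: carrier pi_add pi_zero algebra_simps intro!: imageI)
  show "comm_monoid A"
    by (rule comm_monoidI) (auto simp: carrier pi_mult pi_one algebra_simps intro!: imageI)
  show "(x \<oplus> y) \<otimes> z = x \<otimes> z \<oplus> y \<otimes> z" if "x \<in> carrier A" "y \<in> carrier A" "z \<in> carrier A" for x y z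
    using that by (auto simp: carrier pi_mult pi_add algebra_simps)
qed

sublocale cring A by (rule cring)

lemma pi_closed [simp]: "F \<in> R \<Longrightarrow> \<pi> F \<in> carrier A"
  by (auto simp: carrier)

lemma pi_eq_zero: "F \<in> R \<Longrightarrow> \<pi> F = \<zero> \<longleftrightarrow> F \<in> I"
  using pi_eq[of F 0] by (simp add: pi_zero)

definition ideal_preimage :: "'a set \<Rightarrow> 'k mpoly set" where
  "ideal_preimage p = {F \<in> R. \<pi> F \<in> p}"

lemma pi_mem_image:
  assumes P: "hideal N P" "I \<subseteq> P" and F: "F \<in> R"
  shows "\<pi> F \<in> \<pi> ` P \<longleftrightarrow> F \<in> P"
proof
  assume "\<pi> F \<in> \<pi> ` P"
  then obtain G where G: "G \<in> P" "\<pi> F = \<pi> G" by auto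
  then have "F - G \<in> P" using pi_eq[OF F, of G] hidealD(1)[OF P(1)] P(2) by auto
  from hidealD(3)[OF P(1) this G(1)] show "F \<in> P" by simp
qed auto

lemma preimage_image: "hideal N P \<Longrightarrow> I \<subseteq> P \<Longrightarrow> ideal_preimage (\<pi> ` P) = P"
  using pi_mem_image hidealD(1) by (auto simp: ideal_preimage_def)

lemma image_preimage: "p \<subseteq> carrier A \<Longrightarrow> \<pi> ` ideal_preimage p = p"
  by (auto simp: ideal_preimage_def carrier)

lemma ideal_image:
  assumes P: "hideal N P" "I \<subseteq> P"
  shows "ideal (\<pi> ` P) A"
proof (rule idealI)
  show "ring A" by unfold_locales
  show "subgroup (\<pi> ` P) (add_monoid A)"
  proof
    show "\<pi> ` P \<subseteq> carrier (add_monoid A)" using hidealD(1)[OF P(1)] by auto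
    show "\<one>\<^bsub>add_monoid A\<^esub> \<in> \<pi> ` P" using hidealD(2)[OF P(1)] by (auto simp: pi_zero)
    show "x \<otimes>\<^bsub>add_monoid A\<^esub> y \<in> \<pi> ` P" if "x \<in> \<pi> ` P" "y \<in> \<pi> ` P" for x y
      using that hidealD(1,3)[OF P(1)] by (auto simp: pi_add)
    show "inv\<^bsub>add_monoid A\<^esub> x \<in> \<pi> ` P" if x: "x \<in> \<pi> ` P" for x
    proof -
      obtain F where F: "F \<in> P" "x = \<pi> F" using x by auto
      have "- F \<in> P" using hideal_minus[OF P(1) hidealD(2)[OF P(1)] F(1)] by simp
      moreover have "\<pi> (- F) \<oplus> x = \<zero>"
        using F hidealD(1)[OF P(1)] by (simp add: pi_add pi_zero)
      then have "\<ominus> x = \<pi> (- F)"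
        using F hidealD(1)[OF P(1)] by (intro minus_equality) auto
      ultimately show ?thesis by (simp add: a_inv_def)
    qed
  qed
  show "x \<otimes> a \<in> \<pi> ` P" "a \<otimes> x \<in> \<pi> ` P" if "a \<in> \<pi> ` P" "x \<in> carrier A" for a x
    using that hidealD(1,4,5)[OF P(1)] by (auto simp: carrier pi_mult)
qed

lemma homogeneous_ideal_image:
  assumes P: "hideal N P" "I \<subseteq> P"
  shows "homogeneous_ideal (\<pi> ` P) A"
  unfolding homogeneous_ideal_def
proof (intro conjI ideal_image[OF P] subset_antisym)
  let ?S = "\<pi> ` P \<inter> (\<Union>d. grade A d)"
  have S: "?S \<subseteq> carrier A" using hidealD(1)[OF P(1)] by auto
  show "Idl ?S \<subseteq> \<pi> ` P" by (rule genideal_minimal[OF ideal_image[OF P]]) auto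
  interpret J: ideal "Idl ?S" A by (rule genideal_ideal[OF S])
  show "\<pi> ` P \<subseteq> Idl ?S"
  proof
    fix x assume "x \<in> \<pi> ` P"
    then obtain F where F: "F \<in> P" "x = \<pi> F" by auto
    obtain n where n: "F = (\<Sum>d\<le>n. component d F)" using comp_expand by blast
    have "\<pi> (\<Sum>d\<in>D. component d F) \<in> Idl ?S" if "finite D" for D
      using that
    proof (induction D rule: finite_induct)
      case empty
      then show ?case using J.zero_closed by (simp add: pi_zero)
    next
      case (insert d D)
      have "component d F \<in> P" "component d F \<in> forms N d" using F hidealD(1,6)[OF P(1)] by auto
      then have "\<pi> (component d F) \<in> Idl ?S" using genideal_self[OF S] by (auto simp: grade)
      moreover have "\<pi> (component d F) \<oplus> \<pi> (\<Sum>d\<in>D. component d F) = \<pi> (component d F + (\<Sum>d\<in>D. component d F))"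
        by (rule pi_add) (use F hidealD(1)[OF P(1)] in auto)
      ultimately show ?case using insert J.a_closed by fastforce
    qed
    then show "x \<in> Idl ?S" using n F(2) by (metis finite_atMost)
  qed
qed

text \<open>The polynomials all of whose components are mapped into \<open>p\<close> form an ideal, and its image
  contains the homogeneous elements of \<open>p\<close>. As these generate \<open>p\<close>, every element of the preimage
  is such a polynomial.\<close>

lemma hideal_preimage:
  assumes p: "homogeneous_ideal p A"
  shows "hideal N (ideal_preimage p)" "I \<subseteq> ideal_preimage p"
proof -
  interpret p: ideal p A using p by (simp add: homogeneous_ideal_def)
  let ?P = "{F \<in> R. \<forall>d. \<pi> (component d F) \<in> p}"
  have sum_p: "\<pi> (sum f D) \<in> p" if "\<And>d. d \<in> D \<Longrightarrow> f d \<in> R \<and> \<pi> (f d) \<in> p" for D :: "nat set" and f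
    using that
  proof (induction D rule: infinite_finite_induct)
    case (insert d D)
    then have "\<pi> (f d) \<oplus> \<pi> (sum f D) \<in> p" by (intro p.a_closed) auto
    moreover have "\<pi> (f d) \<oplus> \<pi> (sum f D) = \<pi> (f d + sum f D)" using insert by (intro pi_add) auto
    ultimately show ?case using insert by simp
  qed (auto simp: pi_zero[symmetric] p.zero_closed)
  have P: "hideal N ?P"
    unfolding hideal_def
  proof (intro conjI ballI allI)
    show "0 \<in> ?P" using p.zero_closed by (auto simp: pi_zero)
  next
    fix F G assume "F \<in> ?P" "G \<in> ?P"
    then show "F + G \<in> ?P" using p.a_closed by (auto simp: part_add pi_add[symmetric])
  next
    fix F G assume F: "F \<in> ?P" and G: "G \<in> R"
    have "\<pi> (component d (F * G)) \<in> p" for d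
      unfolding wpart_mult[OF weight_monomial_degree]
      by (rule sum_p) (use F G in \<open>auto simp: pi_mult[symmetric] intro!: p.I_r_closed\<close>)
    then show "F * G \<in> ?P" using F G by auto
  next
    fix F d assume F: "F \<in> ?P"
    then have "\<pi> (component e (component d F)) \<in> p" for e
      using comp_of_form[OF comp_forms[of F N d], of e] p.zero_closed by (auto simp: pi_zero)
    then show "component d F \<in> ?P" using F by auto
  qed auto
  have IP: "I \<subseteq> ?P"
  proof
    fix F assume F: "F \<in> I"
    have "\<pi> (component d F) = \<zero>" for d
      using hidealD(1,6)[OF I] F pi_eq_zero by simp
    then show "F \<in> ?P" using hidealD(1)[OF I F] p.zero_closed by simp
  qed
  have "p = Idl (p \<inter> (\<Union>d. grade A d))" using p by (simp add: homogeneous_ideal_def)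
  also have "\<dots> \<subseteq> \<pi> ` ?P"
  proof (rule genideal_minimal[OF ideal_image[OF P IP]], rule subsetI)
    fix x assume x: "x \<in> p \<inter> (\<Union>d. grade A d)"
    then obtain F d where F: "F \<in> forms N d" "x = \<pi> F" by (auto simp: grade)
    then have "\<pi> (component e F) \<in> p" for e
      using x p.zero_closed by (auto simp: comp_of_form[OF F(1)] pi_zero)
    then show "x \<in> \<pi> ` ?P" using F forms_polynomial[OF F(1)] by auto
  qed
  finally have "ideal_preimage p \<subseteq> ?P"
    using pi_mem_image[OF P IP] unfolding ideal_preimage_def by blast
  moreover have "?P \<subseteq> ideal_preimage p"
  proof
    fix F assume F: "F \<in> ?P"
    obtain n where n: "F = (\<Sum>d\<le>n. component d F)" using comp_expand by blast
    have "\<pi> (\<Sum>d\<le>n. component d F) \<in> p" by (rule sum_p) (use F in auto)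
    then show "F \<in> ideal_preimage p" using F n by (auto simp: ideal_preimage_def)
  qed
  ultimately have "ideal_preimage p = ?P" by blast
  then show "hideal N (ideal_preimage p)" "I \<subseteq> ideal_preimage p" using P IP by simp_all
qed

lemma homogeneous_prime_iff:
  "primeideal p A \<and> homogeneous_ideal p A \<longleftrightarrow> (\<exists>P. hprime N P \<and> I \<subseteq> P \<and> p = \<pi> ` P)"
proof
  assume p: "primeideal p A \<and> homogeneous_ideal p A"
  interpret p: primeideal p A using p by simp
  note P = hideal_preimage[OF conjunct2[OF p]]
  have "hprime N (ideal_preimage p)"
    unfolding hprime_def
  proof (intro conjI P ballI impI)
    show "1 \<notin> ideal_preimage p"
      using p.one_imp_carrier p.I_notcarr by (auto simp: ideal_preimage_def pi_one)
    fix F G assume "F \<in> R" "G \<in> R" "F * G \<in> ideal_preimage p"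
    then show "F \<in> ideal_preimage p \<or> G \<in> ideal_preimage p"
      using p.I_prime[of "\<pi> F" "\<pi> G"] by (auto simp: ideal_preimage_def pi_mult)
  qed
  with P show "\<exists>P. hprime N P \<and> I \<subseteq> P \<and> p = \<pi> ` P"
    using image_preimage[of p] p.a_subset by (intro exI[of _ "ideal_preimage p"]) auto
next
  assume "\<exists>P. hprime N P \<and> I \<subseteq> P \<and> p = \<pi> ` P"
  then obtain P where P: "hprime N P" "I \<subseteq> P" "p = \<pi> ` P" by blast
  have hP: "hideal N P" using P hprimeD by blast
  have "primeideal p A"
  proof (rule primeidealI)
    show "ideal p A" unfolding P(3) by (rule ideal_image[OF hP P(2)])
    show "carrier A \<noteq> p"
      using pi_mem_image[OF hP P(2), of 1] hprimeD(2)[OF P(1)] P(3) by auto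
    show "a \<in> p \<or> b \<in> p" if ab: "a \<in> carrier A" "b \<in> carrier A" "a \<otimes> b \<in> p" for a b
    proof -
      obtain F G where "F \<in> R" "a = \<pi> F" "G \<in> R" "b = \<pi> G" using ab by (auto simp: carrier)
      then show ?thesis
        using ab(3) hprime_mult_iff[OF P(1), of F G] pi_mem_image[OF hP P(2)]
        by (simp add: P(3) pi_mult)
    qed
  qed (rule cring)
  then show "primeideal p A \<and> homogeneous_ideal p A"
    using homogeneous_ideal_image[OF hP P(2)] P(3) by simp
qed

lemma contains_irrelevant_iff:
  assumes P: "hideal N P" "I \<subseteq> P"
  shows "contains_irrelevant (\<pi> ` P) A \<longleftrightarrow> \<not> relevant N P"
proof
  assume c: "contains_irrelevant (\<pi> ` P) A"
  have "Var i \<in> P" if "i \<le> N" for i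
  proof -
    have "\<pi> (Var i) \<in> \<pi> ` P"
      using c forms_Var[OF that] by (auto simp: contains_irrelevant_def grade)
    then show ?thesis using pi_mem_image[OF P] that by auto
  qed
  then show "\<not> relevant N P" by (auto simp: relevant_def)
next
  assume "\<not> relevant N P"
  then show "contains_irrelevant (\<pi> ` P) A"
    using irrelevant_forms[OF P(1)] by (auto simp: contains_irrelevant_def grade)
qed

text \<open>The points of \<open>Proj\<close>, seen as ideals of the polynomial ring.\<close>

definition point :: "'k mpoly set \<Rightarrow> bool" where
  "point P \<longleftrightarrow> hprime N P \<and> I \<subseteq> P \<and> relevant N P"

lemma pointD: "point P \<Longrightarrow> hprime N P" "point P \<Longrightarrow> hideal N P" "point P \<Longrightarrow> I \<subseteq> P" "point P \<Longrightarrow> relevant N P"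
  by (auto simp: point_def hprimeD)

lemma point_mem: "point P \<Longrightarrow> F \<in> R \<Longrightarrow> \<pi> F \<in> \<pi> ` P \<longleftrightarrow> F \<in> P"
  using pi_mem_image pointD by blast

lemma Proj_points_eq: "Proj_points A = (\<lambda>P. \<pi> ` P) ` {P. point P}"
proof -
  have "p \<in> Proj_points A \<longleftrightarrow> (\<exists>P. point P \<and> p = \<pi> ` P)" for p
    unfolding Proj_points_def mem_Collect_eq
    using homogeneous_prime_iff[of p] contains_irrelevant_iff hprimeD(1)
    by (metis point_def)
  then show ?thesis by auto
qed

definition basic_open :: "'k mpoly set \<Rightarrow> 'a set set" where
  "basic_open E = {p \<in> Proj_points A. \<exists>F\<in>E. \<pi> F \<notin> p}"

text \<open>The sets where a given form does not vanish are closed under finite intersection, because the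
  points are prime, and so they are a base of the topology.\<close>

lemma openin_Proj_iff:
  "openin (Proj A) U \<longleftrightarrow> (\<exists>E \<subseteq> (\<Union>d. forms N d). U = basic_open E)"
proof
  assume "openin (Proj A) U"
  then have "generate_topology_on {{p \<in> Proj_points A. f \<notin> p} |f. f \<in> (\<Union>d. grade A d)} U"
    by (simp add: Proj_def openin_topology_generated_by_iff)
  then show "\<exists>E \<subseteq> (\<Union>d. forms N d). U = basic_open E"
  proof induction
    case Empty
    then show ?case by (intro exI[of _ "{}"]) (auto simp: basic_open_def)
  next
    case (Int U V)
    then obtain D E where *: "D \<subseteq> (\<Union>d. forms N d)" "U = basic_open D" "E \<subseteq> (\<Union>d. forms N d)" "V = basic_open E"
      by blast
    let ?C = "{F * G |F G. F \<in> D \<and> G \<in> E}"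
    have C: "?C \<subseteq> (\<Union>d. forms N d)"
    proof
      fix H assume "H \<in> ?C"
      then obtain F G where H: "H = F * G" "F \<in> D" "G \<in> E" by blast
      then obtain a b where "F \<in> forms N a" "G \<in> forms N b" using *(1,3) by blast
      then have "H \<in> forms N (a + b)" unfolding H by (rule forms_mult)
      then show "H \<in> (\<Union>d. forms N d)" by blast
    qed
    moreover have "U \<inter> V = basic_open ?C"
    proof -
      have "(\<exists>H\<in>?C. \<pi> H \<notin> p) \<longleftrightarrow> (\<exists>F\<in>D. \<pi> F \<notin> p) \<and> (\<exists>F\<in>E. \<pi> F \<notin> p)"
        if p: "p \<in> Proj_points A" for p
      proof -
        obtain P where P: "point P" "p = \<pi> ` P" using p by (auto simp: Proj_points_eq)
        have DE: "D \<subseteq> R" "E \<subseteq> R" using *(1,3) by (auto dest!: subsetD dest: forms_polynomial)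
        have "\<pi> (F * G) \<in> p \<longleftrightarrow> \<pi> F \<in> p \<or> \<pi> G \<in> p" if "F \<in> D" "G \<in> E" for F G
        proof -
          have "F \<in> R" "G \<in> R" using that DE by auto
          then show ?thesis
            by (simp add: P(2) point_mem[OF P(1)] hprime_mult_iff[OF pointD(1)[OF P(1)]])
        qed
        then show ?thesis by blast
      qed
      then show ?thesis unfolding *(2,4) basic_open_def by blast
    qed
    ultimately show ?case using C by blast
  next
    case (UN K)
    then have "\<forall>k\<in>K. \<exists>E. E \<subseteq> (\<Union>d. forms N d) \<and> k = basic_open E" by blast
    then obtain E where E: "\<And>k. k \<in> K \<Longrightarrow> E k \<subseteq> (\<Union>d. forms N d) \<and> k = basic_open (E k)" by metis
    have "\<Union>K = basic_open (\<Union>k\<in>K. E k)"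
    proof (rule subset_antisym; rule subsetI)
      fix p assume "p \<in> \<Union>K"
      then obtain k where k: "k \<in> K" "p \<in> k" by blast
      then have "p \<in> basic_open (E k)" using E by blast
      then show "p \<in> basic_open (\<Union>k\<in>K. E k)" using k by (auto simp: basic_open_def)
    next
      fix p assume "p \<in> basic_open (\<Union>k\<in>K. E k)"
      then obtain k where k: "k \<in> K" "p \<in> basic_open (E k)" by (auto simp: basic_open_def)
      then show "p \<in> \<Union>K" using E by blast
    qed
    moreover have "(\<Union>k\<in>K. E k) \<subseteq> (\<Union>d. forms N d)" using E by blast
    ultimately show ?case by blast
  next
    case (Basis s)
    then obtain F d where F: "F \<in> forms N d" "s = {p \<in> Proj_points A. \<pi> F \<notin> p}" by (auto simp: grade)
    then show ?case by (intro exI[of _ "{F}"]) (auto simp: basic_open_def)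
  qed
next
  assume "\<exists>E \<subseteq> (\<Union>d. forms N d). U = basic_open E"
  then obtain E where E: "E \<subseteq> (\<Union>d. forms N d)" "U = basic_open E" by blast
  have "U = (\<Union>F\<in>E. {p \<in> Proj_points A. \<pi> F \<notin> p})" unfolding E(2) basic_open_def by blast
  also have "openin (Proj A) \<dots>"
    unfolding Proj_def
  proof (rule openin_Union, safe)
    fix F assume "F \<in> E"
    then obtain d where "F \<in> forms N d" using E(1) by blast
    then have "\<pi> F \<in> (\<Union>d. grade A d)" unfolding grade by blast
    then show "openin (topology_generated_by {{p \<in> Proj_points A. f \<notin> p} |f. f \<in> (\<Union>d. grade A d)})
        {p \<in> Proj_points A. \<pi> F \<notin> p}"
      by (intro topology_generated_by_Basis) blast
  qed
  finally show "openin (Proj A) U" .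
qed

lemma topspace_Proj: "topspace (Proj A) = Proj_points A"
proof
  show "topspace (Proj A) \<subseteq> Proj_points A"
    using openin_topspace[of "Proj A"] unfolding openin_Proj_iff basic_open_def by auto
  have "Proj_points A = basic_open {1}"
    using point_mem hprimeD(2)[OF pointD(1)] by (auto simp: basic_open_def Proj_points_eq)
  then have "openin (Proj A) (Proj_points A)"
    unfolding openin_Proj_iff using forms_one by (intro exI[of _ "{1}"]) auto
  then show "Proj_points A \<subseteq> topspace (Proj A)" by (rule openin_subset)
qed

definition zero_locus :: "'k mpoly set \<Rightarrow> 'a set set" where
  "zero_locus E = {p \<in> Proj_points A. \<forall>F\<in>E. \<pi> F \<in> p}"

lemma closedin_Proj_iff:
  "closedin (Proj A) Z \<longleftrightarrow> (\<exists>E \<subseteq> (\<Union>d. forms N d). Z = zero_locus E)"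
proof -
  have "zero_locus E = Proj_points A - basic_open E" "basic_open E = Proj_points A - zero_locus E" for E
    by (auto simp: zero_locus_def basic_open_def)
  moreover have "zero_locus E \<subseteq> Proj_points A" for E by (auto simp: zero_locus_def)
  ultimately show ?thesis
    unfolding closedin_def topspace_Proj openin_Proj_iff by (metis double_diff order_refl)
qed

lemma mem_zero_locus:
  assumes P: "point P" and E: "E \<subseteq> R"
  shows "\<pi> ` P \<in> zero_locus E \<longleftrightarrow> E \<subseteq> P"
proof -
  have m: "\<pi> F \<in> \<pi> ` P \<longleftrightarrow> F \<in> P" if "F \<in> E" for F using point_mem[OF P] E that by blast
  have "\<pi> ` P \<in> Proj_points A" using P by (auto simp: Proj_points_eq)
  then show ?thesis unfolding zero_locus_def using m by blast
qed

lemma zero_locus_cong_forms: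
  assumes "hideal N P"
  shows "zero_locus P = zero_locus (P \<inter> (\<Union>d. forms N d))"
proof -
  have "P \<subseteq> Q \<longleftrightarrow> P \<inter> (\<Union>d. forms N d) \<subseteq> Q" if Q: "hideal N Q" for Q
  proof
    assume s: "P \<inter> (\<Union>d. forms N d) \<subseteq> Q"
    show "P \<subseteq> Q"
    proof
      fix F assume "F \<in> P"
      then have "component d F \<in> Q" for d using s hidealD(1,6)[OF assms, of F] comp_forms by blast
      then show "F \<in> Q" using hideal_comps[OF Q] by blast
    qed
  qed auto
  moreover have "P \<subseteq> R" "P \<inter> (\<Union>d. forms N d) \<subseteq> R" using hidealD(1)[OF assms] by auto
  ultimately have "\<pi> ` Q \<in> zero_locus P \<longleftrightarrow> \<pi> ` Q \<in> zero_locus (P \<inter> (\<Union>d. forms N d))" if "point Q" for Q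
    using mem_zero_locus[OF that] pointD(2)[OF that] by presburger
  moreover have "zero_locus E \<subseteq> (\<lambda>P. \<pi> ` P) ` {P. point P}" for E
    by (auto simp: zero_locus_def Proj_points_eq)
  ultimately show ?thesis by blast
qed

lemma irreducible_zero_locus:
  assumes P: "point P"
  shows "irreducible_closed (Proj A) (zero_locus P)"
  unfolding irreducible_closed_def
proof (intro conjI allI impI)
  have PR: "P \<subseteq> R" using hidealD(1)[OF pointD(2)[OF P]] by auto
  have mem: "\<pi> ` P \<in> zero_locus P" using mem_zero_locus[OF P PR] by simp
  then show "zero_locus P \<noteq> {}" by blast
  show "closedin (Proj A) (zero_locus P)"
    unfolding closedin_Proj_iff using zero_locus_cong_forms[OF pointD(2)[OF P]] by blast
  have sub: "zero_locus P \<subseteq> C" if C: "closedin (Proj A) C" "\<pi> ` P \<in> C" for C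
  proof -
    obtain E where E: "E \<subseteq> (\<Union>d. forms N d)" "C = zero_locus E" using C closedin_Proj_iff by auto
    have "E \<subseteq> R" using E(1) forms_polynomial by blast
    then have "E \<subseteq> P" using mem_zero_locus[OF P] C E(2) by blast
    then show ?thesis unfolding E(2) zero_locus_def by blast
  qed
  fix C D assume "closedin (Proj A) C \<and> closedin (Proj A) D \<and> zero_locus P \<subseteq> C \<union> D"
  then show "zero_locus P \<subseteq> C \<or> zero_locus P \<subseteq> D" using sub mem by blast
qed

definition vanishing :: "'a set set \<Rightarrow> 'k mpoly set" where
  "vanishing W = {F \<in> R. \<forall>p\<in>W. \<pi> F \<in> p}"

text \<open>Irreducible closed sets correspond to homogeneous primes: if a product of forms vanishes on
  \<open>W\<close>, then \<open>W\<close> is covered by the zero loci of the two factors, and lies in one of them.\<close>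

lemma vanishing_point:
  assumes W: "irreducible_closed (Proj A) W"
  shows "point (vanishing W)" "zero_locus (vanishing W) = W"
proof -
  have cl: "closedin (Proj A) W" and ne: "W \<noteq> {}" using W by (auto simp: irreducible_closed_def)
  have WP: "W \<subseteq> Proj_points A" using closedin_subset[OF cl] by (simp add: topspace_Proj)
  have pt: "\<exists>P. point P \<and> p = \<pi> ` P" if "p \<in> W" for p using WP that by (auto simp: Proj_points_eq)
  have van: "F \<in> vanishing W \<longleftrightarrow> F \<in> R \<and> (\<forall>P. point P \<longrightarrow> \<pi> ` P \<in> W \<longrightarrow> F \<in> P)" for F
    using pt point_mem unfolding vanishing_def by blast
  have H: "hideal N (vanishing W)"
    unfolding hideal_def van
    using hidealD[OF pointD(2)] by (auto simp: van)
  have IW: "I \<subseteq> vanishing W" using van pointD(3) hidealD(1)[OF I] by blast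
  obtain P0 where P0: "point P0" "\<pi> ` P0 \<in> W" using ne pt by blast
  have "vanishing W \<subseteq> P0" using van P0 by blast
  have "hprime N (vanishing W)"
  proof (rule hprimeI[OF H])
    show "1 \<notin> vanishing W" using \<open>vanishing W \<subseteq> P0\<close> hprimeD(2)[OF pointD(1)[OF P0(1)]] by blast
    fix a b F G assume F: "F \<in> forms N a" and G: "G \<in> forms N b" and FG: "F * G \<in> vanishing W"
    have cl: "closedin (Proj A) (zero_locus {F})" "closedin (Proj A) (zero_locus {G})"
      unfolding closedin_Proj_iff
      by (rule exI[of _ "{F}"], use F in auto) (rule exI[of _ "{G}"], use G in auto)
    note FR = forms_polynomial[OF F] and GR = forms_polynomial[OF G]
    have "W \<subseteq> zero_locus {F} \<union> zero_locus {G}"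
    proof
      fix p assume "p \<in> W"
      then obtain P where P: "point P" "p = \<pi> ` P" using pt by blast
      then have "F * G \<in> P" using FG van \<open>p \<in> W\<close> by blast
      then have "F \<in> P \<or> G \<in> P" using hprimeD(3)[OF pointD(1)[OF P(1)] FR GR] by blast
      then show "p \<in> zero_locus {F} \<union> zero_locus {G}"
        unfolding P(2) using mem_zero_locus[OF P(1)] FR GR by auto
    qed
    then have "W \<subseteq> zero_locus {F} \<or> W \<subseteq> zero_locus {G}"
      using W cl unfolding irreducible_closed_def by blast
    then show "F \<in> vanishing W \<or> G \<in> vanishing W"
      using FR GR unfolding vanishing_def zero_locus_def by blast
  qed
  moreover have "relevant N (vanishing W)"
    using pointD(4)[OF P0(1)] \<open>vanishing W \<subseteq> P0\<close> by (auto simp: relevant_def)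
  ultimately show "point (vanishing W)" using IW by (simp add: point_def)
  obtain E where E: "E \<subseteq> (\<Union>d. forms N d)" "W = zero_locus E" using cl closedin_Proj_iff by auto
  have "E \<subseteq> vanishing W" using E forms_polynomial unfolding vanishing_def zero_locus_def by blast
  then have "zero_locus (vanishing W) \<subseteq> W" unfolding E(2) zero_locus_def by blast
  moreover have "W \<subseteq> zero_locus (vanishing W)"
    using WP unfolding vanishing_def zero_locus_def by blast
  ultimately show "zero_locus (vanishing W) = W" by blast
qed

text \<open>The correspondence between irreducible closed sets and homogeneous primes reverses inclusions,
  hence the reversed indices.\<close>

lemma krull_dim_Proj:
  assumes upper: "\<And>m Z. (\<And>i. i \<le> m \<Longrightarrow> hprime N (Z i)) \<Longrightarrow> (\<And>i. i < m \<Longrightarrow> Z i \<subset> Z (Suc i)) \<Longrightarrow>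
        relevant N (Z m) \<Longrightarrow> I \<subseteq> Z 0 \<Longrightarrow> m \<le> n"
    and lower: "\<exists>Z. I \<subseteq> Z 0 \<and> (\<forall>i\<le>n. hprime N (Z i)) \<and> (\<forall>i<n. Z i \<subset> Z (Suc i)) \<and> relevant N (Z n)"
  shows "krull_dim (Proj A) = enat n"
proof -
  let ?M = "{m. \<exists>Z. (\<forall>i\<le>m. irreducible_closed (Proj A) (Z i)) \<and> (\<forall>i<m. Z i \<subset> Z (Suc i))}"
  have "m \<le> n" if "m \<in> ?M" for m
  proof -
    obtain W where W: "\<And>i. i \<le> m \<Longrightarrow> irreducible_closed (Proj A) (W i)" "\<And>i. i < m \<Longrightarrow> W i \<subset> W (Suc i)"
      using \<open>m \<in> ?M\<close> by blast
    define Z where "Z i = vanishing (W (m - i))" for i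
    have pt: "point (Z i)" if "i \<le> m" for i
      using vanishing_point(1)[OF W(1), of "m - i"] by (simp add: Z_def)
    show ?thesis
    proof (rule upper[of m Z])
      show "Z i \<subset> Z (Suc i)" if "i < m" for i
      proof -
        have "Suc (m - Suc i) = m - i" using that by simp
        then have s: "W (m - Suc i) \<subset> W (m - i)" using W(2)[of "m - Suc i"] that by simp
        then have "Z i \<subseteq> Z (Suc i)" unfolding Z_def vanishing_def by blast
        moreover have "Z i \<noteq> Z (Suc i)"
        proof
          assume "Z i = Z (Suc i)"
          then have "zero_locus (Z i) = zero_locus (Z (Suc i))" by simp
          then have "W (m - i) = W (m - Suc i)"
            by (simp add: Z_def vanishing_point(2)[OF W(1)])
          with s show False by simp
        qed
        ultimately show ?thesis by blast
      qed
    qed (use pt pointD in auto)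
  qed
  moreover have "n \<in> ?M"
  proof -
    obtain Z where Z: "I \<subseteq> Z 0" "\<And>i. i \<le> n \<Longrightarrow> hprime N (Z i)" "\<And>i. i < n \<Longrightarrow> Z i \<subset> Z (Suc i)" "relevant N (Z n)"
      using lower by blast
    have up: "Z i \<subseteq> Z n" if "i \<le> n" for i
      using that by (induction rule: inc_induct) (use Z(3) in blast)+
    have down: "I \<subseteq> Z i" if "i \<le> n" for i
      using that
    proof (induction i)
      case (Suc i)
      then have "I \<subseteq> Z i" "i < n" by auto
      then show ?case using Z(3)[of i] by blast
    qed (rule Z(1))
    have pt: "point (Z i)" if "i \<le> n" for i
      using that Z(2,4) up[OF that] down[OF that] by (auto simp: point_def relevant_def)
    define W where "W i = zero_locus (Z (n - i))" for i
    have "irreducible_closed (Proj A) (W i)" if "i \<le> n" for i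
      unfolding W_def by (rule irreducible_zero_locus) (use pt in simp)
    moreover have "W i \<subset> W (Suc i)" if i: "i < n" for i
    proof -
      define k where "k = n - Suc i"
      have k: "k < n" "n - i = Suc k" using i by (auto simp: k_def)
      have s: "Z k \<subset> Z (Suc k)" using Z(3)[OF k(1)] .
      have ptk: "point (Z k)" using pt k by simp
      have "Z j \<subseteq> R" if "j \<le> n" for j using hidealD(1)[OF pointD(2)[OF pt[OF that]]] by auto
      then have "\<pi> ` Z k \<in> zero_locus (Z k)" "\<pi> ` Z k \<notin> zero_locus (Z (Suc k))"
        using mem_zero_locus[OF ptk] s k by auto
      moreover have "zero_locus (Z (Suc k)) \<subseteq> zero_locus (Z k)" using s unfolding zero_locus_def by blast
      ultimately show ?thesis unfolding W_def k(2) k_def[symmetric] by blast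
    qed
    ultimately show ?thesis by blast
  qed
  ultimately have "(SUP m\<in>?M. enat m) = enat n"
    by (intro antisym SUP_least SUP_upper) auto
  then show ?thesis by (simp add: krull_dim_def)
qed

section \<open>Hilbert functions and dimension\<close>

lemma scalars_subfield:
  assumes "1 \<notin> I"
  shows "subfield (range (scalar A)) A"
proof (rule subfieldI)
  let ?K = "range (scalar A)"
  have K: "?K = range (\<lambda>c. \<pi> (Const c))" by (auto simp: scalar)
  have ne: "\<pi> (Const c) \<noteq> \<zero>" if "c \<noteq> 0" for c
  proof
    assume "\<pi> (Const c) = \<zero>"
    then have "Const c \<in> I" by (simp add: pi_eq_zero)
    then have "Const c * Const (1 / c) \<in> I" by (rule hidealD(4)[OF I]) simp
    then show False using assms that by (simp add: Const_simps flip: Const_simps(2))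
  qed
  have "subring ?K A"
  proof (rule subringI)
    show "\<one> \<in> ?K" unfolding K pi_one by (rule image_eqI[of _ _ 1]) (simp_all add: Const_simps)
    show "\<ominus> h \<in> ?K" if "h \<in> ?K" for h
    proof -
      obtain c where c: "h = \<pi> (Const c)" using \<open>h \<in> ?K\<close> K by auto
      have "\<pi> (Const (- c)) \<oplus> h = \<zero>" by (simp add: c pi_add pi_zero Const_simps)
      then have "\<ominus> h = \<pi> (Const (- c))" by (intro minus_equality) (auto simp: c)
      then show ?thesis unfolding K by blast
    qed
    show "h1 \<otimes> h2 \<in> ?K" "h1 \<oplus> h2 \<in> ?K" if "h1 \<in> ?K" "h2 \<in> ?K" for h1 h2
      using that unfolding K by (auto simp: pi_mult pi_add simp flip: Const_simps)
  qed (auto simp: scalar)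
  then show "subcring ?K A" by (rule subcringI')
  show "Units (A\<lparr>carrier := ?K\<rparr>) = ?K - {\<zero>}"
  proof (rule subset_antisym; rule subsetI)
    fix x assume "x \<in> Units (A\<lparr>carrier := ?K\<rparr>)"
    then have x: "x \<in> ?K" "\<exists>y\<in>?K. y \<otimes> x = \<one>" by (auto simp: Units_def)
    have "x \<noteq> \<zero>"
    proof
      assume "x = \<zero>"
      with x have "\<one> = \<zero>" by (auto simp: scalar)
      then show False using assms pi_eq_zero[of 1] by (simp add: pi_one)
    qed
    with x show "x \<in> ?K - {\<zero>}" by auto
  next
    fix x assume "x \<in> ?K - {\<zero>}"
    then obtain c where c: "x = \<pi> (Const c)" and "x \<noteq> \<zero>" by (auto simp: scalar)
    then have "c \<noteq> 0" by (auto simp: pi_zero Const_simps)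
    have "\<pi> (Const (1 / c)) \<otimes> x = \<one>" "x \<otimes> \<pi> (Const (1 / c)) = \<one>"
      using c \<open>c \<noteq> 0\<close> by (simp_all add: pi_mult pi_one Const_simps flip: Const_simps(2))
    then show "x \<in> Units (A\<lparr>carrier := ?K\<rparr>)"
      unfolding Units_def K by (auto simp: c)
  qed
qed

lemma reldim_dimension:
  assumes "mp.reldim W E n" and W: "W \<subseteq> I" "mp.subspace W"
    and "E \<subseteq> R" "E \<inter> I \<subseteq> W"
  shows "dimension n (range (scalar A)) (\<pi> ` E)"
  using assms(1,4,5)
proof (induction rule: mp.reldim.induct)
  case reldim_refl
  have "\<pi> F = \<zero>" if "F \<in> W" for F
  proof -
    have "F \<in> R" "F \<in> I" using that W(1) reldim_refl(1) by auto
    then show ?thesis using pi_eq_zero by simp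
  qed
  then have "\<pi> ` W \<subseteq> {\<zero>}" by blast
  moreover have "\<zero> \<in> \<pi> ` W" unfolding pi_zero by (rule imageI[OF mp.subspace_0[OF W(2)]])
  ultimately have "\<pi> ` W = {\<zero>}" by blast
  then show ?case by simp
next
  case (reldim_step E n v)
  let ?E = "{Const c * v + e |c e. e \<in> E}"
  have sub: "E \<subseteq> ?E"
  proof
    fix e assume "e \<in> E"
    then have "e = Const 0 * v + e" by (simp add: Const_simps)
    then show "e \<in> ?E" using \<open>e \<in> E\<close> by blast
  qed
  note sE = mp.reldim_subspace[OF reldim_step(1) W(2)]
  have "v = Const 1 * v + 0" by (simp add: Const_simps)
  then have v: "v \<in> ?E" using mp.subspace_0[OF sE(1)] by blast
  have ER: "E \<subseteq> R" "v \<in> R" using reldim_step(4) sub v by auto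
  have "\<pi> v \<notin> \<pi> ` E"
  proof
    assume "\<pi> v \<in> \<pi> ` E"
    then obtain e where e: "e \<in> E" "\<pi> v = \<pi> e" by blast
    then have "v - e \<in> I" using pi_eq[of v e] ER by auto
    moreover have "v - e \<in> ?E"
      using mp.subspace_diff[OF mp.subspace_line_extension[OF sE(1)] v] e sub by blast
    ultimately have "v - e \<in> W" using reldim_step(5) by blast
    then have "v - e \<in> E" using sE(2) by blast
    then have "(v - e) + e \<in> E" using e(1) mp.subspace_add[OF sE(1)] by blast
    then show False using reldim_step(2) by simp
  qed
  moreover have "dimension n (range (scalar A)) (\<pi> ` E)"
    using reldim_step sub by blast
  ultimately have "dimension (Suc n) (range (scalar A)) (line_extension (range (scalar A)) (\<pi> v) (\<pi> ` E))"
    using ER by (intro Suc_dim) auto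
  moreover have "line_extension (range (scalar A)) (\<pi> v) (\<pi> ` E) = \<pi> ` ?E"
  proof -
    have *: "scalar A c \<otimes> \<pi> v \<oplus> \<pi> e = \<pi> (Const c * v + e)" if "e \<in> E" for c e
      using that ER by (auto simp: scalar pi_mult pi_add)
    have "u \<in> line_extension (range (scalar A)) (\<pi> v) (\<pi> ` E) \<longleftrightarrow> u \<in> \<pi> ` ?E" for u
    proof
      assume "u \<in> line_extension (range (scalar A)) (\<pi> v) (\<pi> ` E)"
      then obtain c e where "e \<in> E" "u = scalar A c \<otimes> \<pi> v \<oplus> \<pi> e"
        unfolding line_extension_mem_iff by blast
      then show "u \<in> \<pi> ` ?E" using *[of e c] by blast
    next
      assume "u \<in> \<pi> ` ?E"
      then obtain c e where ce: "e \<in> E" "u = \<pi> (Const c * v + e)" by blast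
      then have "u = scalar A c \<otimes> \<pi> v \<oplus> \<pi> e" using *[of e c] by simp
      then show "u \<in> line_extension (range (scalar A)) (\<pi> v) (\<pi> ` E)"
        unfolding line_extension_mem_iff
        by (intro bexI[of _ "scalar A c"] bexI[of _ "\<pi> e"]) (use ce in auto)
    qed
    then show ?thesis by blast
  qed
  ultimately show ?case by simp
qed

lemma hilbert_function_eq:
  assumes "1 \<notin> I"
  shows "hilbert_function A t = hilb N I t"
proof -
  have "dimension (hilb N I t) (range (scalar A)) (grade A t)"
    unfolding grade
    by (rule reldim_dimension[OF hilb_reldim[OF I]])
      (use hideal_forms_subspace[OF I] forms_polynomial in auto)
  then show ?thesis
    unfolding hilbert_function_def
    using dimension_is_inj[OF scalars_subfield[OF assms]] by (intro the_equality) auto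
qed

lemma hilbert_polynomial_eqI:
  assumes "1 \<notin> I" and P: "\<And>t. t \<ge> t0 \<Longrightarrow> of_nat (hilb N I t) = poly P (of_nat t)"
  shows "hilbert_polynomial A = P"
  unfolding hilbert_polynomial_def hilbert_function_eq[OF assms(1)]
proof (rule the_equality)
  show ev: "\<forall>\<^sub>F t in sequentially. poly P (of_nat t) = of_nat (hilb N I t)"
    by (rule eventually_sequentiallyI[of t0]) (simp add: P)
  fix Q :: "rat poly" assume "\<forall>\<^sub>F t in sequentially. poly Q (of_nat t) = of_nat (hilb N I t)"
  with ev have "\<forall>\<^sub>F t in sequentially. poly P (of_nat t) = poly Q (of_nat t)"
    by eventually_elim simp
  then obtain s where s: "\<And>t. t \<ge> s \<Longrightarrow> poly P (of_nat t) = poly Q (of_nat t)"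
    by (auto simp: eventually_sequentially)
  show "Q = P"
  proof (rule ccontr)
    assume "Q \<noteq> P"
    then have "finite {x. poly (Q - P) x = 0}" by (intro poly_roots_finite) simp
    moreover have "of_nat ` {s..} \<subseteq> {x. poly (Q - P) x = 0}" using s by auto
    moreover have "infinite (of_nat ` {s..} :: rat set)"
      by (subst finite_image_iff) (auto simp: inj_on_def infinite_Ici)
    ultimately show False using finite_subset by blast
  qed
qed

text \<open>A chain with more than \<open>n + 1\<close> primes would make the Hilbert function grow with exponent
  \<open>n + 1\<close>, against the upper bound; the lower bound makes the ideal big enough to start a chain
  with \<open>n + 1\<close> primes.\<close>

lemma krull_dim_by_growth:
  assumes P: "hprime N I"
    and upper: "\<And>t. hilb N I t \<le> c * (t + 1) ^ n"
    and lower: "\<And>t. (t + n) choose n \<le> hilb N I (t + l)"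
  shows "krull_dim (Proj A) = enat n"
proof (rule krull_dim_Proj)
  \<comment> \<open>the constant in the bound of \<open>(t + 1) ^ (n + 1)\<close> by a binomial coefficient\<close>
  define K where "K = (n + 1) ^ (n + 1)"
  have choose: "(t + 1) ^ (n + 1) \<le> K * ((t + (n + 1)) choose (n + 1))" for t
  proof -
    have *: "real (t + m) ^ m \<le> real (m ^ m) * real ((t + m) choose m)" if "m > 0" for m
    proof -
      have "(real (t + m) / real m) ^ m \<le> real ((t + m) choose m)"
        by (rule binomial_ge_n_over_k_pow_k) simp
      then show ?thesis using that by (simp add: power_divide divide_le_eq mult.commute)
    qed
    have "real (t + (n + 1)) ^ (n + 1) \<le> real K * real ((t + (n + 1)) choose (n + 1))"
      unfolding K_def by (rule *) simp
    moreover have "real (t + 1) ^ (n + 1) \<le> real (t + (n + 1)) ^ (n + 1)"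
      by (intro power_mono) auto
    ultimately have "real (t + 1) ^ (n + 1) \<le> real K * real ((t + (n + 1)) choose (n + 1))"
      by (rule order_trans[rotated])
    then have "real ((t + 1) ^ (n + 1)) \<le> real (K * ((t + (n + 1)) choose (n + 1)))"
      by (simp only: of_nat_power of_nat_mult)
    then show ?thesis unfolding of_nat_le_iff .
  qed
  {
    fix m Z
    assume Z: "\<And>i. i \<le> m \<Longrightarrow> hprime N (Z i)" "\<And>i. i < m \<Longrightarrow> Z i \<subset> Z (Suc i)"
      "relevant N (Z m)" "I \<subseteq> Z 0"
    show "m \<le> n"
    proof (rule ccontr)
      assume "\<not> m \<le> n"
      then have m: "n + 1 \<le> m" by simp
      have "Z (n + 1) \<subseteq> Z m"
        using m by (induction rule: inc_induct) (use Z(2) in blast)+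
      then have "relevant N (Z (n + 1))" using Z(3) by (auto simp: relevant_def)
      then obtain e where e: "\<And>j. (j + (n + 1)) choose (n + 1) \<le> hilb N (Z 0) (j * e)"
        using chain_hilb_lower_bound[of "n + 1" N Z] Z(1,2) m by auto
      have "j + 1 \<le> K * c * (e + 1) ^ n" for j
      proof -
        have "hilb N (Z 0) (j * e) \<le> hilb N I (j * e)"
          using hilb_antimono[OF I hprimeD(1)[OF Z(1)[of 0]] Z(4)] by simp
        then have "(j + (n + 1)) choose (n + 1) \<le> c * (j * e + 1) ^ n"
          using e[of j] upper[of "j * e"] by linarith
        also have "\<dots> \<le> c * ((j + 1) * (e + 1)) ^ n"
          by (intro mult_left_mono power_mono) auto
        finally have "K * ((j + (n + 1)) choose (n + 1)) \<le> K * (c * ((j + 1) * (e + 1)) ^ n)"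
          by (rule mult_le_mono2)
        with choose[of j] have "(j + 1) ^ (n + 1) \<le> K * (c * ((j + 1) * (e + 1)) ^ n)" by linarith
        then have "(j + 1) ^ n * (j + 1) \<le> (j + 1) ^ n * (K * c * (e + 1) ^ n)"
          by (simp only: power_add power_one_right power_mult_distrib mult_ac)
        then show ?thesis by (subst (asm) mult_le_cancel1) simp
      qed
      \<comment> \<open>a bound on \<open>j\<close> that is supposed to hold for all \<open>j\<close>\<close>
      from this[of "K * c * (e + 1) ^ n"] show False by simp
    qed
  }
  have "big N I n"
    unfolding big_def
  proof
    fix C
    \<comment> \<open>large enough that \<open>t (t + 1) ^ n\<close> exceeds the required bound, after the shift by \<open>l\<close>\<close>
    define t where "t = K * (C * (l + 1) ^ n)"
    have "K * (C * (t + l + 1) ^ n) \<le> K * (C * ((l + 1) * (t + 1)) ^ n)"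
      by (intro mult_left_mono power_mono) auto
    also have "\<dots> = t * (t + 1) ^ n" by (simp only: t_def power_mult_distrib mult_ac)
    also have "\<dots> < (t + 1) ^ (n + 1)" by simp
    also have "\<dots> \<le> K * ((t + (n + 1)) choose (n + 1))" by (rule choose)
    finally have "C * (t + l + 1) ^ n < (t + (n + 1)) choose (n + 1)"
      by (subst (asm) mult_less_cancel1) simp
    also have "\<dots> = (\<Sum>s\<le>t. (s + n) choose n)"
      using sum_choose_upper[of "n" "t + n"]
      by (induction t) (auto simp: add.commute)
    also have "\<dots> \<le> (\<Sum>s\<le>t. hilb N I (s + l))" by (intro sum_mono lower)
    also have "\<dots> = (\<Sum>s\<in>(\<lambda>s. s + l) ` {..t}. hilb N I s)"
      by (subst sum.reindex) (auto simp: inj_on_def)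
    also have "\<dots> \<le> (\<Sum>s\<le>t + l. hilb N I s)" by (intro sum_mono2) auto
    finally show "\<exists>t. C * (t + 1) ^ n < (\<Sum>s\<le>t. hilb N I s)" by blast
  qed
  from prime_chain_exists[OF P this]
  show "\<exists>Z. I \<subseteq> Z 0 \<and> (\<forall>i\<le>n. hprime N (Z i)) \<and> (\<forall>i<n. Z i \<subset> Z (Suc i)) \<and> relevant N (Z n)"
    by blast
qed

end

section \<open>The function field\<close>

locale presented_domain = presented_algebra A \<pi> N I
  for A :: "('a, 'k::field) graded_algebra" (structure) and \<pi> N I +
  assumes prime: "hprime N I"
begin

definition rational :: "'k mpoly \<Rightarrow> 'k mpoly \<Rightarrow> ('a \<times> 'a) set" where
  "rational F G = fraction A (\<pi> F) (\<pi> G)"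

text \<open>The admissible numerators and denominators: forms of the same degree \<open>d\<close>, with a denominator
  that is nonzero in the quotient.\<close>

definition fracpair :: "nat \<Rightarrow> 'k mpoly \<Rightarrow> 'k mpoly \<Rightarrow> bool" where
  "fracpair d F G \<longleftrightarrow> F \<in> forms N d \<and> G \<in> forms N d \<and> G \<notin> I"

lemma fracpairD: "fracpair d F G \<Longrightarrow> F \<in> forms N d" "fracpair d F G \<Longrightarrow> G \<in> forms N d"
  "fracpair d F G \<Longrightarrow> F \<in> R" "fracpair d F G \<Longrightarrow> G \<in> R" "fracpair d F G \<Longrightarrow> G \<notin> I"
  by (auto simp: fracpair_def forms_polynomial)

lemma frac_mem:
  assumes "fracpair d F G"
  shows "z \<in> rational F G \<longleftrightarrow> (\<exists>F' G' e. fracpair e F' G' \<and> z = (\<pi> F', \<pi> G') \<and> F * G' - F' * G \<in> I)"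
proof -
  note FG = fracpairD(3,4)[OF assms]
  have nz: "\<pi> G' \<noteq> \<zero> \<longleftrightarrow> G' \<notin> I" if "G' \<in> forms N e" for G' e
    using pi_eq_zero forms_polynomial[OF that] by simp
  have cong: "\<pi> F \<otimes> \<pi> G' = \<pi> F' \<otimes> \<pi> G \<longleftrightarrow> F * G' - F' * G \<in> I" if "F' \<in> forms N e" "G' \<in> forms N e" for F' G' e
    using that[THEN forms_polynomial] FG pi_eq[of "F * G'" "F' * G"] by (simp add: pi_mult)
  show ?thesis
    unfolding rational_def fraction_def grade fracpair_def using nz cong by auto blast+
qed

lemma frac_self: "fracpair d F G \<Longrightarrow> (\<pi> F, \<pi> G) \<in> rational F G"
  unfolding frac_mem
  by (intro exI[of _ F] exI[of _ G] exI[of _ d]) (simp add: hidealD(2)[OF I])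

lemma I_combine:
  assumes "X \<in> I" "Y \<in> I" "a \<in> R" "b \<in> R"
  shows "a * X + b * Y \<in> I" "a * X - b * Y \<in> I"
  using hidealD(5)[OF I assms(1,3)] hidealD(5)[OF I assms(2,4)] hidealD(3)[OF I] hideal_minus[OF I] by auto

lemma frac_eq_iff:
  assumes FG: "fracpair d F G" and FG': "fracpair e F' G'"
  shows "rational F G = rational F' G' \<longleftrightarrow> F * G' - F' * G \<in> I"
proof
  assume "rational F G = rational F' G'"
  then have "(\<pi> F', \<pi> G') \<in> rational F G" using frac_self[OF FG'] by simp
  then obtain F2 G2 f where *: "fracpair f F2 G2" "\<pi> F' = \<pi> F2" "\<pi> G' = \<pi> G2" "F * G2 - F2 * G \<in> I"
    using frac_mem[OF FG] by auto
  have "F' - F2 \<in> I" "G' - G2 \<in> I"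
    using * pi_eq fracpairD(3,4)[OF *(1)] fracpairD(3,4)[OF FG'] by auto
  then have "F * (G' - G2) \<in> I" "(F' - F2) * G \<in> I"
    using fracpairD(3,4)[OF FG] by (auto intro: hidealD(4,5)[OF I])
  then have "(F * G2 - F2 * G) + F * (G' - G2) - (F' - F2) * G \<in> I"
    using hideal_minus[OF I hidealD(3)[OF I *(4)]] by blast
  then show "F * G' - F' * G \<in> I" by (simp add: algebra_simps)
next
  have sub: "rational F G \<subseteq> rational F' G'"
    if FG: "fracpair d F G" and FG': "fracpair e F' G'" and eq: "F * G' - F' * G \<in> I" for F G d F' G' e
  proof
    fix z assume "z \<in> rational F G"
    then obtain a b f where ab: "fracpair f a b" "z = (\<pi> a, \<pi> b)" "F * b - a * G \<in> I"
      using frac_mem[OF FG] by auto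
    have mem: "G' * (F * b - a * G) - b * (F * G' - F' * G) \<in> I"
      using fracpairD(3,4)[OF ab(1)] fracpairD(3,4)[OF FG']
      by (intro I_combine ab(3) eq) auto
    \<comment> \<open>transitivity of equality of fractions; the denominator \<open>G\<close> is then cancelled\<close>
    have "G * (F' * b - a * G') = G' * (F * b - a * G) - b * (F * G' - F' * G)"
      by (simp add: algebra_simps)
    then have "G * (F' * b - a * G') \<in> I" using mem by simp
    then have "F' * b - a * G' \<in> I"
      using hprimeD(3)[OF prime, of G "F' * b - a * G'"] fracpairD[OF FG] fracpairD[OF FG'] fracpairD[OF ab(1)]
      by auto
    then show "z \<in> rational F' G'" using frac_mem[OF FG'] ab by blast
  qed
  assume eq: "F * G' - F' * G \<in> I"
  have "0 - (F * G' - F' * G) \<in> I" using hideal_minus[OF I hidealD(2)[OF I] eq] .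
  then have "F' * G - F * G' \<in> I" by simp
  then show "rational F G = rational F' G'" using sub[OF FG FG' eq] sub[OF FG' FG] by blast
qed

lemma fracpair_mult: "fracpair d F G \<Longrightarrow> fracpair e F' G' \<Longrightarrow> fracpair (d + e) (F * F') (G * G')"
  using hprime_mult_iff[OF prime, of G G'] forms_mult[of F N d F' e] forms_mult[of G N d G' e]
    fracpairD[of d F G] fracpairD[of e F' G'] unfolding fracpair_def by blast

lemma fracpair_add:
  assumes "fracpair d F G" "fracpair e F' G'"
  shows "fracpair (d + e) (F * G' + F' * G) (G * G')"
proof -
  have "F * G' \<in> forms N (d + e)" "F' * G \<in> forms N (e + d)"
    using fracpairD(1,2)[OF assms(1)] fracpairD(1,2)[OF assms(2)] by (auto intro: forms_mult)
  then have "F * G' + F' * G \<in> forms N (d + e)" using forms_closed(2) by (simp add: add.commute)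
  then show ?thesis using fracpair_mult[OF assms] unfolding fracpair_def by blast
qed

lemma pi_form_zero: "G \<in> forms N d \<Longrightarrow> \<pi> G = \<zero> \<longleftrightarrow> G \<in> I"
  by (rule pi_eq_zero[OF forms_polynomial])

lemma carrier_function_field:
  "carrier (function_field A) = {rational F G | F G d. fracpair d F G}"
proof -
  have "carrier (function_field A) = {fraction A a f | a f d. a \<in> grade A d \<and> f \<in> grade A d \<and> f \<noteq> \<zero>}"
    by (simp add: function_field_def)
  also have "\<dots> = {rational F G | F G d. fracpair d F G}"
  proof (rule subset_antisym; rule subsetI)
    fix x assume "x \<in> {fraction A a f | a f d. a \<in> grade A d \<and> f \<in> grade A d \<and> f \<noteq> \<zero>}"
    then obtain F G d where *: "F \<in> forms N d" "G \<in> forms N d" "\<pi> G \<noteq> \<zero>" "x = fraction A (\<pi> F) (\<pi> G)"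
      unfolding grade by blast
    then have "fracpair d F G" using pi_form_zero[OF *(2)] by (simp add: fracpair_def)
    then show "x \<in> {rational F G | F G d. fracpair d F G}" using *(4) rational_def by blast
  next
    fix x assume "x \<in> {rational F G | F G d. fracpair d F G}"
    then obtain F G d where *: "fracpair d F G" "x = fraction A (\<pi> F) (\<pi> G)" unfolding rational_def by blast
    then have "\<pi> F \<in> grade A d" "\<pi> G \<in> grade A d" "\<pi> G \<noteq> \<zero>"
      using pi_form_zero fracpairD(1,2,5)[OF *(1)] by (auto simp: grade)
    then show "x \<in> {fraction A a f | a f d. a \<in> grade A d \<and> f \<in> grade A d \<and> f \<noteq> \<zero>}" using *(2) by blast
  qed
  finally show ?thesis .
qed

text \<open>The operations of the function field are unions over all representatives. If the members of
  such a union do not depend on the representatives, the union collapses to their common value.\<close>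

lemma frac_union:
  assumes FG: "fracpair d F G" and FG': "fracpair e F' G'"
    and h: "\<And>a b a' b' i j. fracpair i a b \<Longrightarrow> fracpair j a' b' \<Longrightarrow> F * b - a * G \<in> I \<Longrightarrow>
       F' * b' - a' * G' \<in> I \<Longrightarrow> h (\<pi> a) (\<pi> b) (\<pi> a') (\<pi> b') = S"
  shows "(\<Union>(a, f)\<in>rational F G. \<Union>(b, g)\<in>rational F' G'. h a f b g) = S"
proof (rule subset_antisym; rule subsetI)
  fix x assume "x \<in> (\<Union>(a, f)\<in>rational F G. \<Union>(b, g)\<in>rational F' G'. h a f b g)"
  then obtain a f b g where *: "(a, f) \<in> rational F G" "(b, g) \<in> rational F' G'" "x \<in> h a f b g" by blast
  then show "x \<in> S" using h frac_mem[OF FG] frac_mem[OF FG'] by auto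
next
  fix x assume "x \<in> S"
  moreover have "F * G - F * G \<in> I" "F' * G' - F' * G' \<in> I" using hidealD(2)[OF I] by auto
  then have "h (\<pi> F) (\<pi> G) (\<pi> F') (\<pi> G') = S" using h[OF FG FG'] by blast
  ultimately show "x \<in> (\<Union>(a, f)\<in>rational F G. \<Union>(b, g)\<in>rational F' G'. h a f b g)"
    using frac_self[OF FG] frac_self[OF FG'] by blast
qed

lemma function_field_mult:
  assumes FG: "fracpair d F G" and FG': "fracpair e F' G'"
  shows "rational F G \<otimes>\<^bsub>function_field A\<^esub> rational F' G' = rational (F * F') (G * G')"
proof -
  have "fraction A (\<pi> a \<otimes> \<pi> a') (\<pi> b \<otimes> \<pi> b') = rational (F * F') (G * G')"
    if ab: "fracpair i a b" "fracpair j a' b'" and eq: "F * b - a * G \<in> I" "F' * b' - a' * G' \<in> I"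
    for a b a' b' i j
  proof -
    have "(F' * b') * (F * b - a * G) + (a * G) * (F' * b' - a' * G') \<in> I"
      using fracpairD(3,4)[OF ab(1)] fracpairD(3,4)[OF ab(2)] fracpairD(3,4)[OF FG] fracpairD(3,4)[OF FG']
      by (intro I_combine eq) auto
    then have "F * F' * (b * b') - a * a' * (G * G') \<in> I" by (simp add: algebra_simps)
    then have "rational (F * F') (G * G') = rational (a * a') (b * b')"
      using frac_eq_iff[OF fracpair_mult[OF FG FG'] fracpair_mult[OF ab]] by simp
    then show ?thesis using fracpairD(3,4)[OF ab(1)] fracpairD(3,4)[OF ab(2)]
      by (simp add: pi_mult rational_def)
  qed
  from frac_union[OF FG FG', of "\<lambda>a f b g. fraction A (a \<otimes> b) (f \<otimes> g)", OF this]
  show ?thesis by (simp add: function_field_def)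
qed

lemma function_field_add:
  assumes FG: "fracpair d F G" and FG': "fracpair e F' G'"
  shows "rational F G \<oplus>\<^bsub>function_field A\<^esub> rational F' G' = rational (F * G' + F' * G) (G * G')"
proof -
  have "fraction A (\<pi> a \<otimes> \<pi> b' \<oplus> \<pi> a' \<otimes> \<pi> b) (\<pi> b \<otimes> \<pi> b') = rational (F * G' + F' * G) (G * G')"
    if ab: "fracpair i a b" "fracpair j a' b'" and eq: "F * b - a * G \<in> I" "F' * b' - a' * G' \<in> I"
    for a b a' b' i j
  proof -
    have "(G' * b') * (F * b - a * G) + (G * b) * (F' * b' - a' * G') \<in> I"
      using fracpairD(3,4)[OF ab(1)] fracpairD(3,4)[OF ab(2)] fracpairD(3,4)[OF FG] fracpairD(3,4)[OF FG']
      by (intro I_combine eq) auto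
    then have "(F * G' + F' * G) * (b * b') - (a * b' + a' * b) * (G * G') \<in> I" by (simp add: algebra_simps)
    then have "rational (F * G' + F' * G) (G * G') = rational (a * b' + a' * b) (b * b')"
      using frac_eq_iff[OF fracpair_add[OF FG FG'] fracpair_add[OF ab]] by simp
    then show ?thesis using fracpairD(3,4)[OF ab(1)] fracpairD(3,4)[OF ab(2)]
      by (simp add: pi_mult pi_add rational_def)
  qed
  from frac_union[OF FG FG', of "\<lambda>a f b g. fraction A (a \<otimes> g \<oplus> b \<otimes> f) (f \<otimes> g)", OF this]
  show ?thesis by (simp add: function_field_def)
qed

lemma function_field_one: "\<one>\<^bsub>function_field A\<^esub> = rational 1 1"
  by (simp add: function_field_def rational_def pi_one)

lemma constant_fraction: "fraction A (scalar A c) \<one> = rational (Const c) 1"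
  by (simp add: rational_def pi_one scalar)

lemma fracpair_Const: "fracpair 0 (Const c) 1"
  by (simp add: fracpair_def forms_Const forms_one hprimeD(2)[OF prime])

lemma local_ring_eq:
  assumes P: "point P"
  shows "local_ring A (\<pi> ` P) = {rational F G | F G d. fracpair d F G \<and> G \<notin> P}"
proof (rule subset_antisym; rule subsetI)
  fix x assume "x \<in> local_ring A (\<pi> ` P)"
  then obtain F G d where *: "F \<in> forms N d" "G \<in> forms N d" "\<pi> G \<notin> \<pi> ` P" "x = fraction A (\<pi> F) (\<pi> G)"
    unfolding local_ring_def grade by blast
  have "G \<notin> P" using *(3) by blast
  then have "fracpair d F G" using * pointD(3)[OF P] by (auto simp: fracpair_def)
  then show "x \<in> {rational F G | F G d. fracpair d F G \<and> G \<notin> P}" using *(4) \<open>G \<notin> P\<close> rational_def by blast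
next
  fix x assume "x \<in> {rational F G | F G d. fracpair d F G \<and> G \<notin> P}"
  then obtain F G d where *: "fracpair d F G" "G \<notin> P" "x = fraction A (\<pi> F) (\<pi> G)" unfolding rational_def by blast
  then have "\<pi> F \<in> grade A d" "\<pi> G \<in> grade A d" "\<pi> G \<notin> \<pi> ` P"
    using point_mem[OF P fracpairD(4)[OF *(1)]] fracpairD(1,2)[OF *(1)] by (auto simp: grade)
  then show "x \<in> local_ring A (\<pi> ` P)" unfolding local_ring_def using *(3) by blast
qed

lemma point_I: "relevant N I \<Longrightarrow> point I"
  using prime by (simp add: point_def)

end

section \<open>Homogeneous coordinate rings\<close>

lemma polynomial_algebra_simps [simp]:
  "carrier (polynomial_algebra N) = polynomials_in N"
  "mult (polynomial_algebra N) = (*)" "one (polynomial_algebra N) = 1"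
  "zero (polynomial_algebra N) = 0" "add (polynomial_algebra N) = (+)"
  "scalar (polynomial_algebra N) = Const"
  by (simp_all add: polynomial_algebra_def)

lemma presented_polynomial_algebra:
  "presented_algebra (polynomial_algebra N) (\<lambda>F. F) N {0 :: 'k::field mpoly}"
  by unfold_locales (auto simp: hprimeD(1)[OF hprime_zero] grade_polynomial_algebra)

lemma polynomial_algebra_domain: "domain (polynomial_algebra N :: ('k::field mpoly, 'k) graded_algebra)"
proof -
  interpret presented_algebra "polynomial_algebra N" "\<lambda>F. F" N "{0 :: 'k mpoly}"
    by (rule presented_polynomial_algebra)
  show ?thesis by unfold_locales auto
qed

text \<open>This is the correspondence of homogeneous primes for the identity presentation of the
  polynomial ring.\<close>

lemma projective_variety_iff:
  "projective_variety Y \<longleftrightarrow> hprime (ambient Y) (vanishing_ideal Y) \<and> relevant (ambient Y) (vanishing_ideal Y)"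
  for Y :: "'k::field projective_scheme"
proof -
  interpret presented_algebra "polynomial_algebra (ambient Y)" "\<lambda>F. F" "ambient Y" "{0 :: 'k mpoly}"
    by (rule presented_polynomial_algebra)
  have "primeideal p (polynomial_algebra (ambient Y)) \<and> homogeneous_ideal p (polynomial_algebra (ambient Y))
     \<longleftrightarrow> hprime (ambient Y) p" for p :: "'k mpoly set"
    using homogeneous_prime_iff[of p] hidealD(2)[OF hprimeD(1)] by auto
  moreover have "contains_irrelevant p (polynomial_algebra (ambient Y)) \<longleftrightarrow> \<not> relevant (ambient Y) p"
    if "hprime (ambient Y) p" for p :: "'k mpoly set"
    using contains_irrelevant_iff[OF hprimeD(1)[OF that]] hidealD(2)[OF hprimeD(1)[OF that]] by simp
  ultimately show ?thesis unfolding projective_variety_def Let_def by blast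
qed

text \<open>The quotient map from the polynomial ring to the coordinate ring, whose elements are cosets.\<close>

definition residue :: "'k::field projective_scheme \<Rightarrow> 'k mpoly \<Rightarrow> 'k mpoly set" where
  "residue Y F = vanishing_ideal Y +>\<^bsub>polynomial_algebra (ambient Y)\<^esub> F"

lemma residue_eq: "residue Y F = (\<lambda>h. h + F) ` vanishing_ideal Y"
  by (auto simp: residue_def a_r_coset_def')

lemma residue_eq_iff:
  assumes I: "hideal N (vanishing_ideal Y)"
  shows "residue Y F = residue Y G \<longleftrightarrow> F - G \<in> vanishing_ideal Y"
proof
  assume "residue Y F = residue Y G"
  moreover have "F \<in> residue Y F" unfolding residue_eq
    using hidealD(2)[OF I] by (intro image_eqI[of _ _ 0]) auto
  ultimately show "F - G \<in> vanishing_ideal Y" by (auto simp: residue_eq)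
next
  have sub: "residue Y F \<subseteq> residue Y G" if "F - G \<in> vanishing_ideal Y" for F G
  proof
    fix x assume "x \<in> residue Y F"
    then obtain h where "h \<in> vanishing_ideal Y" "x = (h + (F - G)) + G" by (auto simp: residue_eq)
    then show "x \<in> residue Y G" unfolding residue_eq using hidealD(3)[OF I _ that] by blast
  qed
  assume FG: "F - G \<in> vanishing_ideal Y"
  then have "G - F \<in> vanishing_ideal Y" using hideal_minus[OF I hidealD(2)[OF I] FG] by simp
  then show "residue Y F = residue Y G" using sub FG by blast
qed

lemma presented_coordinate_ring:
  fixes Y :: "'k::field projective_scheme"
  assumes I: "hideal (ambient Y) (vanishing_ideal Y)"
  shows "presented_algebra (coordinate_ring Y) (residue Y) (ambient Y) (vanishing_ideal Y)"
proof
  let ?N = "ambient Y" and ?I = "vanishing_ideal Y" and ?A = "coordinate_ring Y"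
  note A = coordinate_ring_def quotient_algebra_def FactRing_def
  show "hideal ?N ?I" by (rule I)
  show "carrier ?A = residue Y ` polynomials_in ?N"
    by (auto simp: A A_RCOSETS_def' residue_def)
  show "\<one>\<^bsub>?A\<^esub> = residue Y 1" by (simp add: A residue_def)
  show "\<zero>\<^bsub>?A\<^esub> = residue Y 0" by (simp add: A residue_eq)
  show "scalar ?A c = residue Y (Const c)" for c by (simp add: A residue_def)
  show "grade ?A d = residue Y ` forms ?N d" for d
    by (auto simp: A residue_def grade_polynomial_algebra)
  show "residue Y F = residue Y G \<longleftrightarrow> F - G \<in> ?I" for F G
    by (rule residue_eq_iff[OF I])
  fix F G :: "'k mpoly" assume F: "F \<in> polynomials_in ?N" and G: "G \<in> polynomials_in ?N"
  have "residue Y F \<oplus>\<^bsub>?A\<^esub> residue Y G = (\<Union>h\<in>residue Y F. \<Union>k\<in>residue Y G. {h + k})"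
    by (simp add: A set_add_def')
  also have "\<dots> = residue Y (F + G)"
  proof (rule subset_antisym; rule subsetI)
    fix x assume "x \<in> (\<Union>h\<in>residue Y F. \<Union>k\<in>residue Y G. {h + k})"
    then obtain h k where "h \<in> ?I" "k \<in> ?I" "x = (h + k) + (F + G)"
      by (auto simp: residue_eq algebra_simps)
    then show "x \<in> residue Y (F + G)" unfolding residue_eq using hidealD(3)[OF I] by blast
  next
    fix x assume "x \<in> residue Y (F + G)"
    then obtain h where h: "h \<in> ?I" "x = (h + F) + (0 + G)" by (auto simp: residue_eq algebra_simps)
    then show "x \<in> (\<Union>h\<in>residue Y F. \<Union>k\<in>residue Y G. {h + k})"
      unfolding residue_eq using hidealD(2)[OF I] by blast
  qed
  finally show "residue Y F \<oplus>\<^bsub>?A\<^esub> residue Y G = residue Y (F + G)" .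
  have "residue Y F \<otimes>\<^bsub>?A\<^esub> residue Y G = (\<Union>a\<in>residue Y F. \<Union>b\<in>residue Y G. residue Y (a * b))"
    by (simp add: A rcoset_mult_def residue_def)
  also have "\<dots> = residue Y (F * G)"
  proof -
    have "residue Y (a * b) = residue Y (F * G)" if "a \<in> residue Y F" "b \<in> residue Y G" for a b
    proof -
      obtain h k where hk: "h \<in> ?I" "k \<in> ?I" "a = h + F" "b = k + G" using \<open>a \<in> residue Y F\<close> \<open>b \<in> residue Y G\<close> by (auto simp: residue_eq)
      have "h * (k + G) \<in> ?I" "F * k \<in> ?I"
        using hk F G hidealD(1)[OF I] by (auto intro: hidealD(4,5)[OF I])
      then have "h * (k + G) + F * k \<in> ?I" by (rule hidealD(3)[OF I])
      moreover have "a * b - F * G = h * (k + G) + F * k" by (simp add: hk algebra_simps)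
      ultimately show ?thesis using residue_eq_iff[OF I] by metis
    qed
    moreover have "F \<in> residue Y F" "G \<in> residue Y G"
      unfolding residue_eq using hidealD(2)[OF I] by (auto intro: image_eqI[of _ _ 0])
    ultimately show ?thesis by blast
  qed
  finally show "residue Y F \<otimes>\<^bsub>?A\<^esub> residue Y G = residue Y (F * G)" .
qed

lemma presented_domain_coordinate_ring:
  assumes "hprime (ambient Y) (vanishing_ideal Y)"
  shows "presented_domain (coordinate_ring Y) (residue Y) (ambient Y) (vanishing_ideal Y)"
  using presented_coordinate_ring[OF hprimeD(1)[OF assms]] assms
  by (simp add: presented_domain_def presented_domain_axioms_def)

section \<open>Isomorphic charts\<close>

lemma hideal_eq_on_forms:
  assumes "hideal N P" "hideal N Q" "\<And>d F. F \<in> forms N d \<Longrightarrow> F \<in> P \<longleftrightarrow> F \<in> Q"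
  shows "P = Q"
proof -
  have "F \<in> P \<longleftrightarrow> F \<in> Q" if F: "F \<in> polynomials_in N" for F
    using hideal_comps[OF assms(1), of F] hideal_comps[OF assms(2), of F] assms(3)[OF comp_forms[OF F]]
    by blast
  then show ?thesis using hidealD(1)[OF assms(1)] hidealD(1)[OF assms(2)] by blast
qed

text \<open>A homomorphism of algebras over the ground field, from polynomials in the variables up to \<open>M\<close>
  to polynomials in the variables up to \<open>N\<close>, that multiplies degrees by \<open>r\<close>.\<close>

locale graded_substitution =
  fixes \<alpha> :: "'k::field mpoly \<Rightarrow> 'k mpoly" and M N r :: nat
  assumes hom_add: "\<alpha> (F + G) = \<alpha> F + \<alpha> G" and hom_mult: "\<alpha> (F * G) = \<alpha> F * \<alpha> G"
    and hom_Const: "\<alpha> (Const c) = Const c"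
    and hom_forms: "F \<in> forms M d \<Longrightarrow> \<alpha> F \<in> forms N (r * d)"
    and hom_comp: "F \<in> polynomials_in M \<Longrightarrow> component (r * d) (\<alpha> F) = \<alpha> (component d F)"
    and hom_polynomials: "F \<in> polynomials_in M \<Longrightarrow> \<alpha> F \<in> polynomials_in N"
begin

lemma hom_zero: "\<alpha> 0 = 0" and hom_one: "\<alpha> 1 = 1"
  using hom_Const[of 0] hom_Const[of 1] by (simp_all add: Const_simps)

lemma hom_minus: "\<alpha> (F - G) = \<alpha> F - \<alpha> G"
  using hom_add[of "F - G" G] by (simp add: algebra_simps)

definition pullback :: "'k mpoly set \<Rightarrow> 'k mpoly set" where
  "pullback P = {F \<in> polynomials_in M. \<alpha> F \<in> P}"

lemma pullback_mem: "F \<in> polynomials_in M \<Longrightarrow> F \<in> pullback P \<longleftrightarrow> \<alpha> F \<in> P"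
  by (simp add: pullback_def)

lemma hideal_pullback:
  assumes P: "hideal N P"
  shows "hideal M (pullback P)"
  unfolding hideal_def
proof (intro conjI ballI allI)
  fix F d assume F: "F \<in> pullback P"
  then have "component (r * d) (\<alpha> F) \<in> P" using hidealD(6)[OF P] by (simp add: pullback_def)
  then show "component d F \<in> pullback P" using F hom_comp by (auto simp: pullback_def)
qed (use hidealD(2-4)[OF P] hom_polynomials in \<open>auto simp: pullback_def hom_zero hom_add hom_mult\<close>)

lemma hprime_pullback:
  assumes P: "hprime N P"
  shows "hprime M (pullback P)"
  unfolding hprime_def
proof (intro conjI ballI impI hideal_pullback hprimeD(1)[OF P])
  show "1 \<notin> pullback P" using hprimeD(2)[OF P] by (simp add: pullback_def hom_one)
  fix F G assume "F \<in> polynomials_in M" "G \<in> polynomials_in M" "F * G \<in> pullback P"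
  then show "F \<in> pullback P \<or> G \<in> pullback P"
    using hprimeD(3)[OF P, of "\<alpha> F" "\<alpha> G"] hom_polynomials by (auto simp: pullback_def hom_mult)
qed

end

lemma graded_substitution_substitute:
  assumes "\<And>i. i \<le> M \<Longrightarrow> \<sigma> i \<in> forms N r" "r > 0"
  shows "graded_substitution (substitute \<sigma>) M N r"
proof
  show "substitute \<sigma> F \<in> polynomials_in N" if "F \<in> polynomials_in M" for F
    by (rule substitute_in_polynomials[OF that]) (rule forms_polynomial[OF assms(1)])
qed (use assms in \<open>auto simp: substitute_add substitute_mult intro: substitute_forms comp_substitute\<close>)

text \<open>Two graded domains with homomorphisms in both directions whose composites multiply forms of
  degree \<open>d\<close> by \<open>v ^ d\<close> and \<open>u ^ d\<close>. The homomorphisms become mutually inverse, up to powers of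
  \<open>u\<close> and \<open>v\<close>, on the charts where these do not vanish. In the application one of them preserves
  degrees and the other doubles them.\<close>

locale chart_pair =
  A: presented_domain A \<pi> N I + B: presented_domain B \<rho> M J +
  a: graded_substitution \<alpha> M N r + b: graded_substitution \<beta> N M s
  for A :: "('a, 'k::field) graded_algebra" and \<pi> N I
    and B :: "('b, 'k) graded_algebra" and \<rho> M J
    and \<alpha> \<beta> :: "'k mpoly \<Rightarrow> 'k mpoly" and r s +
  fixes u v :: "'k mpoly" and i j :: nat
  assumes u: "u \<in> forms N 1" "u \<notin> I" and v: "v \<in> forms M 1" "v \<notin> J"
    and alpha_v: "\<alpha> v = u ^ i" and beta_u: "\<beta> u = v ^ j"
    and alpha_J: "F \<in> J \<Longrightarrow> \<alpha> F \<in> I" and beta_I: "F \<in> I \<Longrightarrow> \<beta> F \<in> J"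
    and beta_alpha: "F \<in> forms M d \<Longrightarrow> \<beta> (\<alpha> F) - v ^ d * F \<in> J"
    and alpha_beta: "F \<in> forms N d \<Longrightarrow> \<alpha> (\<beta> F) - u ^ d * F \<in> I"
begin

text \<open>The hypotheses are symmetric in the two algebras, so that what is proved for \<open>A\<close> below also
  holds for \<open>B\<close>, through the interpretation \<open>swap\<close>.\<close>

lemma swapped: "chart_pair B \<rho> M J A \<pi> N I \<beta> \<alpha> s r v u j i"
  using u v alpha_v beta_u alpha_J beta_I beta_alpha alpha_beta by unfold_locales

lemma uR: "u \<in> polynomials_in N" and vR: "v \<in> polynomials_in M"
  using u v forms_polynomial by auto

text \<open>Modulo \<open>P\<close>, the composite multiplies \<open>F\<close> by a power of \<open>u\<close>, which is a unit as far as
  membership in the prime \<open>P\<close> is concerned.\<close>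

lemma alpha_beta_mem:
  assumes P: "hprime N P" "I \<subseteq> P" "u \<notin> P" and F: "F \<in> forms N d"
  shows "\<alpha> (\<beta> F) \<in> P \<longleftrightarrow> F \<in> P"
proof -
  have hP: "hideal N P" using P hprimeD by blast
  have FR: "F \<in> polynomials_in N" using F forms_polynomial by auto
  have ab: "\<alpha> (\<beta> F) - u ^ d * F \<in> P" using alpha_beta[OF F] P(2) by blast
  have "\<alpha> (\<beta> F) \<in> P \<longleftrightarrow> u ^ d * F \<in> P"
    using hidealD(3)[OF hP ab, of "u ^ d * F"] hideal_minus[OF hP _ ab, of "\<alpha> (\<beta> F)"] by auto
  also have "\<dots> \<longleftrightarrow> F \<in> P"
    using hprime_mult_iff[OF P(1), of "u ^ d" F] hprime_power[OF P(1) uR, of d] P(3) uR FR by auto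
  finally show ?thesis .
qed

lemma beta_mem_J: "F \<in> forms N d \<Longrightarrow> \<beta> F \<in> J \<longleftrightarrow> F \<in> I"
  using alpha_J beta_I alpha_beta_mem[OF A.prime order_refl u(2)] by blast

lemma pullback_alpha:
  assumes P: "A.point P" "u \<notin> P"
  shows "B.point (a.pullback P)" "v \<notin> a.pullback P"
proof -
  have h: "hprime M (a.pullback P)" using P A.pointD a.hprime_pullback by blast
  show nv: "v \<notin> a.pullback P"
    using P(2) a.pullback_mem[OF vR] alpha_v hprime_power[OF A.pointD(1)[OF P(1)] uR, of i] by auto
  have "relevant M (a.pullback P)"
    using irrelevant_forms[OF hprimeD(1)[OF h] _ v(1)] nv by auto
  moreover have "J \<subseteq> a.pullback P"
    using A.pointD(3)[OF P(1)] alpha_J hidealD(1)[OF B.I] unfolding a.pullback_def by blast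
  ultimately show "B.point (a.pullback P)" using h by (simp add: B.point_def)
qed

lemma pullback_beta_alpha:
  assumes P: "A.point P" "u \<notin> P"
  shows "b.pullback (a.pullback P) = P"
proof (rule hideal_eq_on_forms)
  show "hideal N (b.pullback (a.pullback P))" "hideal N P"
    using A.pointD(2)[OF P(1)] by (auto intro: b.hideal_pullback a.hideal_pullback)
  fix d and F :: "'k mpoly" assume F: "F \<in> forms N d"
  then have "F \<in> polynomials_in N" "\<beta> F \<in> polynomials_in M" using forms_polynomial b.hom_polynomials by auto
  then show "F \<in> b.pullback (a.pullback P) \<longleftrightarrow> F \<in> P"
    using alpha_beta_mem[OF A.pointD(1,3)[OF P(1)] P(2) F] by (simp add: a.pullback_mem b.pullback_mem)
qed

abbreviation UA where "UA \<equiv> A.basic_open {u}"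
abbreviation UB where "UB \<equiv> B.basic_open {v}"

lemma UA_iff: "p \<in> UA \<longleftrightarrow> (\<exists>P. A.point P \<and> u \<notin> P \<and> p = \<pi> ` P)"
  using A.point_mem[OF _ uR] by (auto simp: A.basic_open_def A.Proj_points_eq)

lemma open_UA: "openin (Proj A) UA"
  unfolding A.openin_Proj_iff using u(1) by (intro exI[of _ "{u}"]) auto

lemma topspace_UA: "topspace (subtopology (Proj A) UA) = UA"
  using openin_subset[OF open_UA] by (auto simp: topspace_subtopology)

lemma UA_nonempty: "UA \<noteq> {}"
proof -
  have "relevant N I" using irrelevant_forms[OF A.I _ u(1)] u(2) by auto
  then show ?thesis using UA_iff A.point_I u(2) by blast
qed

definition to_B :: "'a set \<Rightarrow> 'b set" where
  "to_B p = \<rho> ` a.pullback (A.ideal_preimage p)"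

lemma to_B_image: "A.point P \<Longrightarrow> to_B (\<pi> ` P) = \<rho> ` a.pullback P"
  by (simp add: to_B_def A.preimage_image A.pointD)

end

context chart_pair
begin

interpretation swap: chart_pair B \<rho> M J A \<pi> N I \<beta> \<alpha> s r v u j i
  by (rule swapped)

lemma to_B_UA:
  assumes "p \<in> UA"
  shows "to_B p \<in> UB" "swap.to_B (to_B p) = p"
proof -
  obtain P where P: "A.point P" "u \<notin> P" "p = \<pi> ` P" using assms UA_iff by blast
  note Q = pullback_alpha[OF P(1,2)]
  show "to_B p \<in> UB" unfolding swap.UA_iff P(3) to_B_image[OF P(1)] using Q by blast
  show "swap.to_B (to_B p) = p"
    unfolding P(3) to_B_image[OF P(1)] swap.to_B_image[OF Q(1)] pullback_beta_alpha[OF P(1,2)] ..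
qed

text \<open>The preimage of the set where \<open>F\<close> does not vanish is the set where \<open>\<alpha> F\<close> does not
  vanish.\<close>

lemma to_B_continuous: "continuous_map (subtopology (Proj A) UA) (subtopology (Proj B) UB) to_B"
  unfolding continuous_map_def topspace_UA swap.topspace_UA
proof (intro conjI allI impI)
  show "to_B \<in> UA \<rightarrow> UB" using to_B_UA by blast
  fix V assume "openin (subtopology (Proj B) UB) V"
  then obtain E where E: "E \<subseteq> (\<Union>d. forms M d)" "V = B.basic_open E \<inter> UB"
    unfolding openin_subtopology B.openin_Proj_iff by blast
  have "to_B p \<in> V \<longleftrightarrow> p \<in> A.basic_open (\<alpha> ` E)" if p: "p \<in> UA" for p
  proof -
    obtain P where P: "A.point P" "u \<notin> P" "p = \<pi> ` P" using p UA_iff by blast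
    note Q = pullback_alpha[OF P(1,2)]
    have ER: "F \<in> polynomials_in M" "\<alpha> F \<in> polynomials_in N" if "F \<in> E" for F
      using E(1) that forms_polynomial a.hom_polynomials by blast+
    have "\<rho> F \<in> to_B p \<longleftrightarrow> \<pi> (\<alpha> F) \<in> p" if "F \<in> E" for F
      using ER[OF that] unfolding P(3) to_B_image[OF P(1)]
      by (simp add: B.point_mem[OF Q(1)] A.point_mem[OF P(1)] a.pullback_mem)
    moreover have "to_B p \<in> B.basic_open E \<longleftrightarrow> (\<exists>F\<in>E. \<rho> F \<notin> to_B p)"
      using to_B_UA(1)[OF p] by (simp add: B.basic_open_def)
    moreover have "p \<in> A.basic_open (\<alpha> ` E) \<longleftrightarrow> (\<exists>F\<in>E. \<pi> (\<alpha> F) \<notin> p)"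
      using p by (simp add: A.basic_open_def)
    ultimately show ?thesis using to_B_UA(1)[OF p] E(2) by auto
  qed
  then have "{p \<in> UA. to_B p \<in> V} = A.basic_open (\<alpha> ` E) \<inter> UA" by blast
  moreover have "\<alpha> ` E \<subseteq> (\<Union>d. forms N d)" using E(1) a.hom_forms by blast
  ultimately show "openin (subtopology (Proj A) UA) {p \<in> UA. to_B p \<in> V}"
    unfolding openin_subtopology A.openin_Proj_iff by blast
qed

end

context chart_pair
begin

interpretation swap: chart_pair B \<rho> M J A \<pi> N I \<beta> \<alpha> s r v u j i
  by (rule swapped)

text \<open>The inverse is the map in the other direction, which is the same construction with the roles
  of the two algebras exchanged; \<open>swap\<close> is interpreted anew to cover what has been proved about
  it.\<close>

lemma charts_homeomorphic:
  "homeomorphic_map (subtopology (Proj A) UA) (subtopology (Proj B) UB) to_B"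
proof (rule homeomorphic_maps_imp_map)
  show "homeomorphic_maps (subtopology (Proj A) UA) (subtopology (Proj B) UB) to_B swap.to_B"
    unfolding homeomorphic_maps_def topspace_UA swap.topspace_UA
    using to_B_continuous swap.to_B_continuous to_B_UA(2) swap.to_B_UA(2) by blast
qed

lemmas UB_open_nonempty = swap.open_UA swap.UA_nonempty

section \<open>The function fields of the two charts\<close>

text \<open>Substitution of \<open>\<alpha>\<close> in numerator and denominator. A representative has to be chosen
  since a fraction is the set of all its representatives; by \<open>pull_rational\<close> the choice is
  immaterial.\<close>

definition pull :: "('b \<times> 'b) set \<Rightarrow> ('a \<times> 'a) set" where
  "pull x = (case SOME (F, G). \<exists>d. B.fracpair d F G \<and> x = B.rational F G of (F, G) \<Rightarrow> A.rational (\<alpha> F) (\<alpha> G))"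

lemma fracpair_beta: "A.fracpair d F G \<Longrightarrow> B.fracpair (s * d) (\<beta> F) (\<beta> G)"
  using b.hom_forms[of F d] b.hom_forms[of G d] beta_mem_J[of G d]
  by (auto simp: A.fracpair_def B.fracpair_def)

lemma fracpair_alpha: "B.fracpair d F G \<Longrightarrow> A.fracpair (r * d) (\<alpha> F) (\<alpha> G)"
  using a.hom_forms[of F d] a.hom_forms[of G d] swap.beta_mem_J[of G d]
  by (auto simp: A.fracpair_def B.fracpair_def)

lemma rational_alpha_eq_iff:
  assumes "B.fracpair d F G" "B.fracpair e F' G'"
  shows "A.rational (\<alpha> F) (\<alpha> G) = A.rational (\<alpha> F') (\<alpha> G') \<longleftrightarrow> B.rational F G = B.rational F' G'"
proof -
  have "F * G' \<in> forms M (d + e)" "F' * G \<in> forms M (e + d)"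
    using assms unfolding B.fracpair_def by (auto intro: forms_mult)
  then have "F * G' - F' * G \<in> forms M (d + e)" by (simp add: add.commute forms_closed(3))
  from swap.beta_mem_J[OF this] show ?thesis
    using B.frac_eq_iff[OF assms] A.frac_eq_iff[OF fracpair_alpha[OF assms(1)] fracpair_alpha[OF assms(2)]]
    by (simp add: a.hom_minus a.hom_mult)
qed

lemma pull_rational:
  assumes "B.fracpair d F G"
  shows "pull (B.rational F G) = A.rational (\<alpha> F) (\<alpha> G)"
proof -
  define z where "z = (SOME (F', G'). \<exists>d. B.fracpair d F' G' \<and> B.rational F G = B.rational F' G')"
  have "case z of (F', G') \<Rightarrow> \<exists>d. B.fracpair d F' G' \<and> B.rational F G = B.rational F' G'"
    unfolding z_def by (rule someI[of _ "(F, G)"]) (use assms in auto)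
  moreover obtain F' G' where z: "z = (F', G')" by (cases z)
  ultimately obtain e where e: "B.fracpair e F' G'" "B.rational F G = B.rational F' G'" by auto
  have "pull (B.rational F G) = A.rational (\<alpha> F') (\<alpha> G')"
    unfolding pull_def z_def[symmetric] z by simp
  then show ?thesis using rational_alpha_eq_iff[OF e(1) assms] e(2) by simp
qed

lemma rational_alpha_beta:
  assumes "A.fracpair d F G"
  shows "A.rational (\<alpha> (\<beta> F)) (\<alpha> (\<beta> G)) = A.rational F G"
proof -
  note FG = A.fracpairD[OF assms]
  have "G * (\<alpha> (\<beta> F) - u ^ d * F) - F * (\<alpha> (\<beta> G) - u ^ d * G) \<in> I"
    by (rule A.I_combine) (use alpha_beta FG in auto)
  then have "\<alpha> (\<beta> F) * G - F * \<alpha> (\<beta> G) \<in> I" by (simp add: algebra_simps)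
  then show ?thesis using A.frac_eq_iff[OF fracpair_alpha[OF fracpair_beta[OF assms]] assms] by simp
qed

text \<open>If the image of \<open>x\<close> is regular at the point, with denominator \<open>K\<close>, then \<open>\<beta> K\<close> is a
  denominator for \<open>x\<close> at the corresponding point.\<close>

lemma local_ring_pull:
  assumes P: "A.point P" "u \<notin> P" and x: "x \<in> carrier (function_field B)"
  shows "pull x \<in> local_ring A (\<pi> ` P) \<longleftrightarrow> x \<in> local_ring B (to_B (\<pi> ` P))"
proof
  note Q = pullback_alpha[OF P]
  obtain F G d where FG: "B.fracpair d F G" "x = B.rational F G"
    using x unfolding B.carrier_function_field by blast
  {
    assume "x \<in> local_ring B (to_B (\<pi> ` P))"
    then obtain F G d where FG: "B.fracpair d F G" "x = B.rational F G" "G \<notin> a.pullback P"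
      unfolding to_B_image[OF P(1)] B.local_ring_eq[OF Q(1)] by blast
    then have "\<alpha> G \<notin> P" using a.pullback_mem[OF B.fracpairD(4)[OF FG(1)]] by simp
    then show "pull x \<in> local_ring A (\<pi> ` P)"
      unfolding A.local_ring_eq[OF P(1)] FG(2) pull_rational[OF FG(1)]
      using fracpair_alpha[OF FG(1)] by blast
  }
  {
    assume "pull x \<in> local_ring A (\<pi> ` P)"
    then obtain H K e where HK: "A.fracpair e H K" "pull x = A.rational H K" "K \<notin> P"
      unfolding A.local_ring_eq[OF P(1)] by blast
    have bHK: "B.fracpair (s * e) (\<beta> H) (\<beta> K)" by (rule fracpair_beta[OF HK(1)])
    have "A.rational (\<alpha> (\<beta> H)) (\<alpha> (\<beta> K)) = A.rational (\<alpha> F) (\<alpha> G)"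
      using HK(2) unfolding FG(2) pull_rational[OF FG(1)] rational_alpha_beta[OF HK(1)] by simp
    then have "x = B.rational (\<beta> H) (\<beta> K)"
      using rational_alpha_eq_iff[OF bHK FG(1)] FG(2) by simp
    moreover have "\<beta> K \<notin> a.pullback P"
      using alpha_beta_mem[OF A.pointD(1,3)[OF P(1)] P(2) A.fracpairD(2)[OF HK(1)]] HK(3)
        a.pullback_mem[OF B.fracpairD(4)[OF bHK]] by simp
    ultimately show "x \<in> local_ring B (to_B (\<pi> ` P))"
      unfolding to_B_image[OF P(1)] B.local_ring_eq[OF Q(1)] using bHK by blast
  }
qed

lemma pull_bij: "bij_betw pull (carrier (function_field B)) (carrier (function_field A))"
proof (rule bij_betwI')
  fix x y assume "x \<in> carrier (function_field B)" "y \<in> carrier (function_field B)"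
  then obtain F G d F' G' e where "B.fracpair d F G" "x = B.rational F G" "B.fracpair e F' G'" "y = B.rational F' G'"
    unfolding B.carrier_function_field by blast
  then show "(pull x = pull y) = (x = y)" using pull_rational rational_alpha_eq_iff by metis
next
  fix x assume "x \<in> carrier (function_field B)"
  then obtain F G d where "B.fracpair d F G" "x = B.rational F G" unfolding B.carrier_function_field by blast
  then show "pull x \<in> carrier (function_field A)"
    unfolding A.carrier_function_field using pull_rational[of d F G] fracpair_alpha[of d F G] by blast
next
  fix y assume "y \<in> carrier (function_field A)"
  then obtain F G d where FG: "A.fracpair d F G" "y = A.rational F G" unfolding A.carrier_function_field by blast
  have "y = pull (B.rational (\<beta> F) (\<beta> G))"
    using pull_rational[OF fracpair_beta[OF FG(1)]] rational_alpha_beta[OF FG(1)] FG(2) by simp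
  then show "\<exists>x\<in>carrier (function_field B). y = pull x"
    unfolding B.carrier_function_field using fracpair_beta[OF FG(1)] by blast
qed

lemma pull_hom:
  assumes "x \<in> carrier (function_field B)" "y \<in> carrier (function_field B)"
  shows "pull (x \<otimes>\<^bsub>function_field B\<^esub> y) = pull x \<otimes>\<^bsub>function_field A\<^esub> pull y"
    "pull (x \<oplus>\<^bsub>function_field B\<^esub> y) = pull x \<oplus>\<^bsub>function_field A\<^esub> pull y"
proof -
  obtain F G d F' G' e where *: "B.fracpair d F G" "x = B.rational F G" "B.fracpair e F' G'" "y = B.rational F' G'"
    using assms unfolding B.carrier_function_field by blast
  note ** = fracpair_alpha[OF *(1)] fracpair_alpha[OF *(3)]
  show "pull (x \<otimes>\<^bsub>function_field B\<^esub> y) = pull x \<otimes>\<^bsub>function_field A\<^esub> pull y"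
    unfolding *(2,4) B.function_field_mult[OF *(1,3)] pull_rational[OF *(1)] pull_rational[OF *(3)]
      A.function_field_mult[OF **] pull_rational[OF B.fracpair_mult[OF *(1,3)]] by (simp add: a.hom_mult)
  show "pull (x \<oplus>\<^bsub>function_field B\<^esub> y) = pull x \<oplus>\<^bsub>function_field A\<^esub> pull y"
    unfolding *(2,4) B.function_field_add[OF *(1,3)] pull_rational[OF *(1)] pull_rational[OF *(3)]
      A.function_field_add[OF **] pull_rational[OF B.fracpair_add[OF *(1,3)]]
    by (simp add: a.hom_mult a.hom_add)
qed

lemma pull_constant: "pull (fraction B (scalar B c) \<one>\<^bsub>B\<^esub>) = fraction A (scalar A c) \<one>\<^bsub>A\<^esub>"
  unfolding B.constant_fraction A.constant_fraction pull_rational[OF B.fracpair_Const]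
  by (simp add: a.hom_Const a.hom_one)

text \<open>One map between the function fields serves for all open sets at once, so that compatibility
  with restrictions is automatic.\<close>

lemma pull_sections:
  assumes V: "V \<subseteq> UB"
  shows "pull \<in> ring_iso (sections B V) (sections A {p \<in> UA. to_B p \<in> V})"
proof -
  let ?W = "{p \<in> UA. to_B p \<in> V}"
  have "UB = to_B ` UA"
    using homeomorphic_imp_surjective_map[OF charts_homeomorphic] topspace_UA swap.topspace_UA by simp
  then have surj: "\<exists>p\<in>?W. q = to_B p" if "q \<in> V" for q using V that by auto
  have iff: "pull x \<in> carrier (sections A ?W) \<longleftrightarrow> x \<in> carrier (sections B V)"
    if x: "x \<in> carrier (function_field B)" for x
  proof -
    have "pull x \<in> carrier (function_field A)" using pull_bij x by (auto simp: bij_betw_def)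
    then have "pull x \<in> carrier (sections A ?W) \<longleftrightarrow> (\<forall>p\<in>?W. pull x \<in> local_ring A p)"
      by (simp add: sections_def)
    also have "\<dots> \<longleftrightarrow> (\<forall>p\<in>?W. x \<in> local_ring B (to_B p))"
    proof (rule ball_cong[OF refl])
      fix p assume "p \<in> ?W"
      then obtain P where "A.point P" "u \<notin> P" "p = \<pi> ` P" using UA_iff[of p] by blast
      then show "pull x \<in> local_ring A p \<longleftrightarrow> x \<in> local_ring B (to_B p)"
        using local_ring_pull[OF _ _ x] by simp
    qed
    also have "\<dots> \<longleftrightarrow> (\<forall>q\<in>V. x \<in> local_ring B q)"
    proof
      assume "\<forall>p\<in>?W. x \<in> local_ring B (to_B p)"
      then show "\<forall>q\<in>V. x \<in> local_ring B q" using surj by metis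
    qed simp
    also have "\<dots> \<longleftrightarrow> x \<in> carrier (sections B V)" using x by (simp add: sections_def)
    finally show ?thesis .
  qed
  have sub: "carrier (sections B V) \<subseteq> carrier (function_field B)"
    "carrier (sections A ?W) \<subseteq> carrier (function_field A)" by (auto simp: sections_def)
  have "bij_betw pull (carrier (sections B V)) (carrier (sections A ?W))"
    unfolding bij_betw_def
  proof
    show "inj_on pull (carrier (sections B V))"
      using pull_bij sub(1) inj_on_subset by (auto simp: bij_betw_def)
    show "pull ` carrier (sections B V) = carrier (sections A ?W)"
    proof (rule subset_antisym; rule subsetI)
      fix y assume "y \<in> pull ` carrier (sections B V)"
      then show "y \<in> carrier (sections A ?W)" using iff sub(1) by blast
    next
      fix y assume y: "y \<in> carrier (sections A ?W)"
      then obtain x where "x \<in> carrier (function_field B)" "y = pull x"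
        using pull_bij sub(2) unfolding bij_betw_def by blast
      then show "y \<in> pull ` carrier (sections B V)" using iff y by blast
    qed
  qed
  moreover have "pull \<in> ring_hom (sections B V) (sections A ?W)"
  proof (rule ring_hom_memI)
    fix x assume x: "x \<in> carrier (sections B V)"
    then show "pull x \<in> carrier (sections A ?W)" using iff sub(1) by blast
    fix y assume y: "y \<in> carrier (sections B V)"
    show "pull (x \<otimes>\<^bsub>sections B V\<^esub> y) = pull x \<otimes>\<^bsub>sections A ?W\<^esub> pull y"
      "pull (x \<oplus>\<^bsub>sections B V\<^esub> y) = pull x \<oplus>\<^bsub>sections A ?W\<^esub> pull y"
      using pull_hom[of x y] x y sub(1) by (auto simp: sections_def)
  next
    have "B.fracpair 0 1 1" using B.fracpair_Const[of 1] by (simp add: Const_simps)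
    then show "pull \<one>\<^bsub>sections B V\<^esub> = \<one>\<^bsub>sections A ?W\<^esub>"
      using pull_rational[of 0 1 1]
      by (simp add: sections_def A.function_field_one B.function_field_one a.hom_one)
  qed
  ultimately show ?thesis by (simp add: ring_iso_def)
qed

theorem charts_isomorphic: "open_subvarieties_isomorphic A UA B UB"
  unfolding open_subvarieties_isomorphic_def
  by (rule exI[of _ to_B], rule exI[of _ "\<lambda>_. pull"])
    (use charts_homeomorphic pull_sections pull_constant in auto)

end

section \<open>Principal ideals and cones\<close>

lemma dvd_substitute: "F dvd G \<Longrightarrow> substitute \<sigma> F dvd substitute \<sigma> G"
  by (auto simp: dvd_def substitute_mult)

text \<open>Setting all variables beyond \<open>N\<close> to zero fixes \<open>F\<close> and \<open>F * G\<close>, hence also \<open>G\<close>.\<close>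

lemma polynomials_in_factor:
  assumes "F * G \<in> polynomials_in N" "F \<in> polynomials_in N" "F \<noteq> 0"
  shows "G \<in> polynomials_in N"
proof -
  \<comment> \<open>a projection onto the polynomials in the variables up to \<open>N\<close>\<close>
  define \<kappa> where "\<kappa> = substitute (\<lambda>j. if j \<le> N then Var j else (0 :: 'a mpoly))"
  have id: "\<kappa> F = F" if "F \<in> polynomials_in N" for F
    using substitute_cong_polynomials[OF that, of "\<lambda>j. if j \<le> N then Var j else 0" Var]
    by (simp add: \<kappa>_def substitute_Var_id)
  have "F * \<kappa> G = F * G" using id[OF assms(1)] id[OF assms(2)] by (simp add: \<kappa>_def substitute_mult)
  then have "\<kappa> G = G" using assms(3) by simp
  moreover have "\<kappa> G \<in> polynomials_in N"
    unfolding \<kappa>_def substitute_def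
    by (intro polynomials_in_sum polynomials_in_closed polynomials_in_prod polynomials_in_power) auto
  ultimately show ?thesis by simp
qed

text \<open>The ideal generated by \<open>f\<close>. Divisibility may be taken in the ring of polynomials in all
  variables, by \<open>polynomials_in_factor\<close>.\<close>

definition multiples :: "nat \<Rightarrow> 'k::field mpoly \<Rightarrow> 'k mpoly set" where
  "multiples N f = {F \<in> polynomials_in N. f dvd F}"

lemma multiples_eq_adjoin:
  assumes "f \<in> polynomials_in N" "f \<noteq> 0"
  shows "multiples N f = adjoin N {0} f"
proof (rule subset_antisym; rule subsetI)
  fix F assume F: "F \<in> multiples N f"
  then obtain G where G: "F = f * G" by (auto simp: multiples_def dvd_def)
  then have "G \<in> polynomials_in N" using polynomials_in_factor[of f G N] F assms by (simp add: multiples_def)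
  then show "F \<in> adjoin N {0} f" using G unfolding adjoin_def by auto
next
  fix F assume "F \<in> adjoin N {0} f"
  then obtain G where "F = f * G" "G \<in> polynomials_in N" by (auto simp: adjoin_def)
  then show "F \<in> multiples N f" using assms(1) by (simp add: multiples_def)
qed

lemma PIdl_eq_multiples:
  assumes "f \<in> polynomials_in N" "f \<noteq> 0"
  shows "PIdl\<^bsub>polynomial_algebra N\<^esub> f = multiples N f"
  unfolding multiples_eq_adjoin[OF assms] by (simp add: cgenideal_def adjoin_def mult.commute)

lemma hideal_multiples:
  assumes "f \<in> forms N d" "f \<noteq> 0"
  shows "hideal N (multiples N f)"
  using multiples_eq_adjoin[OF forms_polynomial[OF assms(1)] assms(2)]
    hideal_adjoin[OF hprimeD(1)[OF hprime_zero] assms(1)] by simp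

lemma hilb_multiples:
  fixes f :: "'k::field mpoly"
  assumes "f \<in> forms N d" "f \<noteq> 0"
  shows "hilb N (multiples N f) (t + d) + ((t + N) choose N) = (t + d + N) choose N"
proof -
  have "colon N {0} f = {0}"
    using colon_hprime[OF hprime_zero forms_polynomial[OF assms(1)]] assms(2) by simp
  then show ?thesis
    using hilb_exact[OF hprimeD(1)[OF hprime_zero] assms(1), of t]
      multiples_eq_adjoin[OF forms_polynomial[OF assms(1)] assms(2)]
    by (simp add: hilb_zero)
qed

text \<open>Setting the variable \<open>i\<close> to zero: its kernel is the ideal of that variable, which is therefore
  a prime element.\<close>

definition kill :: "nat \<Rightarrow> 'k::field mpoly \<Rightarrow> 'k mpoly" where
  "kill i = substitute (\<lambda>j. if j = i then 0 else Var j)"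

lemma kill_mult: "kill i (F * G) = kill i F * kill i G" and kill_Var: "kill i (Var i) = 0"
  by (simp_all add: kill_def substitute_mult)

lemma kill_dvd: "F dvd G \<Longrightarrow> kill i F dvd kill i G"
  by (simp add: kill_def dvd_substitute)

lemma kill_eq_part: "kill i F = part {m. i \<notin> keys m} F"
proof -
  have "kill i F = (\<Sum>m\<in>keys F. if i \<notin> keys m then Poly_Mapping.single m (lookup F m) else 0)"
    unfolding kill_def substitute_def
  proof (rule sum.cong[OF refl])
    fix m
    show "Const (lookup F m) * monomial_value (\<lambda>j. if j = i then 0 else Var j) m =
       (if i \<notin> keys m then Poly_Mapping.single m (lookup F m) else 0)"
    proof (cases "i \<in> keys m")
      case True
      then have "monomial_value (\<lambda>j. if j = i then 0 else (Var j :: 'a mpoly)) m = 0"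
        by (intro prod_zero) (auto simp: in_keys_iff intro!: bexI[of _ i])
      then show ?thesis using True by simp
    next
      case False
      then have "monomial_value (\<lambda>j. if j = i then 0 else (Var j :: 'a mpoly)) m = monomial_value Var m"
        by (intro prod.cong) auto
      then show ?thesis using False by (simp add: monomial_value_Var Const_def mult_single)
    qed
  qed
  also have "\<dots> = (\<Sum>m\<in>keys F. Poly_Mapping.single m (lookup (part {m. i \<notin> keys m} F) m))"
    by (intro sum.cong refl) (simp add: lookup_part)
  also have "\<dots> = part {m. i \<notin> keys m} F"
    by (rule poly_expand_superset[symmetric]) (auto simp: keys_part)
  finally show ?thesis .
qed

lemma Var_dvd_minus_kill: "\<exists>F'. F - kill i F = F' * Var i" for F :: "'k::field mpoly"
proof -
  let ?e = "Poly_Mapping.single i (1::nat)"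
  define F' where "F' = (\<Sum>m\<in>{m\<in>keys F. i \<in> keys m}. Poly_Mapping.single (m - ?e) (lookup F m))"
  have "F' * Var i = (\<Sum>m\<in>{m\<in>keys F. i \<in> keys m}. Poly_Mapping.single (m - ?e + ?e) (lookup F m))"
    by (simp add: F'_def Var_def sum_distrib_right mult_single)
  also have "\<dots> = (\<Sum>m\<in>{m\<in>keys F. i \<in> keys m}. Poly_Mapping.single m (lookup F m))"
  proof (rule sum.cong[OF refl])
    fix m assume "m \<in> {m\<in>keys F. i \<in> keys m}"
    then have "m - ?e + ?e = m"
      by (intro poly_mapping_eqI) (auto simp: lookup_add lookup_minus lookup_single when_def in_keys_iff)
    then show "Poly_Mapping.single (m - ?e + ?e) (lookup F m) = Poly_Mapping.single m (lookup F m)" by simp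
  qed
  also have "\<dots> = (\<Sum>m\<in>{m\<in>keys F. i \<in> keys m}. Poly_Mapping.single m (lookup (F - kill i F) m))"
    unfolding kill_eq_part by (intro sum.cong refl) (simp add: lookup_part lookup_minus)
  also have "\<dots> = F - kill i F"
    unfolding kill_eq_part
    by (rule poly_expand_superset[symmetric])
      (auto simp: lookup_minus lookup_part lookup_not_eq_zero_eq_in_keys[symmetric] split: if_splits)
  finally show ?thesis by metis
qed

lemma Var_dvd_iff: "Var i dvd F \<longleftrightarrow> kill i F = 0" for F :: "'k::field mpoly"
proof
  assume "Var i dvd F"
  then show "kill i F = 0" by (auto simp: dvd_def kill_mult kill_Var)
next
  assume "kill i F = 0"
  then show "Var i dvd F" using Var_dvd_minus_kill[of F i] by auto
qed

lemma Var_dvd_mult: "Var i dvd F * G \<Longrightarrow> Var i dvd F \<or> Var i dvd G" for F G :: "'k::field mpoly"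
  by (simp add: Var_dvd_iff kill_mult)

lemma kill_id: "F \<in> polynomials_in N \<Longrightarrow> N < i \<Longrightarrow> kill i F = F"
  unfolding kill_eq_part by (rule part_id) (fastforce simp: polynomials_in_def)

text \<open>A variable that does not divide \<open>f\<close> is not a zero divisor modulo \<open>f\<close>, since it is prime and
  has to divide the cofactor of \<open>f\<close>.\<close>

lemma dvd_Var_cancel:
  fixes f G :: "'k::field mpoly"
  assumes "f dvd Var i * G" "\<not> Var i dvd f"
  shows "f dvd G"
proof -
  obtain q where q: "Var i * G = f * q" using assms(1) by (auto simp: dvd_def)
  then have "Var i dvd q" using Var_dvd_mult[of i f q] assms(2) by (metis dvd_triv_left)
  then obtain q' where "q = Var i * q'" by (auto simp: dvd_def)
  with q have "Var i * G = Var i * (f * q')" by (simp add: algebra_simps)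
  then have "G = f * q'" by simp
  then show ?thesis by simp
qed

lemma dvd_Var_power_cancel:
  fixes f G :: "'k::field mpoly"
  assumes "\<not> Var i dvd f"
  shows "f dvd Var i ^ k * G \<Longrightarrow> f dvd G"
  by (induction k) (auto simp: mult.assoc intro: dvd_Var_cancel[OF _ assms])

lemma form_dvd_lower_degree:
  assumes "f \<in> forms N l" "f dvd F" "F \<in> forms M d" "d < l"
  shows "F = 0"
proof -
  obtain q where "F = f * q" using assms(2) by (auto simp: dvd_def)
  then have "component d F = 0" using comp_mult_form[OF assms(1), of d q] assms(4) by simp
  then show ?thesis using comp_of_form[OF assms(3), of d] by simp
qed

text \<open>Induction on the degrees of \<open>F\<close> and \<open>G\<close> in the new variable \<open>w\<close>, the bounds \<open>a\<close> and \<open>b\<close>.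
  Setting \<open>w = 0\<close> shows that \<open>f\<close> divides the constant term of \<open>F\<close>, say. What remains of \<open>F\<close> is a
  multiple \<open>w F'\<close>, and \<open>w\<close> can be cancelled modulo \<open>f\<close>.\<close>

lemma cone_prime_aux:
  fixes f :: "'k::field mpoly"
  assumes f: "f \<in> polynomials_in N" "f \<noteq> 0"
    and prime: "\<And>F G. F \<in> polynomials_in N \<Longrightarrow> G \<in> polynomials_in N \<Longrightarrow> f dvd F * G \<Longrightarrow> f dvd F \<or> f dvd G"
    and "F \<in> polynomials_in (Suc N)" "G \<in> polynomials_in (Suc N)" "f dvd F * G"
    and "\<forall>m\<in>keys F. lookup m (Suc N) < a" "\<forall>m\<in>keys G. lookup m (Suc N) < b"
  shows "f dvd F \<or> f dvd G"
  using assms(4-)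
proof (induction "a + b" arbitrary: a b F G rule: less_induct)
  case less
  have kR: "kill (Suc N) F \<in> polynomials_in N" if "F \<in> polynomials_in (Suc N)" for F :: "'k mpoly"
    using that unfolding kill_eq_part polynomials_in_def by (fastforce simp: keys_part le_Suc_eq)
  have kf: "kill (Suc N) f = f" by (rule kill_id[OF f(1)]) simp
  have nd: "\<not> Var (Suc N) dvd f" using kf f(2) by (simp add: Var_dvd_iff)
  have step: "f dvd F \<or> f dvd G"
    if FR: "F \<in> polynomials_in (Suc N)" and GR: "G \<in> polynomials_in (Suc N)" and FG: "f dvd F * G"
      and Fa: "\<forall>m\<in>keys F. lookup m (Suc N) < a" and k: "f dvd kill (Suc N) F"
      and IH: "\<And>F'. F' \<in> polynomials_in (Suc N) \<Longrightarrow> f dvd F' * G \<Longrightarrow> a > 0 \<Longrightarrow>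
            \<forall>m\<in>keys F'. lookup m (Suc N) < a - 1 \<Longrightarrow> f dvd F' \<or> f dvd G"
    for F G a
  proof (cases "F = 0")
    case False
    then obtain m where "m \<in> keys F" by (metis ex_in_conv poly_expand sum.empty)
    then have "a > 0" using Fa by auto
    obtain F' where F': "F - kill (Suc N) F = F' * Var (Suc N)" using Var_dvd_minus_kill by blast
    have "F - kill (Suc N) F \<in> polynomials_in (Suc N)"
      using FR polynomials_in_mono[of N "Suc N"] kR[OF FR] by auto
    then have F'R: "F' \<in> polynomials_in (Suc N)"
      using polynomials_in_factor[of "Var (Suc N)" F' "Suc N"] F' by (simp add: mult.commute)
    have eq: "F * G = kill (Suc N) F * G + Var (Suc N) * (F' * G)"
    proof -
      have "F * G = (kill (Suc N) F + (F - kill (Suc N) F)) * G" by simp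
      also have "\<dots> = kill (Suc N) F * G + Var (Suc N) * (F' * G)"
        unfolding F' by (simp add: algebra_simps)
      finally show ?thesis .
    qed
    have "f dvd Var (Suc N) * (F' * G)"
      using FG k unfolding eq by (simp add: dvd_add_right_iff)
    then have "f dvd F' * G" by (rule dvd_Var_cancel[OF _ nd])
    moreover have "\<forall>m\<in>keys F'. lookup m (Suc N) < a - 1"
    proof
      fix m assume "m \<in> keys F'"
      then have "m + Poly_Mapping.single (Suc N) 1 \<in> keys (F' * Var (Suc N))"
        unfolding Var_def keys_mult_monomial by blast
      then have "m + Poly_Mapping.single (Suc N) 1 \<in> keys F"
        unfolding F'[symmetric] kill_eq_part by (auto simp: in_keys_iff lookup_minus lookup_part split: if_splits)
      then have "lookup (m + Poly_Mapping.single (Suc N) 1) (Suc N) < a" using Fa by blast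
      then show "lookup m (Suc N) < a - 1" by (simp add: lookup_add)
    qed
    ultimately have "f dvd F' \<or> f dvd G" using IH[OF F'R] \<open>a > 0\<close> by blast
    moreover have "F = kill (Suc N) F + F' * Var (Suc N)" using F' by (simp add: algebra_simps)
    then have "f dvd F" if "f dvd F'" using k that by (metis dvd_add dvd_mult2)
    ultimately show ?thesis by blast
  qed simp
  have "f dvd kill (Suc N) F * kill (Suc N) G"
    using kill_dvd[OF less.prems(3), of "Suc N"] by (simp add: kf kill_mult)
  then have "f dvd kill (Suc N) F \<or> f dvd kill (Suc N) G"
    using prime kR less.prems by blast
  then show ?case
  proof
    assume "f dvd kill (Suc N) F"
    then show ?thesis
      by (rule step[OF less.prems(1,2,3,4)]) (rule less.hyps[of "a - 1" b], use less.prems in auto)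
  next
    assume k: "f dvd kill (Suc N) G"
    have "f dvd G \<or> f dvd F"
      by (rule step[OF less.prems(2,1) _ less.prems(5) k])
        (use less.prems(3) less.hyps[of a "b - 1" F] less.prems in \<open>auto simp: mult.commute\<close>)
    then show ?thesis by blast
  qed
qed

lemma hprime_multiples_iff:
  fixes f :: "'k::field mpoly"
  assumes f: "f \<in> forms N l" "f \<noteq> 0"
  shows "hprime N (multiples N f) \<longleftrightarrow> \<not> f dvd 1 \<and>
    (\<forall>F\<in>polynomials_in N. \<forall>G\<in>polynomials_in N. f dvd F * G \<longrightarrow> f dvd F \<or> f dvd G)"
  using hideal_multiples[OF f] by (auto simp: hprime_def multiples_def)

lemma cone_prime:
  fixes f :: "'k::field mpoly"
  assumes f: "f \<in> forms N l" "f \<noteq> 0" and prime: "hprime N (multiples N f)"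
  shows "hprime (Suc N) (multiples (Suc N) f)"
proof -
  have f': "f \<in> forms (Suc N) l" using f(1) polynomials_in_mono[of N "Suc N"] by (auto simp: forms_iff)
  have bound: "\<exists>a. \<forall>m\<in>keys F. lookup m (Suc N) < a" for F :: "'k mpoly"
  proof
    show "\<forall>m\<in>keys F. lookup m (Suc N) < Suc (Max ((\<lambda>m. lookup m (Suc N)) ` keys F))"
      by (auto simp: less_Suc_eq_le intro!: Max_ge)
  qed
  have "f dvd F \<or> f dvd G"
    if FG: "F \<in> polynomials_in (Suc N)" "G \<in> polynomials_in (Suc N)" "f dvd F * G" for F G
  proof -
    obtain a b where ab: "\<forall>m\<in>keys F. lookup m (Suc N) < a" "\<forall>m\<in>keys G. lookup m (Suc N) < b"
      using bound by metis
    show ?thesis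
      by (rule cone_prime_aux[OF forms_polynomial[OF f(1)] f(2) _ FG ab])
        (use prime in \<open>auto simp: hprime_multiples_iff[OF f]\<close>)
  qed
  then show ?thesis
    using prime hprime_multiples_iff[OF f] hprime_multiples_iff[OF f' f(2)] by blast
qed

lemma Var_not_multiple:
  fixes f :: "'k::field mpoly"
  assumes f: "f \<in> forms N l" "f \<noteq> 0" and prime: "hprime N (multiples N f)" and "l \<ge> 2" "i \<le> N"
  shows "Var i \<notin> multiples N f" "\<not> Var i dvd f"
proof -
  have nd: "\<not> f dvd Var i"
    using form_dvd_lower_degree[OF f(1) _ forms_Var[OF \<open>i \<le> N\<close>]] \<open>l \<ge> 2\<close> by auto
  then show "Var i \<notin> multiples N f" by (simp add: multiples_def)
  show "\<not> Var i dvd f"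
  proof
    assume "Var i dvd f"
    then obtain h where h: "f = Var i * h" by (auto simp: dvd_def)
    have "h \<in> polynomials_in N"
      using polynomials_in_factor[of "Var i" h N] forms_polynomial[OF f(1)] h \<open>i \<le> N\<close> by simp
    then have "f dvd h"
      using prime nd h \<open>i \<le> N\<close> unfolding hprime_multiples_iff[OF f] by (metis Var_in_polynomials dvd_refl)
    then obtain s where "h = f * s" by (auto simp: dvd_def)
    then have "f * 1 = f * (Var i * s)" using h by (simp add: algebra_simps)
    then have "Var i * s = 1" using f(2) by (metis mult_cancel_left)
    then have "kill i (1 :: 'k mpoly) = 0" by (metis Var_dvd_iff dvd_triv_left)
    then show False by (simp add: kill_def)
  qed
qed

lemma ring_irreducible_if_prime:
  fixes f :: "'k::field mpoly"
  assumes f: "f \<in> forms N l" "f \<noteq> 0" and prime: "hprime N (multiples N f)"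
  shows "ring_irreducible\<^bsub>polynomial_algebra N\<^esub> f"
proof -
  interpret domain "polynomial_algebra N :: ('k mpoly, 'k) graded_algebra"
    by (rule polynomial_algebra_domain)
  have unit: "G \<in> Units (polynomial_algebra N)" if FG: "f = F * G" "f dvd F" "G \<in> polynomials_in N" for F G
  proof -
    obtain s where s: "F = f * s" using FG(2) by (auto simp: dvd_def)
    have "f * (s * G) = f"
      by (simp only: s[symmetric] mult.assoc[symmetric] FG(1)[symmetric])
    then have "f * 1 = f * (s * G)" by simp
    then have sG: "s * G = 1" using f(2) by (metis mult_cancel_left)
    then have "s \<in> polynomials_in N"
      using polynomials_in_factor[of G s N] FG(3) by (force simp: mult.commute)
    then show ?thesis using sG FG(3) by (auto simp: Units_def mult.commute)
  qed
  show ?thesis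
  proof (rule ring_irreducibleI)
    show "f \<in> carrier (polynomial_algebra N) - {\<zero>\<^bsub>polynomial_algebra N\<^esub>}"
      using f forms_polynomial by auto
    show "f \<notin> Units (polynomial_algebra N)"
      using prime unfolding hprime_multiples_iff[OF f] by (auto simp: Units_def dvd_def)
    fix F G :: "'k mpoly" assume "F \<in> carrier (polynomial_algebra N)" "G \<in> carrier (polynomial_algebra N)"
      and eq: "f = F \<otimes>\<^bsub>polynomial_algebra N\<^esub> G"
    then have FG: "F \<in> polynomials_in N" "G \<in> polynomials_in N" "f = F * G" by auto
    then have "f dvd F \<or> f dvd G" using prime unfolding hprime_multiples_iff[OF f] by (metis dvd_refl)
    then show "F \<in> Units (polynomial_algebra N) \<or> G \<in> Units (polynomial_algebra N)"
      using unit[of F G] unit[of G F] FG by (auto simp: mult.commute)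
  qed
qed

section \<open>Dimension and arithmetic genus of hypersurfaces\<close>

text \<open>The Hilbert function of a hypersurface of degree \<open>l\<close> is a difference of two binomial
  coefficients, which by Pascal's rule is a sum of \<open>l\<close> coefficients with the lower entry \<open>k\<close>. It
  is bounded by \<open>l\<close> times the largest of them, and from below by the smallest.\<close>

lemma choose_step_bounds:
  shows "(t + l + Suc k) choose Suc k \<le> ((t + Suc k) choose Suc k) + l * ((t + l + k) choose k)"
    and "l \<ge> 1 \<Longrightarrow> ((t + Suc k) choose k) + ((t + Suc k) choose Suc k) \<le> (t + l + Suc k) choose Suc k"
proof -
  show "(t + l + Suc k) choose Suc k \<le> ((t + Suc k) choose Suc k) + l * ((t + l + k) choose k)"
  proof (induction l)
    case (Suc l)
    have "(t + Suc l + Suc k) choose Suc k = ((t + l + Suc k) choose k) + ((t + l + Suc k) choose Suc k)"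
      by simp
    also have "\<dots> \<le> ((t + l + Suc k) choose k) + (((t + Suc k) choose Suc k) + l * ((t + l + Suc k) choose k))"
      using Suc binomial_right_mono[of "t + l + k" "t + l + Suc k" k]
      by (meson add_left_mono le_trans mult_le_mono2 le_add1 add_le_mono order_refl lessI less_imp_le nat_add_left_cancel_le)
    finally show ?case by simp
  qed simp
  assume "l \<ge> 1"
  then have "(Suc (t + Suc k)) choose Suc k \<le> (t + l + Suc k) choose Suc k"
    by (intro binomial_right_mono) simp
  then show "((t + Suc k) choose k) + ((t + Suc k) choose Suc k) \<le> (t + l + Suc k) choose Suc k" by simp
qed

lemma choose_absorb_le: "(t + Suc k) choose Suc k \<le> (t + 1) * ((t + Suc k) choose k)"
proof (induction t)
  case 0
  then show ?case by simp
next
  case (Suc t)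
  have "(Suc t + Suc k) choose Suc k = ((t + Suc k) choose k) + ((t + Suc k) choose Suc k)" by simp
  also have "\<dots> \<le> (Suc t + 1) * ((t + Suc k) choose k)" using Suc by simp
  also have "\<dots> \<le> (Suc t + 1) * ((Suc t + Suc k) choose k)"
    by (intro mult_le_mono2 binomial_right_mono) simp
  finally show ?case .
qed

lemma choose_le_power: "(t + l + k) choose k \<le> (l + k + 1) ^ k * (t + 1) ^ k"
proof -
  have "(t + l + k) choose k \<le> (t + l + k) ^ k" by (rule binomial_le_pow) simp
  also have "\<dots> \<le> ((l + k + 1) * (t + 1)) ^ k" by (intro power_mono) (auto simp: algebra_simps)
  finally show ?thesis by (simp only: power_mult_distrib)
qed

lemma hilb_multiples_bounds:
  fixes f :: "'k::field mpoly"
  assumes f: "f \<in> forms (Suc k) l" "f \<noteq> 0" and "l \<ge> 1"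
  shows "(t + Suc k) choose k \<le> hilb (Suc k) (multiples (Suc k) f) (t + l)"
    and "\<exists>c. \<forall>t. hilb (Suc k) (multiples (Suc k) f) t \<le> c * (t + 1) ^ k"
proof -
  let ?h = "hilb (Suc k) (multiples (Suc k) f)"
  note h = hilb_multiples[OF f]
  show "(t + Suc k) choose k \<le> ?h (t + l)"
    using h[of t] choose_step_bounds(2)[OF \<open>l \<ge> 1\<close>, of t k] by linarith
  have ge: "?h (t + l) \<le> l * ((l + k + 1) ^ k * (t + l + 1) ^ k)" for t
  proof -
    have "?h (t + l) \<le> l * ((t + l + k) choose k)"
      using h[of t] choose_step_bounds(1)[of t l k] by linarith
    also have "\<dots> \<le> l * ((l + k + 1) ^ k * (t + 1) ^ k)" by (intro mult_le_mono2 choose_le_power)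
    also have "\<dots> \<le> l * ((l + k + 1) ^ k * (t + l + 1) ^ k)" by (intro mult_le_mono2 power_mono) auto
    finally show ?thesis .
  qed
  have lt: "?h t \<le> (l + Suc k) choose Suc k" if "t < l" for t
  proof -
    have "?h t \<le> hilb (Suc k) {0 :: 'k mpoly} t"
      using hidealD(2)[OF hideal_multiples[OF f]]
      by (intro hilb_antimono hprimeD(1)[OF hprime_zero] hideal_multiples[OF f]) auto
    also have "\<dots> \<le> (l + Suc k) choose Suc k"
      unfolding hilb_zero using that by (intro binomial_right_mono) simp
    finally show ?thesis .
  qed
  let ?c = "l * (l + k + 1) ^ k + ((l + Suc k) choose Suc k)"
  have "?h t \<le> ?c * (t + 1) ^ k" for t
  proof (cases "t < l")
    case True
    have "((l + Suc k) choose Suc k) * 1 \<le> ((l + Suc k) choose Suc k) * (t + 1) ^ k" by (intro mult_le_mono2) simp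
    then show ?thesis using lt[OF True] unfolding distrib_right by linarith
  next
    case False
    then show ?thesis using ge[of "t - l"] unfolding distrib_right by (simp add: mult.assoc)
  qed
  then show "\<exists>c. \<forall>t. ?h t \<le> c * (t + 1) ^ k" by blast
qed

definition binom_poly :: "nat \<Rightarrow> rat \<Rightarrow> rat poly" where
  "binom_poly r a = Polynomial.smult (1 / fact r) (\<Prod>i = 0..<r. [:a - of_nat i, 1:])"

lemma poly_binom_poly: "poly (binom_poly r a) x = (x + a) gchoose r"
  by (simp add: binom_poly_def gbinomial_prod_rev poly_prod algebra_simps)

text \<open>The Hilbert polynomial of a hypersurface of degree \<open>l\<close>. At \<open>0\<close>, the subtracted binomial
  coefficient has the upper entry \<open>N - l\<close>; negating it produces the arithmetic genus.\<close>

definition hypersurface_poly :: "nat \<Rightarrow> nat \<Rightarrow> rat poly" where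
  "hypersurface_poly N l = binom_poly N (of_nat N) - binom_poly N (of_nat N - of_nat l)"

lemma hypersurface_poly_0:
  assumes "l \<ge> 1"
  shows "poly (hypersurface_poly N l) 0 = 1 - (-1) ^ N * of_nat ((l - 1) choose N)"
proof -
  have "(of_nat N - of_nat l :: rat) gchoose N = (-1) ^ N * (of_nat (l - 1) gchoose N)"
    using assms by (subst gbinomial_negated_upper) (simp add: of_nat_diff algebra_simps)
  moreover have "(of_nat N :: rat) gchoose N = 1" by (simp flip: binomial_gbinomial)
  ultimately show ?thesis by (simp add: hypersurface_poly_def poly_binom_poly binomial_gbinomial)
qed

lemma hilb_multiples_poly:
  fixes f :: "'k::field mpoly"
  assumes f: "f \<in> forms N l" "f \<noteq> 0" and "l \<le> t"
  shows "of_nat (hilb N (multiples N f) t) = poly (hypersurface_poly N l) (of_nat t)"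
proof -
  define s where "s = t - l"
  have t: "t = s + l" using assms by (simp add: s_def)
  have "rat_of_nat (hilb N (multiples N f) (s + l)) + of_nat ((s + N) choose N) = of_nat ((s + l + N) choose N)"
    unfolding hilb_multiples[OF f, of s, symmetric] by simp
  moreover have "rat_of_nat (s + l) + (of_nat N - of_nat l) = of_nat (s + N)" by simp
  moreover have "rat_of_nat (s + l) + of_nat N = of_nat (s + l + N)" by simp
  ultimately show ?thesis
    unfolding t hypersurface_poly_def poly_diff poly_binom_poly by (simp only: binomial_gbinomial)
qed

lemma hypersurface_invariants:
  fixes f :: "'k::field mpoly"
  assumes f: "f \<in> forms (Suc k) l" "f \<noteq> 0" and prime: "hprime (Suc k) (multiples (Suc k) f)" and "l \<ge> 2"
    and Y: "ambient Y = Suc k" "vanishing_ideal Y = multiples (Suc k) f"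
  shows "projective_variety Y" "dimension_of Y = enat k" "arithmetic_genus Y = of_nat ((l - 1) choose Suc k)"
    "hypersurface (Suc k) l Y"
proof -
  have rel: "relevant (Suc k) (multiples (Suc k) f)"
    using Var_not_multiple(1)[OF f prime \<open>l \<ge> 2\<close>, of 0] by (auto simp: relevant_def)
  show pv: "projective_variety Y" unfolding projective_variety_iff Y using prime rel by simp
  interpret presented_domain "coordinate_ring Y" "residue Y" "Suc k" "multiples (Suc k) f"
    using presented_domain_coordinate_ring[of Y] prime by (simp add: Y)
  obtain c where c: "\<And>t. hilb (Suc k) (multiples (Suc k) f) t \<le> c * (t + 1) ^ k"
    using hilb_multiples_bounds(2)[OF f] \<open>l \<ge> 2\<close> by auto
  have low: "(t + k) choose k \<le> hilb (Suc k) (multiples (Suc k) f) (t + l)" for t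
    using hilb_multiples_bounds(1)[OF f, of t] \<open>l \<ge> 2\<close> binomial_right_mono[of "t + k" "t + Suc k" k] by simp
  show dim: "dimension_of Y = enat k"
    unfolding dimension_of_def by (rule krull_dim_by_growth[OF prime c low])
  have "hilbert_polynomial (coordinate_ring Y) = hypersurface_poly (Suc k) l"
    by (rule hilbert_polynomial_eqI[OF hprimeD(2)[OF prime], of l]) (rule hilb_multiples_poly[OF f])
  then show "arithmetic_genus Y = of_nat ((l - 1) choose Suc k)"
    unfolding arithmetic_genus_def dim using hypersurface_poly_0[of l "Suc k"] \<open>l \<ge> 2\<close>
    by (simp flip: mult.assoc power_add mult_2)
  show "hypersurface (Suc k) l Y"
    unfolding hypersurface_def grade_polynomial_algebra
    using pv Y f ring_irreducible_if_prime[OF f prime] PIdl_eq_multiples[OF forms_polynomial[OF f(1)] f(2)] by auto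
qed

section \<open>Hypersurfaces of every degree\<close>

text \<open>A binomial that vanishes on the image of the monomial map \<open>toric_subst\<close>, which describes a
  rational curve of degree \<open>l\<close> in the plane, and a cone over it in higher dimensions.\<close>

definition toric_form :: "nat \<Rightarrow> 'k::field mpoly" where
  "toric_form l = Var 2 ^ l - Var 1 * Var 0 ^ (l - 1)"

lemma toric_form_forms:
  assumes "N \<ge> 2" "l \<ge> 1"
  shows "(toric_form l :: 'k::field mpoly) \<in> forms N l"
proof -
  have "(Var 2 :: 'k mpoly) ^ l \<in> forms N l" "(Var 0 :: 'k mpoly) ^ (l - 1) \<in> forms N (l - 1)"
    using forms_power[OF forms_Var[of 2 N], of l] forms_power[OF forms_Var[of 0 N], of "l - 1"] assms by simp_all
  moreover from forms_mult[OF forms_Var[of 1 N] this(2)] have "(Var 1 :: 'k mpoly) * Var 0 ^ (l - 1) \<in> forms N l"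
    using assms by simp
  ultimately show ?thesis unfolding toric_form_def by (intro forms_closed(3))
qed

text \<open>The exponent vector of the image of a monomial under \<open>toric_subst\<close>.\<close>

definition toric_exponents :: "nat \<Rightarrow> (nat \<Rightarrow>\<^sub>0 nat) \<Rightarrow> nat \<Rightarrow>\<^sub>0 nat" where
  "toric_exponents l m = m + Poly_Mapping.single 0 (lookup m 1 + lookup m 2)
     + Poly_Mapping.single 1 (l * lookup m 1 + lookup m 2)
     - Poly_Mapping.single 1 (lookup m 1) - Poly_Mapping.single 2 (lookup m 2)"

definition toric_subst :: "nat \<Rightarrow> nat \<Rightarrow> 'k::field mpoly" where
  "toric_subst l i = (if i = 1 then Var 0 * Var 1 ^ l else if i = 2 then Var 0 * Var 1 else Var i)"

lemma Var_power: "Var i ^ n = Poly_Mapping.single (Poly_Mapping.single i n) (1 :: 'k::field)"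
  by (induction n) (simp_all add: Var_def mult_single flip: single_add)

lemma lookup_toric_exponents:
  "lookup (toric_exponents l m) i =
    (if i = 0 then lookup m 0 + lookup m 1 + lookup m 2
     else if i = 1 then l * lookup m 1 + lookup m 2 else if i = 2 then 0 else lookup m i)"
  by (auto simp: toric_exponents_def lookup_add lookup_minus lookup_single when_def)

lemma monomial_value_toric:
  "monomial_value (toric_subst l) m = Poly_Mapping.single (toric_exponents l m) (1 :: 'k::field)"
proof -
  define S where "S = keys m \<union> {0, 1, 2}"
  let ?rest = "\<Prod>i\<in>S - {0,1,2}. (Var i :: 'k mpoly) ^ lookup m i"
  have fin: "finite S" by (simp add: S_def)
  have three: "(\<Prod>i\<in>S. g i) = g 0 * g 1 * g 2 * (\<Prod>i\<in>S - {0,1,2}. g i)" for g :: "nat \<Rightarrow> 'k mpoly"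
  proof -
    have "(\<Prod>i\<in>S. g i) = (\<Prod>i\<in>{0,1,2} \<union> (S - {0,1,2}). g i)" by (rule prod.cong) (auto simp: S_def)
    also have "\<dots> = (\<Prod>i\<in>{0,1,2}. g i) * (\<Prod>i\<in>S - {0,1,2}. g i)"
      by (rule prod.union_disjoint) (auto simp: fin)
    finally show ?thesis by (simp add: mult.assoc)
  qed
  define m' where "m' = toric_exponents l m"
  have keys_m': "keys m' \<subseteq> S"
    by (auto simp: m'_def S_def in_keys_iff lookup_toric_exponents split: if_splits)
  have "monomial_value (toric_subst l) m = (\<Prod>i\<in>S. toric_subst l i ^ lookup m i)"
    by (rule monomial_value_superset) (auto simp: S_def)
  also have "\<dots> = Var 0 ^ lookup m 0 * (Var 0 * Var 1 ^ l) ^ lookup m 1 * (Var 0 * Var 1) ^ lookup m 2 * ?rest"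
    unfolding three by (simp add: toric_subst_def)
  also have "\<dots> = Var 0 ^ lookup m' 0 * Var 1 ^ lookup m' 1 * Var 2 ^ lookup m' 2 * ?rest"
    by (simp add: m'_def lookup_toric_exponents power_add power_mult power_mult_distrib)
  also have "?rest = (\<Prod>i\<in>S - {0,1,2}. Var i ^ lookup m' i)"
    by (rule prod.cong) (auto simp: m'_def lookup_toric_exponents)
  also have "Var 0 ^ lookup m' 0 * Var 1 ^ lookup m' 1 * Var 2 ^ lookup m' 2 * \<dots> = (\<Prod>i\<in>S. Var i ^ lookup m' i)"
    unfolding three by simp
  also have "\<dots> = monomial_value Var m'"
    by (rule monomial_value_superset[symmetric]) (use keys_m' in \<open>auto simp: S_def\<close>)
  finally show ?thesis by (simp add: monomial_value_Var m'_def)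
qed

text \<open>The exponent of \<open>Var 1\<close> in the image is \<open>l * lookup m 1 + lookup m 2\<close>, from which quotient and
  remainder modulo \<open>l\<close> recover both exponents.\<close>

lemma toric_exponents_inj:
  assumes "toric_exponents l m = toric_exponents l m'" "lookup m 2 < l" "lookup m' 2 < l"
  shows "m = m'"
proof -
  have eq: "lookup (toric_exponents l m) i = lookup (toric_exponents l m') i" for i using assms(1) by simp
  have e1: "l * lookup m 1 + lookup m 2 = l * lookup m' 1 + lookup m' 2"
    using eq[of 1] by (simp add: lookup_toric_exponents)
  have 2: "lookup m 2 = lookup m' 2"
    using arg_cong[OF e1, of "\<lambda>x. x mod l"] assms(2,3) by simp
  have 1: "lookup m 1 = lookup m' 1"
    using e1 2 assms(2) by simp
  have 0: "lookup m 0 = lookup m' 0"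
    using eq[of 0] 1 2 by (simp add: lookup_toric_exponents)
  have "lookup m i = lookup m' i" for i
  proof -
    consider "i = 0" | "i = 1" | "i = 2" | "i \<noteq> 0" "i \<noteq> 1" "i \<noteq> 2" by blast
    then show ?thesis using 0 1 2 eq[of i] by cases (auto simp: lookup_toric_exponents)
  qed
  then show ?thesis by (rule poly_mapping_eqI)
qed

lemma toric_remainder_monomial:
  fixes c :: "'k::field"
  assumes "l \<ge> 1"
  shows "\<exists>G. toric_form l dvd (Poly_Mapping.single m c - G) \<and> (\<forall>m\<in>keys G. lookup m 2 < l)"
proof (induction "lookup m 2" arbitrary: m rule: less_induct)
  case less
  show ?case
  proof (cases "lookup m 2 < l")
    case True
    then show ?thesis by (intro exI[of _ "Poly_Mapping.single m c"]) auto
  next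
    case False
    define u where "u = m - Poly_Mapping.single 2 l"
    have m: "m = u + Poly_Mapping.single 2 l"
      using False unfolding u_def
      by (intro poly_mapping_eqI) (auto simp: lookup_add lookup_minus lookup_single when_def)
    \<comment> \<open>modulo the binomial, \<open>Var 2 ^ l\<close> is replaced by \<open>Var 1 * Var 0 ^ (l - 1)\<close>\<close>
    define m' where "m' = u + Poly_Mapping.single 1 1 + Poly_Mapping.single 0 (l - 1)"
    have "lookup m' 2 < lookup m 2"
      using False assms by (simp add: m'_def m lookup_add lookup_single when_def)
    then obtain G where G: "toric_form l dvd (Poly_Mapping.single m' c - G)" "\<forall>m\<in>keys G. lookup m 2 < l"
      using less by blast
    have "Poly_Mapping.single m c = Poly_Mapping.single u c * Var 2 ^ l"
      by (simp add: m Var_power mult_single)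
    moreover have "Poly_Mapping.single m' c = Poly_Mapping.single u c * (Var 1 * Var 0 ^ (l - 1))"
      unfolding Var_power by (simp add: m'_def Var_def mult_single add.assoc)
    ultimately have "Poly_Mapping.single m c - G =
        toric_form l * Poly_Mapping.single u c + (Poly_Mapping.single m' c - G)"
      by (simp add: toric_form_def algebra_simps)
    then have "toric_form l dvd (Poly_Mapping.single m c - G)"
      using G(1) by (metis dvd_add dvd_triv_left)
    with G(2) show ?thesis by blast
  qed
qed

text \<open>Division by \<open>toric_form l\<close>, which is monic of degree \<open>l\<close> in the variable \<open>Var 2\<close>.\<close>

lemma toric_remainder:
  fixes F :: "'k::field mpoly"
  assumes "l \<ge> 1"
  shows "\<exists>G. toric_form l dvd (F - G) \<and> (\<forall>m\<in>keys G. lookup m 2 < l)"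
proof -
  obtain g where g: "\<And>m. toric_form l dvd (Poly_Mapping.single m (lookup F m) - g m)"
     "\<And>m. \<forall>m'\<in>keys (g m). lookup m' 2 < l"
  proof -
    have "\<forall>m. \<exists>G. toric_form l dvd (Poly_Mapping.single m (lookup F m) - G) \<and> (\<forall>m\<in>keys G. lookup m 2 < l)"
      by (intro allI toric_remainder_monomial assms)
    from this[THEN choice] show thesis using that by blast
  qed
  have "F - (\<Sum>m\<in>keys F. g m) = (\<Sum>m\<in>keys F. Poly_Mapping.single m (lookup F m) - g m)"
    by (subst (1) poly_expand) (simp add: sum_subtractf)
  also have "toric_form l dvd \<dots>" by (intro dvd_sum g)
  finally have "toric_form l dvd F - (\<Sum>m\<in>keys F. g m)" .
  moreover have "\<forall>m'\<in>keys (\<Sum>m\<in>S. g m). lookup m' 2 < l" for S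
    by (induction S rule: infinite_finite_induct) (use g(2) keys_add_subset in \<open>auto dest!: subsetD[OF keys_add_subset]\<close>)
  ultimately show ?thesis by blast
qed

text \<open>The binomial generates the kernel of a homomorphism to a domain, which shows that it is prime.
  A remainder in the kernel is zero, because distinct monomials of degree less than \<open>l\<close> in
  \<open>Var 2\<close> have distinct images.\<close>

lemma toric_dvd_iff:
  fixes F :: "'k::field mpoly"
  assumes "l \<ge> 1"
  shows "toric_form l dvd F \<longleftrightarrow> substitute (toric_subst l) F = 0"
proof -
  have zero: "substitute (toric_subst l) (toric_form l :: 'k mpoly) = 0"
  proof -
    have "(Var 0 * Var 1) ^ l = Var 0 * (Var 1 :: 'k mpoly) ^ l * Var 0 ^ (l - 1)"
      using assms by (cases l) (auto simp: power_mult_distrib algebra_simps)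
    then show ?thesis
      by (simp add: toric_form_def substitute_minus substitute_mult substitute_power toric_subst_def)
  qed
  show ?thesis
  proof
    assume "toric_form l dvd F"
    then show "substitute (toric_subst l) F = 0"
      using dvd_substitute[of "toric_form l" F "toric_subst l"] zero by simp
  next
    assume F: "substitute (toric_subst l) F = 0"
    obtain G where G: "toric_form l dvd (F - G)" "\<forall>m\<in>keys G. lookup m 2 < l"
      using toric_remainder[OF assms] by blast
    have "substitute (toric_subst l) (F - G) = 0"
      using dvd_substitute[OF G(1), of "toric_subst l"] zero by simp
    then have "substitute (toric_subst l) G = 0" using F by (simp add: substitute_minus)
    moreover have "substitute (toric_subst l) G =
        (\<Sum>m\<in>keys G. Poly_Mapping.single (toric_exponents l m) (lookup G m))"
      unfolding substitute_def monomial_value_toric by (simp add: Const_def mult_single)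
    ultimately have sum0: "(\<Sum>m\<in>keys G. Poly_Mapping.single (toric_exponents l m) (lookup G m)) = 0" by simp
    have "keys G = {}"
    proof (rule ccontr)
      assume "keys G \<noteq> {}"
      then obtain m where m: "m \<in> keys G" by blast
      have "0 = lookup (\<Sum>m\<in>keys G. Poly_Mapping.single (toric_exponents l m) (lookup G m)) (toric_exponents l m)"
        using sum0 by simp
      also have "\<dots> = (\<Sum>m'\<in>keys G. if m' = m then lookup G m else 0)"
        unfolding lookup_sum
        by (intro sum.cong refl) (use G(2) m toric_exponents_inj in \<open>auto simp: lookup_single when_def\<close>)
      also have "\<dots> = lookup G m" using m by simp
      finally show False using m by (simp add: in_keys_iff)
    qed
    then have "G = 0" using poly_expand[of G] by simp
    then show "toric_form l dvd F" using G(1) by simp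
  qed
qed

lemma hypersurface_exists:
  assumes "N \<ge> 2" "l \<ge> 2"
  shows "\<exists>H :: 'k::field projective_scheme. hypersurface N l H"
proof -
  let ?f = "toric_form l :: 'k mpoly"
  have f: "?f \<in> forms N l" by (rule toric_form_forms) (use assms in auto)
  have ne: "?f \<noteq> 0"
  proof
    assume "?f = 0"
    \<comment> \<open>the value of the binomial at the point with \<open>y_2 = 1\<close> and all other coordinates zero is \<open>1\<close>\<close>
    then have "substitute (\<lambda>i. if i = 2 then 1 else 0) ?f = 0" by simp
    then show False by (simp add: toric_form_def substitute_minus substitute_mult substitute_power)
  qed
  have prime: "hprime N (multiples N ?f)"
    unfolding hprime_multiples_iff[OF f ne] toric_dvd_iff[of l, OF order_trans[OF one_le_numeral assms(2)]]
    by (simp add: substitute_mult)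
  obtain k where "N = Suc k" using assms by (cases N) auto
  then show ?thesis
    using hypersurface_invariants(4)[of ?f k l "\<lparr>ambient = N, vanishing_ideal = multiples N ?f\<rparr>"] f ne prime assms(2)
    by auto
qed

section \<open>The Segre product of the projective line with a hypersurface\<close>

lemma nat_zero_one_or_shift: "i = 0 \<or> i = 1 \<or> (\<exists>j. i = j + (2 :: nat))"
  by presburger

text \<open>The product of the projective line, with coordinates \<open>x_0, x_1\<close>, and the hypersurface of \<open>f\<close>,
  with coordinates \<open>y_0, ..., y_n\<close>. Three polynomial rings occur. In the Segre coordinates,
  \<open>z_0j\<close> is the variable \<open>j\<close> and \<open>z_1j\<close> the variable \<open>n + 1 + j\<close>, so that \<open>D\<close> is the last index.
  In the ring of the \<open>x_i\<close> and \<open>y_j\<close>, the variable \<open>x_i\<close> has number \<open>i\<close> and \<open>y_j\<close> has number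
  \<open>2 + j\<close>, and \<open>f\<close> becomes \<open>fy\<close>. In the ring of the cone, \<open>y_j\<close> has number \<open>j\<close> and the
  additional variable \<open>w\<close> has number \<open>n + 1\<close>.\<close>

locale segre_hypersurface =
  fixes n l :: nat and f :: "'k::field mpoly"
  assumes n: "n \<ge> 1" and l: "l \<ge> 2" and f: "f \<in> forms n l" "f \<noteq> 0"
    and prime: "hprime n (multiples n f)"
begin

definition D where "D = 2 * n + 1"
definition fy where "fy = substitute (\<lambda>j. Var (2 + j)) f"
text \<open>The homomorphisms between these rings: \<open>seg\<close> is the Segre map \<open>z_ij \<mapsto> x_i y_j\<close>; \<open>tau\<close>
  sends \<open>x_0\<close> to \<open>y_0\<close> and \<open>x_1\<close> to \<open>w\<close> and keeps the \<open>y_j\<close>; \<open>beta\<close> is the composite of the two;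
  and \<open>theta\<close> sends \<open>y_j\<close> to \<open>x_0 y_j\<close> and \<open>w\<close> to \<open>x_1 y_0\<close>, so that applied after \<open>tau\<close> it
  multiplies every \<open>x_i y_j\<close> by \<open>x_0 y_0\<close>. The map in the opposite direction of \<open>beta\<close>, sending
  \<open>y_j\<close> to \<open>z_0j\<close> and \<open>w\<close> to \<open>z_10\<close>, preserves the numbers of the variables and so is the
  identity.\<close>

definition seg :: "nat \<Rightarrow> 'k mpoly" where "seg q = Var (q div (n + 1)) * Var (2 + q mod (n + 1))"
definition beta :: "nat \<Rightarrow> 'k mpoly" where
  "beta q = (if q \<le> n then Var 0 * Var q else Var (n + 1) * Var (q - (n + 1)))"
definition tau :: "nat \<Rightarrow> 'k mpoly" where
  "tau i = (if i = 0 then Var 0 else if i = 1 then Var (n + 1) else Var (i - 2))"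
definition theta :: "nat \<Rightarrow> 'k mpoly" where
  "theta j = (if j \<le> n then Var 0 * Var (2 + j) else Var 1 * Var 2)"

abbreviation Q where "Q \<equiv> multiples (n + 1) f"
definition IX where "IX = {F \<in> polynomials_in D. fy dvd substitute seg F}"

lemma index_cases:
  assumes "q \<le> D"
  obtains (low) "q \<le> n" "q div (n + 1) = 0" "q mod (n + 1) = q"
    | (high) j where "j \<le> n" "q = (n + 1) + j" "q div (n + 1) = 1" "q mod (n + 1) = j"
proof (cases "q \<le> n")
  case True
  then show ?thesis by (intro low) auto
next
  case False
  define j where "j = q - (n + 1)"
  have "q = j + 1 * (n + 1)" "j \<le> n" using False assms by (auto simp: j_def D_def)
  moreover from this have "q div (n + 1) = 1" "q mod (n + 1) = j"
    by (simp_all only: div_mult_self1 mod_mult_self1, simp_all)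
  ultimately show ?thesis by (intro high[of j]) auto
qed

lemma prime': "hprime (n + 1) Q" using cone_prime[OF f prime] by simp
lemma f': "f \<in> forms (n + 1) l" using f(1) polynomials_in_mono[of n "n + 1"] by (auto simp: forms_iff)

lemma fy_forms: "fy \<in> forms (n + 2) l"
  using substitute_forms[OF f(1), of "\<lambda>j. Var (2 + j)" "n + 2" 1] forms_Var[of "2 + j" "n + 2" for j]
  by (auto simp: fy_def)

lemma tau_fy: "substitute tau fy = f"
  by (simp add: fy_def substitute_substitute tau_def substitute_Var_id)

lemma fy_nonzero: "fy \<noteq> 0" using tau_fy f(2) by auto

lemma tau_seg: "F \<in> polynomials_in D \<Longrightarrow> substitute tau (substitute seg F) = substitute beta F"
  unfolding substitute_substitute
  by (rule substitute_cong_polynomials, assumption)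
    (erule index_cases, simp_all add: substitute_mult seg_def beta_def tau_def)

lemma theta_f: "substitute theta f = Var 0 ^ l * fy"
  unfolding fy_def by (rule substitute_scaled[OF f(1)]) (simp add: theta_def)

lemma theta_beta:
  assumes "F \<in> forms D d"
  shows "substitute theta (substitute beta F) = (Var 0 * Var 2) ^ d * substitute seg F"
  unfolding substitute_substitute
proof (rule substitute_scaled[OF assms])
  fix q assume "q \<le> D"
  then show "substitute theta (beta q) = Var 0 * Var 2 * seg q"
    by (cases rule: index_cases) (simp_all add: substitute_mult beta_def theta_def seg_def mult_ac)
qed

lemma seg_forms: "q \<le> D \<Longrightarrow> seg q \<in> forms (n + 2) 2"
  using forms_mult[OF forms_Var[of "q div (n + 1)" "n + 2"] forms_Var[of "2 + q mod (n + 1)" "n + 2"]]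
  by (erule_tac index_cases) (auto simp: seg_def numeral_2_eq_2)

lemma beta_forms: "q \<le> D \<Longrightarrow> beta q \<in> forms (n + 1) 2"
  using forms_mult[OF forms_Var[of 0 "n + 1"] forms_Var[of q "n + 1"]]
    forms_mult[OF forms_Var[of "n + 1" "n + 1"] forms_Var[of "q - (n + 1)" "n + 1"]]
  by (erule_tac index_cases) (auto simp: beta_def numeral_2_eq_2)

sublocale b: graded_substitution "substitute beta" D "n + 1" 2
  by (rule graded_substitution_substitute) (rule beta_forms, auto)

sublocale s: graded_substitution "substitute seg" D "n + 2" 2
  by (rule graded_substitution_substitute) (rule seg_forms, auto)

sublocale i: graded_substitution "\<lambda>F :: 'k mpoly. F" "n + 1" D 1
proof
  have "n + 1 \<le> D" by (simp add: D_def)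
  then have sub: "polynomials_in (n + 1) \<subseteq> (polynomials_in D :: 'k mpoly set)" by (rule polynomials_in_mono)
  then show "F \<in> polynomials_in (n + 1) \<Longrightarrow> F \<in> polynomials_in D" for F :: "'k mpoly" by blast
  show "F \<in> forms (n + 1) d \<Longrightarrow> F \<in> forms D (1 * d)" for F :: "'k mpoly" and d
    using sub by (auto simp: forms_iff)
qed auto

lemma Var_not_dvd_fy: "\<not> Var 0 dvd fy" "\<not> Var 2 dvd fy"
proof -
  have "kill 0 fy = fy"
    unfolding fy_def kill_def substitute_substitute by (rule substitute_cong) auto
  then show "\<not> Var 0 dvd fy" using fy_nonzero by (simp add: Var_dvd_iff)
  show "\<not> Var 2 dvd fy"
  proof
    assume "Var 2 dvd fy"
    then have "Var 0 dvd f" using dvd_substitute[of "Var 2" fy tau] by (simp add: tau_fy tau_def)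
    then show False using Var_not_multiple(2)[OF f prime l, of 0] by simp
  qed
qed

text \<open>The homomorphism \<open>tau\<close> carries membership in the ideal of the product to membership in the
  ideal of the cone, and \<open>theta\<close> carries it back after multiplication by a power of \<open>x_0 y_0\<close>.
  That power can be cancelled because neither \<open>x_0\<close> nor \<open>y_0\<close> divides \<open>fy\<close>.\<close>

lemma IX_pullback: "IX = b.pullback Q"
proof (rule hideal_eq_on_forms)
  have "IX = s.pullback (multiples (n + 2) fy)"
    unfolding IX_def s.pullback_def multiples_def using s.hom_polynomials by blast
  then show "hideal D IX" using s.hideal_pullback[OF hideal_multiples[OF fy_forms fy_nonzero]] by simp
  show "hideal D (b.pullback Q)" by (rule b.hideal_pullback[OF hprimeD(1)[OF prime']])
  fix d and F :: "'k mpoly" assume F: "F \<in> forms D d"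
  note FR = forms_polynomial[OF F]
  have "fy dvd substitute seg F \<longleftrightarrow> f dvd substitute beta F"
  proof
    assume "fy dvd substitute seg F"
    from dvd_substitute[OF this, of tau] show "f dvd substitute beta F"
      by (simp add: tau_fy tau_seg[OF FR])
  next
    assume "f dvd substitute beta F"
    from dvd_substitute[OF this, of theta]
    have "Var 0 ^ l * fy dvd (Var 0 * Var 2) ^ d * substitute seg F"
      by (simp add: theta_f theta_beta[OF F])
    then have "fy dvd Var 0 ^ d * (Var 2 ^ d * substitute seg F)"
      by (metis dvd_mult_right power_mult_distrib mult.assoc)
    then show "fy dvd substitute seg F"
      using dvd_Var_power_cancel[OF Var_not_dvd_fy(1)] dvd_Var_power_cancel[OF Var_not_dvd_fy(2)] by blast
  qed
  then show "F \<in> IX \<longleftrightarrow> F \<in> b.pullback Q"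
    using FR b.hom_polynomials[OF FR] by (simp add: IX_def b.pullback_def multiples_def)
qed

lemma IX_prime: "hprime D IX"
  unfolding IX_pullback by (rule b.hprime_pullback[OF prime'])

text \<open>On \<open>y_j = z_0j\<close> and \<open>w = z_10\<close>, the substitution \<open>beta\<close> is multiplication by \<open>y_0\<close>.\<close>

lemma beta_scaled:
  assumes "F \<in> forms (n + 1) d"
  shows "substitute beta F = Var 0 ^ d * F"
proof -
  have "substitute beta F = Var 0 ^ d * substitute Var F"
    by (rule substitute_scaled[OF assms]) (auto simp: beta_def le_Suc_eq)
  then show ?thesis by (simp add: substitute_Var_id)
qed

lemma Var0: "Var 0 \<notin> Q" "Var 0 \<notin> IX"
proof -
  show Q0: "Var 0 \<notin> Q"
    using Var_not_multiple(1)[OF f prime l, of 0] by (simp add: multiples_def)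
  then have "Var 0 * Var 0 \<notin> Q" using hprime_mult_iff[OF prime', of "Var 0" "Var 0"] by simp
  then show "Var 0 \<notin> IX" by (simp add: IX_pullback b.pullback_def beta_def)
qed

section \<open>Hilbert function and invariants of the product\<close>

text \<open>The degrees in the \<open>x_i\<close> and in the \<open>y_j\<close>. The Segre map identifies forms of degree \<open>t\<close> in the
  \<open>z_ij\<close>, modulo its kernel, with bihomogeneous polynomials of bidegree \<open>(t, t)\<close>.\<close>

definition xw :: "(nat \<Rightarrow>\<^sub>0 nat) \<Rightarrow> nat" where "xw m = lookup m 0 + lookup m 1"
definition yw :: "(nat \<Rightarrow>\<^sub>0 nat) \<Rightarrow> nat" where "yw m = (\<Sum>j\<le>n. lookup m (j + 2))"

lemma weights: "weight xw" "weight yw"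
  by (auto simp: weight_def xw_def yw_def lookup_add sum.distrib)

definition bimonomials :: "nat \<Rightarrow> nat \<Rightarrow> (nat \<Rightarrow>\<^sub>0 nat) set" where
  "bimonomials s t = {m. keys m \<subseteq> {..n + 2} \<and> xw m = s \<and> yw m = t}"

text \<open>The renaming \<open>y_j \<mapsto> Var (2 + j)\<close> on exponent vectors; \<open>down\<close> forgets the \<open>x_i\<close> and
  undoes it.\<close>

definition up :: "(nat \<Rightarrow>\<^sub>0 nat) \<Rightarrow> nat \<Rightarrow>\<^sub>0 nat" where
  "up p = (\<Sum>j\<in>keys p. Poly_Mapping.single (j + 2) (lookup p j))"

lemma lookup_up: "lookup (up p) i = (if 2 \<le> i then lookup p (i - 2) else 0)"
proof -
  have "lookup (up p) i = (\<Sum>j\<in>keys p. if j = i - 2 \<and> 2 \<le> i then lookup p (i - 2) else 0)"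
    unfolding up_def lookup_sum by (intro sum.cong refl) (auto simp: lookup_single when_def)
  then show ?thesis by (cases "2 \<le> i") (auto simp: in_keys_iff)
qed

definition down :: "(nat \<Rightarrow>\<^sub>0 nat) \<Rightarrow> nat \<Rightarrow>\<^sub>0 nat" where
  "down m = Poly_Mapping.map_key (\<lambda>j. j + 2) m"

lemma lookup_down: "lookup (down m) j = lookup m (j + 2)"
  by (simp add: down_def map_key.rep_eq inj_def)

lemma card_bimonomials: "finite (bimonomials s t)" "card (bimonomials s t) = (s + 1) * ((t + n) choose n)"
proof -
  let ?g = "\<lambda>(i, p). Poly_Mapping.single 0 (s - i) + Poly_Mapping.single 1 i + up p"
  let ?h = "\<lambda>m. (lookup m 1, down m)"
  have mon: "monomials n t = {p. keys p \<subseteq> {..n} \<and> (\<Sum>j\<le>n. lookup p j) = t}"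
    unfolding monomials_def using monomial_degree_superset[of "{..n}"] by auto
  have "bij_betw ?g ({..s} \<times> monomials n t) (bimonomials s t)"
  proof (rule bij_betw_byWitness[where f' = ?h])
    show "\<forall>a\<in>{..s} \<times> monomials n t. ?h (?g a) = a"
      by (auto simp: lookup_add lookup_single lookup_up lookup_down when_def intro!: poly_mapping_eqI)
    show "\<forall>m\<in>bimonomials s t. ?g (?h m) = m"
    proof
      fix m assume m: "m \<in> bimonomials s t"
      have "lookup (?g (?h m)) i = lookup m i" for i
      proof -
        consider "i = 0" | "i = 1" | j where "i = j + 2" using nat_zero_one_or_shift[of i] by blast
        then show ?thesis
          using m by cases (auto simp: bimonomials_def xw_def lookup_add lookup_single lookup_up lookup_down when_def)
      qed
      then show "?g (?h m) = m" by (rule poly_mapping_eqI)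
    qed
    show "?g ` ({..s} \<times> monomials n t) \<subseteq> bimonomials s t"
    proof
      fix m assume "m \<in> ?g ` ({..s} \<times> monomials n t)"
      then obtain i p where ip: "i \<le> s" "p \<in> monomials n t" "m = ?g (i, p)" by auto
      have L: "lookup m k = (if k = 0 then s - i else if k = 1 then i else lookup p (k - 2))" for k
        using ip(3) by (auto simp: lookup_add lookup_single lookup_up when_def)
      have "keys m \<subseteq> {..n + 2}"
      proof
        fix k assume "k \<in> keys m"
        then have "lookup m k \<noteq> 0" by (simp add: in_keys_iff)
        then have "k \<le> 1 \<or> k - 2 \<in> keys p" unfolding L by (auto simp: in_keys_iff split: if_splits)
        then show "k \<in> {..n + 2}" using ip(2) by (force simp: mon)
      qed
      then show "m \<in> bimonomials s t"
        using ip(1,2) by (simp add: bimonomials_def xw_def yw_def L mon)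
    qed
    show "?h ` bimonomials s t \<subseteq> {..s} \<times> monomials n t"
    proof
      fix a assume "a \<in> ?h ` bimonomials s t"
      then obtain m where m: "m \<in> bimonomials s t" "a = ?h m" by auto
      have "keys (down m) \<subseteq> {..n}"
      proof
        fix k assume "k \<in> keys (down m)"
        then have "k + 2 \<in> keys m" by (simp add: in_keys_iff lookup_down)
        then show "k \<in> {..n}" using m(1) by (auto simp: bimonomials_def)
      qed
      then show "a \<in> {..s} \<times> monomials n t"
        using m by (auto simp: bimonomials_def xw_def yw_def mon lookup_down)
    qed
  qed
  then show "finite (bimonomials s t)" "card (bimonomials s t) = (s + 1) * ((t + n) choose n)"
    using bij_betw_finite bij_betw_same_card card_monomials[of n t] by fastforce+
qed

text \<open>A monomial of bidegree \<open>(t, t)\<close> is a product of \<open>t\<close> monomials \<open>x_i y_j\<close>.\<close>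

lemma single_in_seg_image:
  assumes "m \<in> bimonomials t t"
  shows "\<exists>x \<in> forms D t. substitute seg x = Poly_Mapping.single m 1"
  using assms
proof (induction t arbitrary: m)
  case 0
  have "lookup m i = 0" for i
  proof -
    consider "i = 0" | "i = 1" | j where "i = j + 2" using nat_zero_one_or_shift[of i] by blast
    then show ?thesis
    proof cases
      case (3 j)
      show ?thesis
      proof (cases "j \<le> n")
        case True
        then show ?thesis using 0 3 by (auto simp: bimonomials_def yw_def)
      next
        case False
        then have "i \<notin> keys m" using 0 3 by (auto simp: bimonomials_def)
        then show ?thesis by (simp add: in_keys_iff)
      qed
    qed (use 0 in \<open>auto simp: bimonomials_def xw_def\<close>)
  qed
  then have "m = 0" by (intro poly_mapping_eqI) simp
  then show ?case using forms_one by (intro bexI[of _ 1]) auto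
next
  case (Suc t)
  obtain i where i: "i \<le> 1" "lookup m i \<noteq> 0"
  proof -
    have "lookup m 0 \<noteq> 0 \<or> lookup m 1 \<noteq> 0" using Suc.prems by (auto simp: bimonomials_def xw_def)
    then show thesis using that[of 0] that[of 1] by auto
  qed
  obtain j where j: "j \<le> n" "lookup m (j + 2) \<noteq> 0"
  proof -
    have "(\<Sum>j\<le>n. lookup m (j + 2)) \<noteq> 0" using Suc.prems by (auto simp: bimonomials_def yw_def)
    then obtain j where "j \<in> {..n}" "lookup m (j + 2) \<noteq> 0" by (meson sum.not_neutral_contains_not_neutral)
    then show thesis using that by auto
  qed
  define e where "e = Poly_Mapping.single i (1::nat) + Poly_Mapping.single (j + 2) 1"
  define m' where "m' = m - e"
  have m: "m = m' + e"
    using i j by (intro poly_mapping_eqI) (auto simp: m'_def e_def lookup_add lookup_minus lookup_single when_def)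
  have "xw e = 1" "yw e = 1"
    using i j by (auto simp: xw_def yw_def e_def lookup_add lookup_single when_def sum.distrib)
  then have "m' \<in> bimonomials t t"
    using Suc.prems weightD[OF weights(1), of m' e] weightD[OF weights(2), of m' e]
    by (auto simp: bimonomials_def m keys_add_nat)
  then obtain x where x: "x \<in> forms D t" "substitute seg x = Poly_Mapping.single m' 1" using Suc.IH by blast
  \<comment> \<open>the number of the coordinate \<open>z_ij\<close>\<close>
  define q where "q = j + i * (n + 1)"
  have "q div (n + 1) = i" "q mod (n + 1) = j"
    unfolding q_def using j(1) by (simp_all only: div_mult_self1 mod_mult_self1, simp_all)
  then have "seg q = Var i * Var (j + 2)" by (simp add: seg_def add.commute)
  also have "\<dots> = Poly_Mapping.single e 1" by (simp add: e_def Var_def mult_single)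
  finally have "substitute seg (x * Var q) = Poly_Mapping.single m 1"
    by (simp add: substitute_mult x(2) m mult_single)
  moreover have "i * (n + 1) \<le> 1 * (n + 1)" by (rule mult_le_mono1[OF i(1)])
  then have "q \<le> D" using j(1) by (simp add: q_def D_def)
  then have "x * Var q \<in> forms D (Suc t)" using forms_mult[OF x(1) forms_Var[of q D]] by simp
  ultimately show ?case by blast
qed

lemma seg_bigraded: "F \<in> forms D t \<Longrightarrow> substitute seg F \<in> supported (bimonomials t t)"
proof -
  assume F: "F \<in> forms D t"
  have seg: "xw m = 1" "yw m = 1" if "q \<le> D" "m \<in> keys (seg q)" for q m
  proof -
    have "m = Poly_Mapping.single (q div (n + 1)) 1 + Poly_Mapping.single (2 + q mod (n + 1)) 1"
      using that(2) by (simp add: seg_def Var_def mult_single)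
    moreover have "q div (n + 1) \<le> 1" "q mod (n + 1) \<le> n" using that(1) by (auto elim: index_cases)
    ultimately show "xw m = 1" "yw m = 1"
      by (auto simp: xw_def yw_def lookup_add lookup_single when_def sum.distrib)
  qed
  show ?thesis
    using substitute_weight[OF weights(1) F seg(1)] substitute_weight[OF weights(2) F seg(2)]
      s.hom_polynomials[OF forms_polynomial[OF F]]
    by (auto simp: supported_def bimonomials_def polynomials_in_def)
qed

lemma fy_weights: "\<forall>m\<in>keys fy. xw m = 0" "\<forall>m\<in>keys fy. yw m = l"
proof -
  have v: "xw m = 0" "yw m = 1" if "j \<le> n" "m \<in> keys (Var (2 + j) :: 'k mpoly)" for j m
    using that by (auto simp: keys_Var xw_def yw_def lookup_single when_def)
  show "\<forall>m\<in>keys fy. xw m = 0" "\<forall>m\<in>keys fy. yw m = l"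
    using substitute_weight[OF weights(1) f(1) v(1)] substitute_weight[OF weights(2) f(1) v(2)]
    by (simp_all add: fy_def)
qed

text \<open>Let \<open>B\<close> be the space of polynomials of bidegree \<open>(t + l, t + l)\<close>. Modulo its intersection with
  the ideal of \<open>fy\<close> it is the coordinate ring of the product in degree \<open>t + l\<close>, by the Segre
  map. As \<open>fy\<close> has bidegree \<open>(0, l)\<close>, the intersection is isomorphic to the space of polynomials
  of bidegree \<open>(t + l, t)\<close>, by multiplication with \<open>fy\<close>.\<close>

lemma hilb_IX:
  "hilb D IX (t + l) + (t + l + 1) * ((t + n) choose n) = (t + l + 1) * ((t + l + n) choose n)"
proof -
  let ?B = "supported (bimonomials (t + l) (t + l)) :: 'k mpoly set"
  let ?C = "supported (bimonomials (t + l) t) :: 'k mpoly set"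
  let ?W = "multiples (n + 2) fy \<inter> ?B"
  have BR: "?B \<subseteq> polynomials_in (n + 2)"
    by (auto simp: supported_def bimonomials_def polynomials_in_def)
  have sW: "mp.subspace ?W"
    by (intro mp.subspace_inter supported_subspace hideal_subspace[OF hideal_multiples[OF fy_forms fy_nonzero]])
  have hI: "hideal D IX" by (rule hprimeD(1)[OF IX_prime])
  have "mp.reldim ?W {substitute seg x + w |x w. x \<in> forms D (t + l) \<and> w \<in> ?W} (hilb D IX (t + l))"
  proof (rule mp.reldim_image[OF hilb_reldim[OF hI] hideal_forms_subspace[OF hI] sW])
    fix x :: "'k mpoly" assume "x \<in> forms D (t + l)"
    then show "substitute seg x \<in> ?W \<longleftrightarrow> x \<in> IX \<inter> forms D (t + l)"
      using seg_bigraded[of x "t + l"] s.hom_polynomials forms_polynomial[of x D "t + l"]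
      by (simp add: IX_def multiples_def)
  qed (simp_all add: substitute_add substitute_mult)
  also have "{substitute seg x + w |x w. x \<in> forms D (t + l) \<and> w \<in> ?W} = ?B"
  proof (rule subset_antisym; rule subsetI)
    fix F assume "F \<in> {substitute seg x + w |x w. x \<in> forms D (t + l) \<and> w \<in> ?W}"
    then obtain x w where "F = substitute seg x + w" "x \<in> forms D (t + l)" "w \<in> ?B" by blast
    then show "F \<in> ?B" using mp.subspace_add[OF supported_subspace seg_bigraded] by blast
  next
    fix F assume F: "F \<in> ?B"
    have "\<forall>m\<in>keys F. \<exists>x. x \<in> forms D (t + l) \<and> substitute seg x = Poly_Mapping.single m 1"
    proof
      fix m assume "m \<in> keys F"
      then have "m \<in> bimonomials (t + l) (t + l)" using F by (auto simp: supported_def)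
      from single_in_seg_image[OF this]
      show "\<exists>x. x \<in> forms D (t + l) \<and> substitute seg x = Poly_Mapping.single m 1" by blast
    qed
    then obtain x where x: "\<And>m. m \<in> keys F \<Longrightarrow> x m \<in> forms D (t + l)"
      "\<And>m. m \<in> keys F \<Longrightarrow> substitute seg (x m) = Poly_Mapping.single m 1" by metis
    let ?x = "\<Sum>m\<in>keys F. Const (lookup F m) * x m"
    have "substitute seg ?x = (\<Sum>m\<in>keys F. Poly_Mapping.single m (lookup F m))"
      by (simp add: substitute_sum substitute_mult x(2) Const_def[symmetric])
        (simp add: Const_def mult_single)
    then have "F = substitute seg ?x + 0" by (simp add: poly_expand[symmetric])
    moreover have "?x \<in> forms D (t + l)" by (intro mp.subspace_sum forms_subspace forms_closed(4) x(1))
    moreover have "0 \<in> ?W" by (rule mp.subspace_0[OF sW])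
    ultimately show "F \<in> {substitute seg x + w |x w. x \<in> forms D (t + l) \<and> w \<in> ?W}" by blast
  qed
  finally have r1: "mp.reldim ?W ?B (hilb D IX (t + l))" .
  have "mp.reldim {0} {fy * x + w |x w. x \<in> ?C \<and> w \<in> {0}} (card (bimonomials (t + l) t))"
    by (rule mp.reldim_image[OF reldim_supported[OF card_bimonomials(1)] mp.subspace_single_0 mp.subspace_single_0])
      (use fy_nonzero in \<open>auto simp: algebra_simps\<close>)
  also have "{fy * x + w |x w. x \<in> ?C \<and> w \<in> {0}} = ?W"
  proof (rule subset_antisym; rule subsetI)
    fix F assume "F \<in> {fy * x + w |x w. x \<in> ?C \<and> w \<in> {0}}"
    then obtain x where x: "F = fy * x" "x \<in> ?C" by auto
    have xR: "x \<in> polynomials_in (n + 2)" using x(2) by (auto simp: supported_def bimonomials_def polynomials_in_def)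
    have "\<forall>m\<in>keys x. xw m = t + l" "\<forall>m\<in>keys x. yw m = t"
      using x(2) by (auto simp: supported_def bimonomials_def)
    from weight_homogeneous_mult[OF weights(1) fy_weights(1) this(1)]
      weight_homogeneous_mult[OF weights(2) fy_weights(2) this(2)]
    have "\<forall>m\<in>keys F. xw m = t + l" "\<forall>m\<in>keys F. yw m = t + l" by (simp_all add: x(1))
    moreover have "F \<in> polynomials_in (n + 2)"
      unfolding x(1) using xR forms_polynomial[OF fy_forms] by auto
    ultimately show "F \<in> ?W"
      using x(1) by (auto simp: multiples_def supported_def bimonomials_def polynomials_in_def)
  next
    fix F assume F: "F \<in> ?W"
    then obtain x where x: "F = fy * x" by (auto simp: multiples_def dvd_def)
    have xR: "x \<in> polynomials_in (n + 2)"
      using polynomials_in_factor[of fy x "n + 2"] F x forms_polynomial[OF fy_forms] fy_nonzero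
      by (auto simp: multiples_def)
    have FB: "\<forall>m\<in>keys F. xw m = t + l" "\<forall>m\<in>keys F. yw m = l + t"
      using F by (auto simp: supported_def bimonomials_def)
    have Fx: "wpart xw (t + l) F = F" and Fy: "wpart yw (l + t) F = F"
      using FB by (auto intro: part_id)
    have "fy * wpart xw (t + l) x = fy * x"
      using wpart_mult_homogeneous[OF weights(1) fy_weights(1), of "t + l" x] Fx
      unfolding x[symmetric] add_0 by simp
    then have "wpart xw (t + l) x = x" using fy_nonzero by simp
    moreover have "fy * wpart yw t x = fy * x"
      using wpart_mult_homogeneous[OF weights(2) fy_weights(2), of t x] Fy
      unfolding x[symmetric] by simp
    then have "wpart yw t x = x" using fy_nonzero by simp
    ultimately have "keys x \<subseteq> bimonomials (t + l) t"
      using xR keys_part[of "{m. xw m = t + l}" x] keys_part[of "{m. yw m = t}" x]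
      unfolding bimonomials_def polynomials_in_def by auto
    then show "F \<in> {fy * x + w |x w. x \<in> ?C \<and> w \<in> {0}}" using x by (auto simp: supported_def)
  qed
  finally have r2: "mp.reldim {0} ?W (card (bimonomials (t + l) t))" .
  from mp.reldim_zero_unique[OF mp.reldim_trans[OF r1 r2] reldim_supported[OF card_bimonomials(1)]]
  show ?thesis by (simp add: card_bimonomials(2) add.commute)
qed

lemma hilb_IX_lower: "(t + n) choose n \<le> hilb D IX (t + l)"
proof -
  obtain k where k: "n = Suc k" using n by (cases n) auto
  have "(t + Suc k) choose Suc k \<le> (t + 1) * ((t + Suc k) choose k)" by (rule choose_absorb_le)
  also have "\<dots> \<le> (t + l + 1) * ((t + Suc k) choose k)" by (intro mult_le_mono1) simp
  finally have "((t + n) choose n) + (t + l + 1) * ((t + n) choose n)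
      \<le> (t + l + 1) * (((t + Suc k) choose k) + ((t + Suc k) choose Suc k))"
    unfolding k distrib_left by (rule add_right_mono)
  also have "\<dots> \<le> (t + l + 1) * ((t + l + Suc k) choose Suc k)"
    using choose_step_bounds(2)[of l t k] l by (intro mult_le_mono2) simp
  finally show ?thesis using hilb_IX[of t] unfolding k by linarith
qed

lemma hilb_IX_upper: "\<exists>c. \<forall>t. hilb D IX t \<le> c * (t + 1) ^ n"
proof -
  obtain k where k: "n = Suc k" using n by (cases n) auto
  define a where "a = l * (l + k + 1) ^ k"
  define b where "b = (l + D) choose D"
  have ge: "hilb D IX (t + l) \<le> a * (t + l + 1) ^ n" for t
  proof -
    have "(t + l + 1) * ((t + l + Suc k) choose Suc k)
        \<le> (t + l + 1) * (((t + Suc k) choose Suc k) + l * ((t + l + k) choose k))"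
      by (intro mult_le_mono2 choose_step_bounds(1))
    then have "hilb D IX (t + l) \<le> (t + l + 1) * (l * ((t + l + k) choose k))"
      using hilb_IX[of t] unfolding k distrib_left by linarith
    also have "\<dots> \<le> (t + l + 1) * (l * ((l + k + 1) ^ k * (t + 1) ^ k))"
      by (intro mult_le_mono2 choose_le_power)
    also have "\<dots> \<le> (t + l + 1) * (l * ((l + k + 1) ^ k * (t + l + 1) ^ k))"
      by (intro mult_le_mono2 power_mono) auto
    also have "\<dots> = a * (t + l + 1) ^ n" by (simp only: a_def k power_Suc mult_ac)
    finally show ?thesis .
  qed
  have lt: "hilb D IX t \<le> b" if "t < l" for t
  proof -
    have "hilb D IX t \<le> hilb D {0 :: 'k mpoly} t"
      using hidealD(2)[OF hprimeD(1)[OF IX_prime]]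
      by (intro hilb_antimono hprimeD(1)[OF hprime_zero] hprimeD(1)[OF IX_prime]) auto
    also have "\<dots> \<le> b" unfolding hilb_zero b_def using that by (intro binomial_right_mono) simp
    finally show ?thesis .
  qed
  have "hilb D IX t \<le> (a + b) * (t + 1) ^ n" for t
  proof (cases "t < l")
    case True
    have "b * 1 \<le> b * (t + 1) ^ n" by (intro mult_le_mono2) simp
    then show ?thesis using lt[OF True] unfolding distrib_right by linarith
  next
    case False
    then show ?thesis using ge[of "t - l"] unfolding distrib_right by simp
  qed
  then show ?thesis by blast
qed

lemma hilb_IX_poly:
  assumes "l \<le> t"
  shows "of_nat (hilb D IX t) = poly ([:1, 1:] * hypersurface_poly n l) (of_nat t)"
proof -
  define s where "s = t - l"
  have t: "t = s + l" using assms by (simp add: s_def)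
  have e1: "rat_of_nat (hilb D IX (s + l)) + of_nat (s + l + 1) * of_nat ((s + n) choose n)
      = of_nat (s + l + 1) * of_nat ((s + l + n) choose n)"
    using arg_cong[OF hilb_IX[of s], of rat_of_nat] by (simp only: of_nat_add of_nat_mult)
  have e2: "poly (hypersurface_poly n l) (of_nat (s + l))
      = of_nat ((s + l + n) choose n) - of_nat ((s + n) choose n)"
  proof -
    have "rat_of_nat (s + l) + (of_nat n - of_nat l) = of_nat (s + n)" by simp
    moreover have "rat_of_nat (s + l) + of_nat n = of_nat (s + l + n)" by simp
    ultimately show ?thesis
      unfolding hypersurface_poly_def poly_diff poly_binom_poly by (simp only: binomial_gbinomial)
  qed
  have e3: "poly [:1, 1:] (rat_of_nat (s + l)) = of_nat (s + l + 1)" by simp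
  show ?thesis
    unfolding t poly_mult e2 e3 right_diff_distrib using e1 by linarith
qed

text \<open>The product and the cone as subschemes of projective spaces.\<close>

definition X :: "'k projective_scheme" where "X = \<lparr>ambient = D, vanishing_ideal = IX\<rparr>"
definition C :: "'k projective_scheme" where "C = \<lparr>ambient = n + 1, vanishing_ideal = Q\<rparr>"

text \<open>The ideal by which the Segre product is defined is generated by all multiples of \<open>f\<close>,
  rewritten in the variables \<open>Var (2 + j)\<close>; it is generated by \<open>fy\<close> alone.\<close>

lemma segre_ideal:
  "Idl\<^bsub>polynomial_algebra (n + 2)\<^esub> ({0} \<union> substitute (\<lambda>j. Var (2 + j)) ` multiples n f) = multiples (n + 2) fy"
proof -
  interpret presented_algebra "polynomial_algebra (n + 2)" "\<lambda>F. F" "n + 2" "{0 :: 'k mpoly}"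
    by (rule presented_polynomial_algebra)
  let ?S = "{0} \<union> substitute (\<lambda>j. Var (2 + j)) ` multiples n f"
  have hp: "hideal (n + 2) (multiples (n + 2) fy)" by (rule hideal_multiples[OF fy_forms fy_nonzero])
  have S: "?S \<subseteq> multiples (n + 2) fy"
  proof -
    have "substitute (\<lambda>j. Var (2 + j)) F \<in> multiples (n + 2) fy" if "F \<in> multiples n f" for F
      using that dvd_substitute[of f F "\<lambda>j. Var (2 + j)"]
      by (auto simp: multiples_def fy_def intro: substitute_in_polynomials)
    then show ?thesis using hidealD(2)[OF hp] by auto
  qed
  have SR: "?S \<subseteq> carrier (polynomial_algebra (n + 2))" using S by (auto simp: multiples_def)
  interpret J: ideal "Idl\<^bsub>polynomial_algebra (n + 2)\<^esub> ?S" "polynomial_algebra (n + 2)"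
    by (rule genideal_ideal[OF SR])
  show ?thesis
  proof (rule subset_antisym)
    show "Idl\<^bsub>polynomial_algebra (n + 2)\<^esub> ?S \<subseteq> multiples (n + 2) fy"
      using genideal_minimal[OF ideal_image[OF hp] ] S hidealD(2)[OF hp] by simp
    show "multiples (n + 2) fy \<subseteq> Idl\<^bsub>polynomial_algebra (n + 2)\<^esub> ?S"
    proof
      fix F assume F: "F \<in> multiples (n + 2) fy"
      then obtain q where q: "F = fy * q" by (auto simp: multiples_def dvd_def)
      then have "q \<in> polynomials_in (n + 2)"
        using F polynomials_in_factor[of fy q "n + 2"] forms_polynomial[OF fy_forms] fy_nonzero
        by (simp add: multiples_def)
      moreover have "f \<in> multiples n f" using forms_polynomial[OF f(1)] by (simp add: multiples_def)
      then have "fy \<in> Idl\<^bsub>polynomial_algebra (n + 2)\<^esub> ?S"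
        using genideal_self[OF SR] unfolding fy_def by blast
      ultimately show "F \<in> Idl\<^bsub>polynomial_algebra (n + 2)\<^esub> ?S"
        using J.I_r_closed[of fy q] q by simp
    qed
  qed
qed

lemma segre_product_eq:
  assumes "ambient H = n" "vanishing_ideal H = multiples n f"
  shows "segre_product (projective_space 1) H = X"
proof -
  have e: "1 + n + 1 = n + 2" "2 * (n + 1) - 1 = D"
    "(\<lambda>q. Var (q div (n + 1)) * Var (2 + q mod (n + 1))) = seg"
    by (auto simp: D_def seg_def)
  have "{F \<in> polynomials_in D. substitute seg F \<in> multiples (n + 2) fy} = IX"
    unfolding IX_def using s.hom_polynomials by (auto simp: multiples_def)
  then show ?thesis
    unfolding segre_product_def projective_space_def Let_def projective_scheme.simps assms
      one_add_one e segre_ideal X_def by simp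
qed

lemma X_variety: "projective_variety X"
  using IX_prime Var0(2) by (auto simp: projective_variety_iff X_def relevant_def)

lemma X_presented: "presented_domain (coordinate_ring X) (residue X) D IX"
  using presented_domain_coordinate_ring[of X] IX_prime by (simp add: X_def)

lemma C_presented: "presented_domain (coordinate_ring C) (residue C) (n + 1) Q"
  using presented_domain_coordinate_ring[of C] prime' by (simp add: C_def)

lemma X_dimension: "dimension_of X = enat n"
proof -
  interpret presented_domain "coordinate_ring X" "residue X" D IX by (rule X_presented)
  obtain c where "\<And>t. hilb D IX t \<le> c * (t + 1) ^ n" using hilb_IX_upper by blast
  from krull_dim_by_growth[OF IX_prime this hilb_IX_lower] show ?thesis by (simp add: dimension_of_def)
qed

lemma X_genus: "arithmetic_genus X = - of_nat ((l - 1) choose n)"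
proof -
  interpret presented_domain "coordinate_ring X" "residue X" D IX by (rule X_presented)
  have "hilbert_polynomial (coordinate_ring X) = [:1, 1:] * hypersurface_poly n l"
    by (rule hilbert_polynomial_eqI[OF hprimeD(2)[OF IX_prime], of l]) (rule hilb_IX_poly)
  then have "arithmetic_genus X = (-1) ^ n * (- ((-1) ^ n * of_nat ((l - 1) choose n)))"
    unfolding arithmetic_genus_def X_dimension using hypersurface_poly_0[of l n] l by simp
  then show ?thesis by (simp flip: mult.assoc power_add mult_2)
qed

lemma C_facts:
  "projective_variety C" "dimension_of C = enat n"
  "arithmetic_genus C = of_nat ((l - 1) choose (n + 1))" "hypersurface (n + 1) l C"
  using hypersurface_invariants[of f n l C] f' f(2) prime' l by (simp_all add: C_def)

lemma birational_X_C: "birational X C"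
proof -
  interpret chart_pair "coordinate_ring X" "residue X" D IX "coordinate_ring C" "residue C" "n + 1" Q
    "\<lambda>F. F" "substitute beta" 1 2 "Var 0" "Var 0" 1 2
  proof (intro chart_pair.intro chart_pair_axioms.intro X_presented C_presented)
    show "graded_substitution (\<lambda>F :: 'k mpoly. F) (n + 1) D 1" by (rule i.graded_substitution_axioms)
    show "graded_substitution (substitute beta) D (n + 1) 2" by (rule b.graded_substitution_axioms)
    show "Var 0 \<in> forms D 1" "Var 0 \<in> forms (n + 1) 1" by (simp_all add: forms_Var del: One_nat_def)
    show "Var 0 \<notin> IX" "Var 0 \<notin> Q" by (rule Var0)+
    show "substitute beta (Var 0) = Var 0 ^ 2" by (simp add: beta_def power2_eq_square)
    fix F :: "'k mpoly" and d
    show "F \<in> IX" if F: "F \<in> Q"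
    proof -
      have FR: "F \<in> polynomials_in (n + 1)" using F by (simp add: multiples_def)
      have "f dvd substitute beta f" using beta_scaled[OF f'] by simp
      also have "substitute beta f dvd substitute beta F"
        using F by (intro dvd_substitute) (simp add: multiples_def)
      finally show ?thesis
        using i.hom_polynomials[OF FR] b.hom_polynomials[of F]
        by (simp add: IX_pullback b.pullback_def multiples_def)
    qed
    show "substitute beta F \<in> Q" if "F \<in> IX" using that by (simp add: IX_pullback b.pullback_def)
    show "substitute beta F - Var 0 ^ d * F \<in> Q" if "F \<in> forms (n + 1) d"
      using beta_scaled[OF that] by (simp add: multiples_def)
    show "substitute beta F - Var 0 ^ d * F \<in> IX" if F: "F \<in> forms D d"
    proof -
      have "substitute beta (substitute beta F) = Var 0 ^ (2 * d) * substitute beta F"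
        by (rule beta_scaled[OF b.hom_forms[OF F]])
      moreover have "substitute beta (Var 0 ^ d) = (Var 0 :: 'k mpoly) ^ (2 * d)"
        by (simp add: substitute_power beta_def power_mult power2_eq_square)
      ultimately have "substitute beta (substitute beta F - Var 0 ^ d * F) = 0"
        by (simp add: substitute_minus substitute_mult)
      moreover have "substitute beta F - Var 0 ^ d * F \<in> polynomials_in D"
        using i.hom_polynomials[OF b.hom_polynomials[OF forms_polynomial[OF F]]] forms_polynomial[OF F] by auto
      ultimately show ?thesis by (simp add: IX_pullback b.pullback_def multiples_def)
    qed
  qed simp
  show ?thesis
    unfolding birational_def X_dimension C_facts(2)
    using open_UA UA_nonempty UB_open_nonempty charts_isomorphic by blast
qed

end

section \<open>Birational varieties of different arithmetic genus\<close>

lemma hypersurface_segre: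
  fixes H :: "'k::field projective_scheme"
  assumes H: "hypersurface n l H" and n: "n \<ge> 1" and l: "l - 1 \<ge> n"
  shows "\<exists>H' :: 'k projective_scheme. let X = segre_product (projective_space 1) H in
    projective_variety X \<and> dimension_of X = enat n \<and>
    arithmetic_genus X = - of_nat ((l - 1) choose n) \<and>
    hypersurface (n + 1) l H' \<and> dimension_of H' = enat n \<and> birational X H' \<and>
    arithmetic_genus H' = of_nat ((l - 1) choose (n + 1))"
proof -
  obtain f where f: "f \<in> forms n l" "ring_irreducible\<^bsub>polynomial_algebra n\<^esub> f"
    and Hn: "projective_variety H" "ambient H = n" and Hf: "vanishing_ideal H = PIdl\<^bsub>polynomial_algebra n\<^esub> f"
    using H unfolding hypersurface_def grade_polynomial_algebra by blast
  have ne: "f \<noteq> 0" using f(2) by (simp add: ring_irreducible_def)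
  have HI: "vanishing_ideal H = multiples n f"
    unfolding Hf by (rule PIdl_eq_multiples[OF forms_polynomial[OF f(1)] ne])
  have "hprime n (multiples n f)" using Hn HI by (simp add: projective_variety_iff)
  then interpret segre_hypersurface n l f
    using n l f(1) ne by unfold_locales auto
  show ?thesis
    unfolding segre_product_eq[OF Hn(2) HI] Let_def
    using X_variety X_dimension X_genus C_facts birational_X_C by blast
qed

theorem corollary2p9:
  fixes n :: nat
  assumes "n \<ge> 4"
  shows
    "(\<forall>(l::nat) (H :: 'k::field projective_scheme).
        hypersurface n l H \<and> l - 1 \<ge> n \<longrightarrow>
          (let X = segre_product (projective_space 1) H
           in projective_variety X \<and>
              dimension_of X = enat n \<and>
              arithmetic_genus X = - of_nat ((l - 1) choose n) \<and>
              - (of_nat ((l - 1) choose n) :: rat) < 0 \<and>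
              (\<exists>(e::nat) (H' :: 'k projective_scheme).
                 hypersurface (n + 1) e H' \<and>
                 birational X H' \<and>
                 arithmetic_genus X \<noteq> arithmetic_genus H' \<and>
                 arithmetic_genus H' = of_nat ((e - 1) choose (n + 1)))))
     \<and>
     (\<exists>(l::nat) (H :: 'k projective_scheme) (e::nat) (H' :: 'k projective_scheme).
        hypersurface n l H \<and> l - 1 \<ge> n \<and> hypersurface (n + 1) e H' \<and>
        (let X = segre_product (projective_space 1) H
         in projective_variety X \<and> projective_variety H' \<and>
            dimension_of X = enat n \<and> dimension_of H' = enat n \<and>
            birational X H' \<and>
            arithmetic_genus X \<noteq> arithmetic_genus H'))"
proof (intro conjI allI impI)
  have main: "\<exists>H' :: 'k projective_scheme. let X = segre_product (projective_space 1) H in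
      projective_variety X \<and> dimension_of X = enat n \<and>
      arithmetic_genus X = - of_nat ((l - 1) choose n) \<and> - (of_nat ((l - 1) choose n) :: rat) < 0 \<and>
      hypersurface (n + 1) l H' \<and> dimension_of H' = enat n \<and> birational X H' \<and>
      arithmetic_genus X \<noteq> arithmetic_genus H' \<and> arithmetic_genus H' = of_nat ((l - 1) choose (n + 1))"
    if H: "hypersurface n l H \<and> l - 1 \<ge> n" for l and H :: "'k projective_scheme"
  proof -
    have "(0 :: rat) < of_nat ((l - 1) choose n)" using H by (simp add: zero_less_binomial_iff)
    moreover have "(0 :: rat) \<le> of_nat ((l - 1) choose (n + 1))" by simp
    moreover obtain H' :: "'k projective_scheme" where
      "let X = segre_product (projective_space 1) H in
        projective_variety X \<and> dimension_of X = enat n \<and>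
        arithmetic_genus X = - of_nat ((l - 1) choose n) \<and>
        hypersurface (n + 1) l H' \<and> dimension_of H' = enat n \<and> birational X H' \<and>
        arithmetic_genus H' = of_nat ((l - 1) choose (n + 1))"
      using hypersurface_segre[of n l H] H assms by auto
    moreover from calculation have "- rat_of_nat ((l - 1) choose n) \<noteq> of_nat ((l - 1) choose (n + 1))"
      by linarith
    ultimately show ?thesis unfolding Let_def by (intro exI[of _ H']) simp
  qed
  fix l and H :: "'k projective_scheme"
  assume "hypersurface n l H \<and> l - 1 \<ge> n"
  from main[OF this] show "let X = segre_product (projective_space 1) H
           in projective_variety X \<and>
              dimension_of X = enat n \<and>
              arithmetic_genus X = - of_nat ((l - 1) choose n) \<and>
              - (of_nat ((l - 1) choose n) :: rat) < 0 \<and>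
              (\<exists>(e::nat) (H' :: 'k projective_scheme).
                 hypersurface (n + 1) e H' \<and>
                 birational X H' \<and>
                 arithmetic_genus X \<noteq> arithmetic_genus H' \<and>
                 arithmetic_genus H' = of_nat ((e - 1) choose (n + 1)))"
    unfolding Let_def by blast
next
  obtain H :: "'k projective_scheme" where H: "hypersurface n (n + 1) H"
    using hypersurface_exists[of n "n + 1"] assms by auto
  obtain H' :: "'k projective_scheme" where H':
    "let X = segre_product (projective_space 1) H in
      projective_variety X \<and> dimension_of X = enat n \<and>
      arithmetic_genus X = - of_nat ((n + 1 - 1) choose n) \<and>
      hypersurface (n + 1) (n + 1) H' \<and> dimension_of H' = enat n \<and> birational X H' \<and>
      arithmetic_genus H' = of_nat ((n + 1 - 1) choose (n + 1))"
    using hypersurface_segre[OF H] assms by auto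
  have "projective_variety H'" using H' by (auto simp: hypersurface_def Let_def)
  then show "\<exists>(l::nat) (H :: 'k projective_scheme) (e::nat) (H' :: 'k projective_scheme).
        hypersurface n l H \<and> l - 1 \<ge> n \<and> hypersurface (n + 1) e H' \<and>
        (let X = segre_product (projective_space 1) H
         in projective_variety X \<and> projective_variety H' \<and>
            dimension_of X = enat n \<and> dimension_of H' = enat n \<and>
            birational X H' \<and>
            arithmetic_genus X \<noteq> arithmetic_genus H')"
    using H H' unfolding Let_def
    by (intro exI[of _ "n + 1"] exI[of _ H] exI[of _ H']) simp
qed

end
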